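(* Let $\omega=\omega_1\cdots\omega_s$ with $\omega_i\in\Omega$ for $i=1,\dots,s$. (i) If $u\in A_\infty$ and $0<p\le q<\infty$, then there is a constant $C=C(\omega,u,p,q)$ such that for every integer $n\ge1$ and every trigonometric polynomial $T_n$ of degree at most $n$, $$\|T_n\|_{L_q(\omega u)}\le C\,n^{1/p-1/q}\,\|T_n\|_{L_p((\omega u)^{p/q})}.$$ (ii) If $u\in A^*$ and $0<p<\infty$, then there is a constant $C=C(\omega,u,p)$ such that for every integer $n\ge1$ and every trigonometric polynomial $T_n$ of degree at most $n$, $$\|T_n\|_{L_\infty(\omega u)}\le C\,n^{1/p}\,\|T_n\|_{L_p((\omega u)^p)}.$$
   Context: $\mathbb{T}=\mathbb{R}/2\pi\mathbb{Z}$. A weight is a nonnegative integrable function on $\mathbb{T}$ (viewed also as a $2\pi$-periodic function on $\mathbb{R}$). $\|f\|_{L_p(w)}=\left(\int_{\mathbb{T}}|f|^pw\right)^{1/p}$ if $0<p<\infty$, $\|f\|_{L_\infty(w)}=\operatorname{ess\,sup}_{t\in\mathbb{T}}|f(t)w(t)|$. $A_\infty$: a weight $u$ is in $A_\infty$ if for every $\alpha>0$ there is $\beta>0$ such that $\int_Eu\ge\beta\int_Iu$ for any interval $I$ and any measurable set $E\subset I$ with $|E|\ge\alpha|I|$. $A^*$: a weight $u$ is in $A^*$ if there is a constant $L$ such that for all intervals $I\subset[-\pi,\pi]$ and all $t\in I$, $u(t)\le\frac{L}{|I|}\int_Iu$. Class $\Omega$: $\omega\in\Omega$ if $\omega(t)=\exp(-F(g(t)))$,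 $t\in\mathbb{T}$ (with $\omega(t)=0$ where $g(t)=0$), where for some $A>0$: - $g:\mathbb{T}\to[-A,A]$ is real analytic, i.e. for some $D>0$, $|g^{(n)}(t)|\le D^n n!$ for all $t\in\mathbb{T}$, $n\ge 1$; each zero of $g$ has multiplicity one; and $g$ has at least one zero on $\mathbb{T}$; - $F:[-A,A]\setminus\{0\}\to(0,\infty)$ is even, $C^\infty$ on $(0,A]$, and satisfies: (F1) $F(x)\to\infty$ as $x\to0+$; (F2) $F$ is decreasing on $(0,A]$; (F3) for some $B>0$, $|F^{(n)}(x)|\le B^n n^n F(x)/x^n$ for $x\in(0,A]$, $n=1,2,\dots$; (F4) there exist $A_1,A_2>0$ with $A_2\le |F'(x)|x/F(x)\le A_1$ for $x\in(0,A]$.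
   Formalization: A* is required for all intervals of the circle (I in some [c-π,c+π], u periodic), not only I⊂[-π,π]; otherwise (ii) fails, e.g. for u(t)=t+π on (-π,π), u(±π)=0, ω=exp(-1/|cos t|). *)

theory Defs
  imports "HOL-Probability.Essential_Supremum"
begin

text \<open>
  Functions on the circle are \<open>2 * pi\<close>-periodic functions on the reals; integrals over the
  circle are integrals over one period with respect to (unnormalised) Lebesgue measure.
\<close>

definition periodic_2pi :: "(real \<Rightarrow> 'a) \<Rightarrow> bool" where
  "periodic_2pi f \<longleftrightarrow> (\<forall>t. f (t + 2 * pi) = f t)"

definition weight :: "(real \<Rightarrow> real) \<Rightarrow> bool" where
  "weight u \<longleftrightarrow> periodic_2pi u \<and> (\<forall>t. 0 \<le> u t) \<and> integrable (lebesgue_on {-pi..pi}) u"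

definition trig_poly :: "nat \<Rightarrow> (real \<Rightarrow> complex) \<Rightarrow> bool" where
  "trig_poly n T \<longleftrightarrow>
     (\<exists>c :: int \<Rightarrow> complex. T = (\<lambda>t. \<Sum>k = - int n..int n. c k * cis (of_int k * t)))"

text \<open>
  For \<open>0 < p < \<infinity>\<close>. The value is the usual one when the integrand is integrable, in particular
  when \<open>f\<close> is a trigonometric polynomial and \<open>w\<close> is a weight.
\<close>
definition Lp_norm :: "real \<Rightarrow> (real \<Rightarrow> real) \<Rightarrow> (real \<Rightarrow> complex) \<Rightarrow> real" where
  "Lp_norm p w f =
     (integral\<^sup>L (lebesgue_on {-pi..pi}) (\<lambda>t. norm (f t) powr p * w t)) powr (1 / p)"

definition Linf_norm :: "(real \<Rightarrow> real) \<Rightarrow> (real \<Rightarrow> complex) \<Rightarrow> ereal" where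
  "Linf_norm w f = esssup (lebesgue_on {-pi..pi}) (\<lambda>t. ereal (norm (f t * of_real (w t))))"

definition A_infty :: "(real \<Rightarrow> real) set" where
  "A_infty = {u. weight u \<and>
     (\<forall>\<alpha>>0. \<exists>\<beta>>0. \<forall>I E. is_interval I \<longrightarrow> bounded I \<longrightarrow> E \<in> sets lebesgue \<longrightarrow> E \<subseteq> I \<longrightarrow>
        \<alpha> * measure lebesgue I \<le> measure lebesgue E \<longrightarrow>
        \<beta> * integral\<^sup>L (lebesgue_on I) u \<le> integral\<^sup>L (lebesgue_on E) u)}"

text \<open>
  An interval of the circle is an interval contained in some period \<open>[c - pi, c + pi]\<close>, so
  the points \<open>-pi\<close> and \<open>pi\<close> play no special role. Admitting only \<open>c = 0\<close> would also admit
  weights such as the periodic extension of \<open>t + pi\<close> (set to zero at the end points), which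
  are not doubling at the jump and hence not in \<open>A_infty\<close>. Degenerate intervals are excluded,
  as the mean value over \<open>I\<close> requires positive length.
\<close>
definition A_star :: "(real \<Rightarrow> real) set" where
  "A_star = {u. weight u \<and>
     (\<exists>L. \<forall>c I. is_interval I \<longrightarrow> I \<subseteq> {c - pi..c + pi} \<longrightarrow> 0 < measure lebesgue I \<longrightarrow>
        (\<forall>t\<in>I. u t \<le> L / measure lebesgue I * integral\<^sup>L (lebesgue_on I) u))}"

text \<open>
  \<open>d n\<close> is the \<open>n\<close>-th derivative of \<open>f\<close> on \<open>S\<close> for every \<open>n\<close>; in particular \<open>f\<close> is smooth on
  \<open>S\<close>. Derivatives are taken within \<open>S\<close>, hence one-sided at an end point belonging to \<open>S\<close>; on
  an interval of positive length they determine \<open>d\<close> uniquely.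
\<close>
definition derivs_on :: "real set \<Rightarrow> (real \<Rightarrow> real) \<Rightarrow> (nat \<Rightarrow> real \<Rightarrow> real) \<Rightarrow> bool" where
  "derivs_on S f d \<longleftrightarrow> (\<forall>x\<in>S. d 0 x = f x) \<and>
     (\<forall>n. \<forall>x\<in>S. (d n has_real_derivative d (Suc n) x) (at x within S))"

definition Omega_inner :: "real \<Rightarrow> (real \<Rightarrow> real) \<Rightarrow> bool" where
  "Omega_inner A g \<longleftrightarrow> periodic_2pi g \<and> (\<forall>t. g t \<in> {-A..A}) \<and> (\<exists>t. g t = 0) \<and>
     (\<exists>d. derivs_on UNIV g d \<and>
        (\<exists>D>0. \<forall>n\<ge>1. \<forall>t. \<bar>d n t\<bar> \<le> D ^ n * fact n) \<and>
        (\<forall>t. g t = 0 \<longrightarrow> d 1 t \<noteq> 0))"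

text \<open>The values of \<open>F\<close> at \<open>0\<close> and outside \<open>[-A, A]\<close> are irrelevant.\<close>
definition Omega_outer :: "real \<Rightarrow> (real \<Rightarrow> real) \<Rightarrow> bool" where
  "Omega_outer A F \<longleftrightarrow>
     (\<forall>x\<in>{-A..A} - {0}. 0 < F x \<and> F (- x) = F x) \<and>
     filterlim F at_top (at_right 0) \<and>
     antimono_on {0<..A} F \<and>
     (\<exists>d. derivs_on {0<..A} F d \<and>
        (\<exists>B>0. \<forall>x\<in>{0<..A}. \<forall>n\<ge>1. \<bar>d n x\<bar> \<le> B ^ n * real n ^ n * F x / x ^ n) \<and>
        (\<exists>A\<^sub>1>0. \<exists>A\<^sub>2>0. \<forall>x\<in>{0<..A}. A\<^sub>2 \<le> \<bar>d 1 x\<bar> * x / F x \<and> \<bar>d 1 x\<bar> * x / F x \<le> A\<^sub>1))"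

definition Omega_class :: "(real \<Rightarrow> real) set" where
  "Omega_class = {\<omega>. \<exists>A>0. \<exists>g F. Omega_inner A g \<and> Omega_outer A F \<and>
     \<omega> = (\<lambda>t. if g t = 0 then 0 else exp (- F (g t)))}"

end

theory Submission
  imports Defs "HOL-Complex_Analysis.Complex_Analysis" "HOL-Real_Asymp.Real_Asymp"
begin

text \<open>
  Write \<open>\<omega> = exp (- h)\<close>. The heart of the proof is a half-maximum property: for a trigonometric
  polynomial \<open>T\<close> of degree \<open>n\<close>, the function \<open>\<bar>T\<bar> \<omega>\<close> stays above half of its maximum on an interval
  of length \<open>\<epsilon> / n\<close> around a maximum point \<open>x\<close>. Remez' inequality shows that \<open>h(x) = O(n G)\<close>, where
  \<open>G\<close> is comparable to the distance of \<open>x\<close> from the zeros of \<open>\<omega>\<close>: otherwise the values of \<open>\<bar>T\<bar>\<close>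
  outside a gap around the nearest zero would be too small to allow the value at \<open>x\<close>. Hence
  \<open>h'' = O(n / G)\<close> near \<open>x\<close>, so that a Gaussian of variance comparable to \<open>G / n\<close> is tangent to
  \<open>\<omega>\<close> at \<open>x\<close> from above, and \<open>\<bar>T\<bar>\<close> times this Gaussian is also maximal at \<open>x\<close>. The maximum principle
  in a strip of width comparable to \<open>G\<close> then gives a Bernstein-type bound for the derivative of
  \<open>T\<close> times the Gaussian.

  Multiplying \<open>T\<close> by a power of a kernel peaked at \<open>t\<close> localises the half-maximum property: it bounds
  \<open>\<bar>T(t)\<bar> \<omega>(t)\<close> by the values of \<open>\<bar>T\<bar> \<omega>\<close> on an interval of length comparable to \<open>1 / n\<close>, with a
  polynomial decay in the distance from \<open>t\<close> that beats the polynomial growth coming from the doubling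
  property of \<open>u\<close>. As \<open>u\<close> is comparable to its mean on a large part of that interval, (ii) follows
  by integration, and (i) by summing over intervals of length \<open>2 \<pi> / n\<close> and embedding
  \<open>\<ell>\<^sup>p\<close> into \<open>\<ell>\<^sup>q\<close>.
\<close>

section \<open>Trigonometric polynomials as entire functions\<close>

text \<open>The obstacle is that \<omega> vanishes to infinite order, so it is not doubling and T
  can be exponentially large near its zeros. Remez' inequality is used with a single gap, yet
  \<omega> may have many zeros on the circle. T is therefore multiplied by a power, of order n, of
  \<open>(1 + cos (t - x)) / 2\<close>: while the degree stays O(n), this damps everything at a
  fixed distance from x by an exponential factor, strong enough to beat a crude bound exp(c n) for T
  obtained beforehand. Zeros of different factors may coincide; as they are simple, inner functions
  that are small at the same point are comparable there, so one gap serves all.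

  All exponents live on the scale n G: the size of h at the maximum, the Remez loss, and the growth
  (in the strip) and decay (at distance G) of the Gaussian. Since h is bounded below, h(x) = O(n G)
  also forces G to be at least of order 1 / n, which makes room for Cauchy discs of that radius.
  Part (i) needs the half-maximum property for \<open>\<omega> powr (1 / q)\<close>, available
  because \<Omega> is closed under positive powers.\<close>

definition trig_entire :: "nat \<Rightarrow> (complex \<Rightarrow> complex) \<Rightarrow> bool" where
  "trig_entire n f \<longleftrightarrow>
     (\<exists>c :: int \<Rightarrow> complex. f = (\<lambda>z. \<Sum>k = - int n..int n. c k * exp (\<i> * of_int k * z)))"

lemma trig_entire_exp:
  assumes "\<bar>k\<bar> \<le> int n"
  shows "trig_entire n (\<lambda>z. a * exp (\<i> * of_int k * z))"
proof -
  have "(\<lambda>z. a * exp (\<i> * of_int k * z)) =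
        (\<lambda>z. \<Sum>j = - int n..int n. (if j = k then a else 0) * exp (\<i> * of_int j * z))"
  proof
    fix z
    have "(\<Sum>j = - int n..int n. (if j = k then a else 0) * exp (\<i> * of_int j * z))
        = (\<Sum>j = - int n..int n. if j = k then a * exp (\<i> * of_int k * z) else 0)"
      by (intro sum.cong) auto
    also have "\<dots> = a * exp (\<i> * of_int k * z)"
      using assms by (subst sum.delta) auto
    finally show "a * exp (\<i> * of_int k * z) =
      (\<Sum>j = - int n..int n. (if j = k then a else 0) * exp (\<i> * of_int j * z))" by simp
  qed
  thus ?thesis unfolding trig_entire_def by (intro exI[of _ "\<lambda>j. if j = k then a else 0"])
qed

lemma trig_entire_add:
  assumes "trig_entire n f" "trig_entire n g"
  shows "trig_entire n (\<lambda>z. f z + g z)"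
proof -
  obtain c d where f: "f = (\<lambda>z. \<Sum>k = - int n..int n. c k * exp (\<i> * of_int k * z))"
    and g: "g = (\<lambda>z. \<Sum>k = - int n..int n. d k * exp (\<i> * of_int k * z))"
    using assms unfolding trig_entire_def by blast
  have "(\<lambda>z. f z + g z) = (\<lambda>z. \<Sum>k = - int n..int n. (c k + d k) * exp (\<i> * of_int k * z))"
    unfolding f g by (simp add: sum.distrib algebra_simps)
  thus ?thesis unfolding trig_entire_def by (intro exI[of _ "\<lambda>k. c k + d k"])
qed

lemma trig_entire_const: "trig_entire n (\<lambda>z. a)"
  using trig_entire_exp[of 0 n a] by simp

lemma trig_entire_sum:
  assumes "finite A" "\<And>i. i \<in> A \<Longrightarrow> trig_entire n (f i)"
  shows "trig_entire n (\<lambda>z. \<Sum>i\<in>A. f i z)"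
  using assms by (induction A rule: finite_induct) (auto intro: trig_entire_const trig_entire_add)

lemma trig_entire_mult:
  assumes "trig_entire n f" "trig_entire m g"
  shows "trig_entire (n + m) (\<lambda>z. f z * g z)"
proof -
  obtain c d where f: "f = (\<lambda>z. \<Sum>k = - int n..int n. c k * exp (\<i> * of_int k * z))"
    and g: "g = (\<lambda>z. \<Sum>k = - int m..int m. d k * exp (\<i> * of_int k * z))"
    using assms unfolding trig_entire_def by blast
  have eq: "(\<lambda>z. f z * g z) = (\<lambda>z. \<Sum>k = - int n..int n. \<Sum>l = - int m..int m.
             (c k * d l) * exp (\<i> * of_int (k + l) * z))"
    unfolding f g by (simp add: sum_product exp_add algebra_simps)
  show ?thesis unfolding eq
    by (intro trig_entire_sum trig_entire_exp) auto
qed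

lemma trig_entire_power:
  assumes "trig_entire n f"
  shows "trig_entire (k * n) (\<lambda>z. f z ^ k)"
proof (induction k)
  case 0
  show ?case using trig_entire_const[of 0 1] by simp
next
  case (Suc k)
  show ?case using trig_entire_mult[OF assms Suc] by simp
qed

lemma trig_entire_mono:
  assumes "trig_entire n f" "n \<le> m"
  shows "trig_entire m f"
  using trig_entire_mult[OF assms(1) trig_entire_const[of "m - n" 1]] assms(2) by simp

lemma trig_entire_cos: "trig_entire 1 (\<lambda>z. cos (z - of_real x))"
proof -
  have "trig_entire 1 (\<lambda>z. exp (-\<i> * of_real x) / 2 * exp (\<i> * of_int 1 * z)
      + exp (\<i> * of_real x) / 2 * exp (\<i> * of_int (-1) * z))"
    by (intro trig_entire_add trig_entire_exp) auto
  moreover have "(\<lambda>z. exp (-\<i> * of_real x) / 2 * exp (\<i> * of_int 1 * z)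
      + exp (\<i> * of_real x) / 2 * exp (\<i> * of_int (-1) * z)) = (\<lambda>z. cos (z - of_real x))"
    by (simp add: fun_eq_iff cos_exp_eq exp_diff exp_minus field_simps)
  ultimately show ?thesis by simp
qed

lemma trig_entire_reflect:
  assumes "trig_entire n f"
  shows "trig_entire n (\<lambda>z. f (- z))"
proof -
  obtain c where f: "f = (\<lambda>z. \<Sum>k = - int n..int n. c k * exp (\<i> * of_int k * z))"
    using assms unfolding trig_entire_def by blast
  have "trig_entire n (\<lambda>z. \<Sum>k = - int n..int n. c k * exp (\<i> * of_int (- k) * z))"
    by (intro trig_entire_sum trig_entire_exp) auto
  thus ?thesis unfolding f by simp
qed

lemma trig_entire_holomorphic: "trig_entire n f \<Longrightarrow> f holomorphic_on S"
  unfolding trig_entire_def by (auto intro!: holomorphic_intros)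

lemma trig_entire_continuous: "trig_entire n f \<Longrightarrow> continuous_on S f"
  by (intro holomorphic_on_imp_continuous_on trig_entire_holomorphic)

lemma trig_entire_periodic:
  assumes "trig_entire n f"
  shows "f (of_real (t + 2 * pi)) = f (of_real t)"
proof -
  obtain c where f: "f = (\<lambda>z. \<Sum>k = - int n..int n. c k * exp (\<i> * of_int k * z))"
    using assms unfolding trig_entire_def by blast
  have "exp (\<i> * of_int k * of_real (t + 2 * pi)) = exp (\<i> * of_int k * of_real t)" for k :: int
  proof -
    have "\<i> * of_int k * of_real (t + 2 * pi) = \<i> * of_int k * of_real t + (2 * of_int k * pi) * \<i>"
      by (simp add: algebra_simps)
    moreover have "exp \<dots> = exp (\<i> * of_int k * of_real t)"
      by (subst exp_add, subst exp_integer_2pi) auto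
    ultimately show ?thesis by metis
  qed
  thus ?thesis unfolding f by simp
qed

text \<open>With \<open>w = exp (\<i> * z)\<close> the function is \<open>w\<close> to the power
  \<open>- n\<close> times a polynomial \<open>P\<close> in \<open>w\<close>. The upper half-plane
  maps into the unit disc, and on the unit circle \<open>P\<close> has the modulus of
  \<open>f\<close> at a real point, so the maximum principle bounds \<open>P\<close> by
  \<open>M\<close>; the factor in front contributes \<open>exp (n * Im z)\<close>.\<close>

lemma trig_entire_bound_upper:
  assumes f: "trig_entire n f" and M: "\<And>t::real. norm (f (of_real t)) \<le> M" and z: "0 \<le> Im z"
  shows "norm (f z) \<le> M * exp (real n * Im z)"
proof -
  obtain c where c: "f = (\<lambda>z. \<Sum>k = - int n..int n. c k * exp (\<i> * of_int k * z))"
    using f unfolding trig_entire_def by blast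
  define P where "P w = (\<Sum>j\<le>2*n. c (int j - int n) * w ^ j)" for w :: complex
  have fP: "f z = exp (- \<i> * of_nat n * z) * P (exp (\<i> * z))" for z
  proof -
    have "f z = (\<Sum>j\<le>2*n. c (int j - int n) * exp (\<i> * of_int (int j - int n) * z))"
      unfolding c
      by (rule sum.reindex_bij_witness[of _ "\<lambda>j. int j - int n" "\<lambda>k. nat (k + int n)"])
         (simp_all add: nat_le_iff)
    also have "\<dots> = (\<Sum>j\<le>2*n. exp (- \<i> * of_nat n * z) * (c (int j - int n) * exp (\<i> * z) ^ j))"
    proof (intro sum.cong refl)
      fix j
      have "exp (- \<i> * of_nat n * z) * exp (\<i> * z) ^ j = exp (- \<i> * of_nat n * z + of_nat j * (\<i> * z))"
        by (simp only: exp_of_nat_mult exp_add)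
      also have "- \<i> * of_nat n * z + of_nat j * (\<i> * z) = \<i> * of_int (int j - int n) * z"
        by (simp add: algebra_simps)
      finally show "c (int j - int n) * exp (\<i> * of_int (int j - int n) * z)
        = exp (- \<i> * of_nat n * z) * (c (int j - int n) * exp (\<i> * z) ^ j)"
        by (metis mult.left_commute)
    qed
    finally show ?thesis unfolding P_def by (simp add: sum_distrib_left)
  qed
  have circ: "norm (P w) \<le> M" if "norm w = 1" for w
  proof -
    have "rcis (norm w) (Arg w) = w" by (rule rcis_cmod_Arg)
    hence w: "exp (\<i> * of_real (Arg w)) = w" using that by (simp add: rcis_def cis_conv_exp)
    have "norm (f (of_real (Arg w))) = norm (P w)"
      unfolding fP w by (simp add: norm_mult)
    thus ?thesis using M[of "Arg w"] by simp
  qed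
  have "norm (P (exp (\<i> * z))) \<le> M"
  proof (rule maximum_modulus_frontier[of P "cball 0 1"])
    show "P holomorphic_on interior (cball 0 1)" unfolding P_def by (intro holomorphic_intros)
    show "continuous_on (closure (cball 0 1)) P" unfolding P_def by (intro continuous_intros)
    show "exp (\<i> * z) \<in> cball 0 1" using z by simp
  qed (use circ in auto)
  moreover have "norm (exp (- \<i> * of_nat n * z)) = exp (real n * Im z)" by simp
  ultimately show ?thesis unfolding fP norm_mult
    by (metis mult.commute mult_right_mono exp_ge_zero)
qed

lemma trig_entire_bound:
  assumes f: "trig_entire n f" and M: "\<And>t::real. norm (f (of_real t)) \<le> M"
  shows "norm (f z) \<le> M * exp (real n * \<bar>Im z\<bar>)"
proof (cases "0 \<le> Im z")
  case True
  thus ?thesis using trig_entire_bound_upper[OF f M, of z] by simp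
next
  case False
  have "norm (f (- of_real t)) \<le> M" for t :: real using M[of "-t"] by simp
  from trig_entire_bound_upper[OF trig_entire_reflect[OF f], OF this, of "- z"] False
  show ?thesis by simp
qed

section \<open>Algebraic polynomials in the cosine and Remez' inequality\<close>

lemma cos_multiple_poly:
  "\<exists>p :: complex poly. degree p \<le> k \<and> (\<forall>z. poly p (cos z) = cos (of_nat k * z))"
proof (induction k rule: less_induct)
  case (less k)
  consider "k = 0" | "k = 1" | m where "k = Suc (Suc m)"
    by (metis One_nat_def not0_implies_Suc)
  thus ?case
  proof cases
    case 1
    thus ?thesis by (intro exI[of _ 1]) auto
  next
    case 2
    thus ?thesis by (intro exI[of _ "[:0, 1:]"]) auto
  next
    case 3
    obtain p :: "complex poly" where p: "degree p \<le> m" "\<And>z. poly p (cos z) = cos (of_nat m * z)"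
      using less.IH[of m] unfolding 3 by auto
    obtain q :: "complex poly" where q: "degree q \<le> Suc m" "\<And>z. poly q (cos z) = cos (of_nat (Suc m) * z)"
      using less.IH[of "Suc m"] unfolding 3 by auto
    \<comment> \<open>The Chebyshev recurrence: \<open>k = m + 2\<close>, and \<open>q\<close>,
      \<open>p\<close> belong to k - 1 and k - 2.\<close>
    have "degree ([:0, 2:] * q - p) \<le> k"
      using p q 3 by (intro degree_diff_le order.trans[OF degree_mult_le]) auto
    moreover have "poly ([:0, 2:] * q - p) (cos z) = cos (of_nat k * z)" for z
    proof -
      have "cos (of_nat k * z) + cos (of_nat m * z) = 2 * cos z * cos (of_nat (Suc m) * z)"
      proof -
        have e: "(of_nat k * z + of_nat m * z) / 2 = of_nat (Suc m) * z"
             "(of_nat k * z - of_nat m * z) / 2 = z" using 3 by (simp_all add: field_simps)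
        show ?thesis using cos_plus_cos[of "of_nat k * z" "of_nat m * z"] unfolding e by (simp only: mult_ac)
      qed
      thus ?thesis using p q by (simp add: algebra_simps)
    qed
    ultimately show ?thesis by blast
  qed
qed

lemma trig_entire_poly_cos:
  assumes "degree p \<le> n"
  shows "trig_entire n (\<lambda>z. poly p (a * cos z + b))"
proof -
  have 1: "trig_entire 1 (\<lambda>z. a * cos z + b)"
    using trig_entire_add[OF trig_entire_mult[OF trig_entire_const[of 0 a] trig_entire_cos[of 0]]
        trig_entire_const[of _ b]] by simp
  have "trig_entire n (\<lambda>z. \<Sum>i\<le>degree p. coeff p i * (a * cos z + b) ^ i)"
  proof (intro trig_entire_sum)
    fix i assume "i \<in> {..degree p}"
    hence "i \<le> n" using assms by auto
    moreover have "trig_entire i (\<lambda>z. coeff p i * (a * cos z + b) ^ i)"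
      using trig_entire_mult[OF trig_entire_const[of 0 "coeff p i"] trig_entire_power[OF 1, of i]] by simp
    ultimately show "trig_entire n (\<lambda>z. coeff p i * (a * cos z + b) ^ i)"
      using trig_entire_mono by blast
  qed auto
  thus ?thesis by (simp add: poly_altdef)
qed

text \<open>\<open>exp (\<i> * k * (x + y)) + exp (\<i> * k * (x - y))\<close> is
  \<open>2 * exp (\<i> * k * x) * cos (k * y)\<close>, and \<open>cos (k * y)\<close> is a
  polynomial of degree at most \<bar>k\<bar> in \<open>cos y\<close>. The symmetrisation keeps the
  value at \<open>y = 0\<close>, which is all that Remez' inequality has to estimate.\<close>

lemma trig_entire_even_part:
  assumes "trig_entire n f"
  shows "\<exists>p. degree p \<le> n \<and> (\<forall>y. poly p (cos y) = (f (x + y) + f (x - y)) / 2)"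
proof -
  obtain c where c: "f = (\<lambda>z. \<Sum>k = - int n..int n. c k * exp (\<i> * of_int k * z))"
    using assms unfolding trig_entire_def by blast
  obtain q :: "nat \<Rightarrow> complex poly" where q: "\<And>k. degree (q k) \<le> k"
      "\<And>k z. poly (q k) (cos z) = cos (of_nat k * z)"
    using cos_multiple_poly by metis
  define p where "p = (\<Sum>k = - int n..int n. smult (c k * exp (\<i> * of_int k * x)) (q (nat \<bar>k\<bar>)))"
  have "degree p \<le> n" unfolding p_def
  proof (intro degree_sum_le)
    fix k assume "k \<in> {- int n..int n}"
    hence "nat \<bar>k\<bar> \<le> n" by auto
    thus "degree (smult (c k * exp (\<i> * of_int k * x)) (q (nat \<bar>k\<bar>))) \<le> n"
      by (intro order.trans[OF degree_smult_le] order.trans[OF q(1)])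
  qed auto
  moreover have "poly p (cos y) = (f (x + y) + f (x - y)) / 2" for y
  proof -
    have cosk: "cos (of_int \<bar>k\<bar> * y) = cos (of_int k * y)" for k :: int
      by (cases "k \<ge> 0") auto
    have "poly p (cos y) = (\<Sum>k = - int n..int n. c k * exp (\<i> * of_int k * x) * cos (of_int k * y))"
      unfolding p_def by (simp add: poly_sum q cosk)
    also have "\<dots> = (\<Sum>k = - int n..int n. (c k * exp (\<i> * of_int k * (x + y)) + c k * exp (\<i> * of_int k * (x - y))) / 2)"
      by (intro sum.cong refl) (simp add: cos_exp_eq exp_add exp_diff exp_minus field_simps)
    also have "\<dots> = (f (x + y) + f (x - y)) / 2"
      unfolding c by (simp add: sum_divide_distrib [symmetric] sum.distrib)
    finally show ?thesis .
  qed
  ultimately show ?thesis by blast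
qed

text \<open>
  The even part of \<open>f\<close> about \<open>x\<close> is a polynomial in \<open>cos\<close>, bounded on \<open>[-1, cos (2 a)]\<close>. Mapping
  \<open>[-1, 1]\<close> affinely onto this interval turns it into another trigonometric polynomial, whose
  value at the point \<open>\<i> * \<eta>\<close> of the imaginary axis is \<open>f x\<close>.
\<close>
lemma remez_centre:
  assumes f: "trig_entire n f" and a: "0 < a" "a \<le> 1"
    and M: "\<And>y. 2 * a \<le> \<bar>y\<bar> \<Longrightarrow> \<bar>y\<bar> \<le> pi \<Longrightarrow> norm (f (of_real (x + y))) \<le> M"
  shows "norm (f (of_real x)) \<le> M * exp (4 * real n * a)"
proof -
  have pi: "pi > 2" using pi_gt3 by simp
  obtain p where p: "degree p \<le> n"
      "\<And>y. poly p (cos y) = (f (of_real x + y) + f (of_real x - y)) / 2"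
    using trig_entire_even_part[OF f] by blast
  have cosa: "cos a \<ge> 1/2"
  proof -
    have "cos (pi/3) \<le> cos a" using a pi_gt3 by (intro cos_monotone_0_pi_le) auto
    thus ?thesis by (simp add: cos_60)
  qed
  \<comment> \<open>The map \<open>c \<mapsto> l * c + (l - 1)\<close> takes [-1, 1] onto
    [-1, cos (2 a)], since \<open>2 * l - 1 = cos (2 * a)\<close>. The number \<eta> solves
    \<open>l * cosh \<eta> + l - 1 = 1\<close>: the argument of \<open>p\<close> is then
    \<open>cos 0\<close>, where the even part equals \<open>f x\<close>.\<close>
  define l where "l = (cos a)\<^sup>2"
  define \<eta> where "\<eta> = 2 * arsinh (tan a)"
  have l0: "l > 0" unfolding l_def using cosa by (intro zero_less_power) auto
  have cosh: "cosh \<eta> = 1 + 2 * (tan a)\<^sup>2"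
    using cosh_double_cosh[of "arsinh (tan a)"] cosh_square_eq[of "arsinh (tan a)"]
    by (simp add: \<eta>_def)
  have tan0: "tan a \<ge> 0" using a pi by (intro tan_pos_pi2_le) auto
  have "l * cosh \<eta> + l - 1 = 1"
  proof -
    have "l * (tan a)\<^sup>2 = (sin a)\<^sup>2" using cosa by (simp add: l_def tan_def power_divide)
    hence "l * cosh \<eta> = l + 2 * (sin a)\<^sup>2" by (simp add: cosh algebra_simps)
    moreover have "l + (sin a)\<^sup>2 = 1" by (simp add: l_def)
    ultimately show ?thesis by simp
  qed
  hence "complex_of_real (l * cosh \<eta> + l - 1) = 1" by simp
  hence at1: "of_real l * cosh (of_real \<eta>) + of_real (l - 1) = (1::complex)"
    by (simp add: cosh_def exp_of_real [symmetric] exp_minus add_diff_eq scaleR_conv_of_real)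
  \<comment> \<open>The 4 in the exponent: \<open>tan a \<le> 2 * a \<le> sinh (2 * a)\<close>, and
    \<eta> is twice \<open>arsinh (tan a)\<close>.\<close>
  have "\<eta> \<le> 4 * a"
  proof -
    have "tan a \<le> 2 * a"
    proof -
      have "sin a \<le> a" using a by (simp add: sin_x_le_x)
      moreover have "a \<le> 2 * a * cos a" using a cosa by simp
      ultimately have "sin a \<le> 2 * a * cos a" by linarith
      thus ?thesis using cosa by (simp add: tan_def field_simps)
    qed
    also have "\<dots> \<le> sinh (2 * a)"
    proof -
      have "2 * a \<le> (exp (2 * a) - inverse (exp (2 * a))) / 2" using a by (intro real_le_x_sinh) auto
      thus ?thesis by (simp add: sinh_field_def exp_minus)
    qed
    finally have "arsinh (tan a) \<le> arsinh (sinh (2*a))"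
      by (metis arsinh_less_iff_real not_less)
    thus ?thesis by (simp add: \<eta>_def arsinh_sinh_real)
  qed
  have \<eta>0: "\<eta> \<ge> 0" using tan0 unfolding \<eta>_def
    by (metis arsinh_real_neg_iff not_less mult_nonneg_nonneg zero_le_numeral)
  define U where "U z = poly p (of_real l * cos z + of_real (l - 1))" for z
  have U: "trig_entire n U" unfolding U_def by (intro trig_entire_poly_cos p)
  have cos2a: "cos (2 * a) = 2 * l - 1" by (simp add: l_def cos_double_cos)
  have Ub: "norm (U (of_real t)) \<le> M" for t
  proof -
    define w where "w = l * cos t + (l - 1)"
    have w: "-1 \<le> w" "w \<le> cos (2 * a)"
    proof -
      have "l * (-1) \<le> l * cos t" "l * cos t \<le> l * 1" using l0 by (intro mult_left_mono; simp)+
      thus "-1 \<le> w" "w \<le> cos (2 * a)" unfolding w_def cos2a by simp_all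
    qed
    hence w1: "w \<le> 1" using cos_le_one order_trans by blast
    define y where "y = arccos w"
    have y: "cos y = w" "2 * a \<le> y" "y \<le> pi"
    proof -
      show "cos y = w" using w w1 by (simp add: y_def cos_arccos)
      show "y \<le> pi" using w w1 by (simp add: y_def arccos_ubound)
      have "arccos (cos (2*a)) \<le> y" unfolding y_def using w w1 by (intro arccos_le_mono[THEN iffD2]) (auto simp: abs_le_iff)
      thus "2 * a \<le> y" using a pi by (simp add: arccos_cos)
    qed
    have "U (of_real t) = poly p (cos (of_real y))"
    proof -
      have "of_real l * cos (of_real t) + of_real (l - 1) = (of_real w :: complex)"
        by (simp only: w_def of_real_add of_real_mult cos_of_real)
      also have "\<dots> = cos (of_real y)" using y by (metis cos_of_real)
      finally show ?thesis by (simp only: U_def)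
    qed
    also have "\<dots> = (f (of_real (x + y)) + f (of_real (x + (- y)))) / 2" by (simp add: p)
    also have "norm \<dots> \<le> M"
    proof -
      have "norm (f (of_real (x + y))) \<le> M" "norm (f (of_real (x + (- y)))) \<le> M"
        using M[of y] M[of "-y"] y a by auto
      thus ?thesis using norm_triangle_ineq[of "f (of_real (x + y))" "f (of_real (x + (- y)))"]
        by (simp add: norm_divide)
    qed
    finally show ?thesis .
  qed
  have M0: "0 \<le> M" using Ub[of 0] norm_ge_zero order_trans by blast
  have "U (\<i> * of_real \<eta>) = f (of_real x)"
  proof -
    have "cos (\<i> * of_real \<eta>) = (cosh (of_real \<eta>) :: complex)"
      by (simp add: cosh_conv_cos)
    hence "U (\<i> * of_real \<eta>) = poly p (cos 0)" unfolding U_def by (simp only: at1 cos_zero)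
    also have "\<dots> = f (of_real x)" by (subst p) simp
    finally show ?thesis .
  qed
  hence "norm (f (of_real x)) \<le> M * exp (real n * \<bar>Im (\<i> * of_real \<eta>)\<bar>)"
    using trig_entire_bound[OF U Ub] by metis
  also have "\<dots> = M * exp (real n * \<eta>)" using \<eta>0 by simp
  also have "\<dots> \<le> M * exp (4 * real n * a)"
    using \<open>\<eta> \<le> 4 * a\<close> M0 mult_left_mono[OF \<open>\<eta> \<le> 4 * a\<close>, of "real n"]
    by (intro mult_left_mono) (auto simp: mult_ac)
  finally show ?thesis .
qed

text \<open>Only an \<open>x\<close> inside the gap needs an argument. Points at distance at least 2
  \<rho> from such an \<open>x\<close> have distance at least \<rho> from \<open>x0\<close>, which
  is why the centred version has the gap \<open>2 * a\<close>. A point \<open>x + y\<close> beyond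
  the period about \<open>x0\<close> is moved back by \<open>2 * pi\<close>; as \<rho> is at most 1,
  it lands outside the gap.\<close>

lemma remez:
  assumes f: "trig_entire n f" and \<rho>: "0 < \<rho>" "\<rho> \<le> 1" and x: "\<bar>x - x0\<bar> \<le> pi"
    and M: "\<And>t. \<rho> \<le> \<bar>t - x0\<bar> \<Longrightarrow> \<bar>t - x0\<bar> \<le> pi \<Longrightarrow> norm (f (of_real t)) \<le> M"
  shows "norm (f (of_real x)) \<le> M * exp (4 * real n * \<rho>)"
proof (cases "\<rho> \<le> \<bar>x - x0\<bar>")
  case True
  hence b: "norm (f (of_real x)) \<le> M" using M x by blast
  hence "M \<ge> 0" using norm_ge_zero order_trans by blast
  hence "M * 1 \<le> M * exp (4 * real n * \<rho>)" using \<rho> by (intro mult_left_mono) auto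
  thus ?thesis using b by simp
next
  case False
  show ?thesis
  proof (rule remez_centre[OF f \<rho>])
    fix y :: real assume y: "2 * \<rho> \<le> \<bar>y\<bar>" "\<bar>y\<bar> \<le> pi"
    have pi: "pi > 3" by (rule pi_gt3)
    have p: "f (of_real (t + 2 * pi)) = f (of_real t)" for t
      by (rule trig_entire_periodic[OF f])
    show "norm (f (of_real (x + y))) \<le> M"
    proof (cases "\<bar>x + y - x0\<bar> \<le> pi")
      case True
      thus ?thesis using False y by (intro M) auto
    next
      case F2: False
      show ?thesis
      proof (cases "x + y - x0 > 0")
        case True
        have "norm (f (of_real (x + y - 2 * pi))) \<le> M"
          using False y \<rho> F2 True pi by (intro M) auto
        thus ?thesis using p[of "x + y - 2 * pi"] by simp
      next
        case F3: False
        have "norm (f (of_real (x + y + 2 * pi))) \<le> M"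
          using False y \<rho> F2 F3 pi by (intro M) auto
        thus ?thesis using p[of "x + y"] by simp
      qed
    qed
  qed
qed

section \<open>Trigonometric polynomials times a Gaussian\<close>

lemma norm_gauss:
  "norm (exp (- of_real b * (z - of_real a)\<^sup>2)) = exp (- b * ((Re z - a)\<^sup>2 - (Im z)\<^sup>2))"
  by (simp add: power2_eq_square algebra_simps)

text \<open>
  Maximum principle for \<open>f z * exp (- b * (z - a)\<^sup>2 + \<i> * L * z)\<close> on the strip \<open>0 \<le> Im z \<le> R\<close>,
  where the Gaussian makes this function vanish at infinity.
\<close>
lemma strip_bound_upper:
  assumes f: "trig_entire N f" and B: "\<And>t::real. norm (f (of_real t)) \<le> B" and b: "0 < b"
    and M: "\<And>t::real. norm (f (of_real t)) * exp (- b * (t - a)\<^sup>2) \<le> M"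
    and L: "B * exp (real N * R + b * R\<^sup>2 - L * R) \<le> M" and R: "0 < R"
    and z: "0 \<le> Im z" "Im z \<le> R"
  shows "norm (f z * exp (- of_real b * (z - of_real a)\<^sup>2)) \<le> M * exp (L * Im z)"
proof (cases "B = 0")
  case True
  have "norm (f z) \<le> 0" using trig_entire_bound[OF f B, of z] True by simp
  moreover have "M \<ge> 0" using L True by simp
  ultimately show ?thesis by simp
next
  case False
  hence B0: "B > 0" using B[of 0] norm_ge_zero[of "f (of_real 0)"] by linarith
  have M0: "M > 0" using L B0 by (smt (verit) exp_gt_zero mult_pos_pos)
  define u where "u w = f w * exp (- of_real b * (w - of_real a)\<^sup>2) * exp (\<i> * of_real L * w)" for w
  have nu: "norm (u w) = norm (f w) * exp (- b * ((Re w - a)\<^sup>2 - (Im w)\<^sup>2)) * exp (- L * Im w)" for w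
    unfolding u_def norm_mult norm_gauss by simp
  \<comment> \<open>Bounds all factors of \<open>u\<close> on the vertical sides
    \<open>Re w = a - X\<close> and \<open>Re w = a + X\<close> except
    \<open>exp (- b * X\<^sup>2)\<close>, which wins for large \<open>X\<close>. The sign of
    \<open>L\<close> is unknown, hence \<open>\<bar>L\<bar>\<close>.\<close>
  define E where "E = B * exp (real N * R + b * R\<^sup>2 + \<bar>L\<bar> * R)"
  have E0: "E > 0" using B0 by (simp add: E_def)
  have "((\<lambda>X. E * exp (- b * X\<^sup>2)) \<longlongrightarrow> 0) at_top"
    using b by real_asymp
  hence "eventually (\<lambda>X. E * exp (- b * X\<^sup>2) < M) at_top"
    using M0 by (rule order_tendstoD)
  moreover have "eventually (\<lambda>X. X > \<bar>Re z - a\<bar>) at_top" by (rule eventually_gt_at_top)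
  ultimately have "eventually (\<lambda>X. E * exp (- b * X\<^sup>2) < M \<and> X > \<bar>Re z - a\<bar>) at_top"
    by (rule eventually_conj)
  then obtain X where X: "E * exp (- b * X\<^sup>2) < M" "X > \<bar>Re z - a\<bar>"
    using eventually_happens trivial_limit_at_top_linorder by blast
  define S where "S = cbox (Complex (a - X) 0) (Complex (a + X) R)"
  have zS: "z \<in> S" using z X unfolding S_def in_cbox_complex_iff by auto
  have "norm (u z) \<le> M"
  proof (rule maximum_modulus_frontier[of u S])
    show "u holomorphic_on interior S" unfolding u_def
      by (intro holomorphic_intros trig_entire_holomorphic[OF f])
    show "continuous_on (closure S) u" unfolding u_def
      by (intro continuous_intros trig_entire_continuous[OF f])
    show "bounded S" by (simp add: S_def)
    show "z \<in> S" by (rule zS)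
    fix w assume "w \<in> frontier S"
    hence w: "Re w \<in> {a - X..a + X}" "Im w \<in> {0..R}"
       and w': "Re w = a - X \<or> Re w = a + X \<or> Im w = 0 \<or> Im w = R"
      unfolding S_def frontier_cbox by (auto simp: in_cbox_complex_iff in_box_complex_iff)
    have fw: "norm (f w) \<le> B * exp (real N * Im w)"
      using trig_entire_bound[OF f B, of w] w by simp
    have g: "exp (- b * (x - y)) = exp (- b * x) * exp (b * y)" for x y :: real
      by (simp add: exp_add [symmetric] algebra_simps)
    consider "Im w = 0" | "Im w = R" | "(Re w - a)\<^sup>2 = X\<^sup>2" using w' by (auto simp: power2_commute)
    thus "norm (u w) \<le> M"
    proof cases
      case 1
      hence "w = of_real (Re w)" by (simp add: complex_eq_iff)
      thus ?thesis unfolding nu using M[of "Re w"] 1 by (metis exp_zero diff_zero mult.right_neutral mult_zero_right power_zero_numeral)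
    next
      \<comment> \<open>The side \<open>Im w = R\<close>: here \<open>f\<close> has gained at most
        \<open>exp (N * R)\<close> and the Gaussian \<open>exp (b * R\<^sup>2)\<close>. The
        assumption on \<open>L\<close> says that \<open>exp (- L * R)\<close> makes up for both and
        for the ratio \<open>B / M\<close>.\<close>
      case 2
      have "norm (u w) \<le> (B * exp (real N * R)) * exp (b * R\<^sup>2) * exp (- L * R)"
        unfolding nu using fw 2 b B0
        by (intro mult_mono) (auto simp: mult_left_mono algebra_simps)
      also have "\<dots> = B * exp (real N * R + b * R\<^sup>2 - L * R)"
        by (simp add: exp_add [symmetric])
      finally show ?thesis using L by simp
    next
      case 3
      have "norm (u w) \<le> (B * exp (real N * R)) * exp (- b * X\<^sup>2 + b * R\<^sup>2) * exp (\<bar>L\<bar> * R)"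
      proof (unfold nu, intro mult_mono)
        have "real N * Im w \<le> real N * R" using w by (intro mult_left_mono) auto
        hence "B * exp (real N * Im w) \<le> B * exp (real N * R)" using B0 by simp
        thus "norm (f w) \<le> B * exp (real N * R)" using fw by linarith
        have "(Im w)\<^sup>2 \<le> R\<^sup>2" using w by (intro power_mono) auto
        thus "exp (- b * ((Re w - a)\<^sup>2 - (Im w)\<^sup>2)) \<le> exp (- b * X\<^sup>2 + b * R\<^sup>2)"
          using b 3 by (simp add: algebra_simps)
        have "- L * Im w \<le> \<bar>L\<bar> * Im w" using w by (intro mult_right_mono) auto
        also have "\<dots> \<le> \<bar>L\<bar> * R" using w by (intro mult_left_mono) auto
        finally show "exp (- L * Im w) \<le> exp (\<bar>L\<bar> * R)" by simp
      qed (use B0 in auto)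
      also have "\<dots> = E * exp (- b * X\<^sup>2)"
        by (simp add: E_def exp_add [symmetric] algebra_simps exp_diff exp_minus divide_inverse)
      finally show ?thesis using X by simp
    qed
  qed
  hence "norm (f z * exp (- of_real b * (z - of_real a)\<^sup>2)) * exp (- L * Im z) \<le> M"
    unfolding u_def norm_mult by simp
  hence "norm (f z * exp (- of_real b * (z - of_real a)\<^sup>2)) * exp (- L * Im z) * exp (L * Im z) \<le> M * exp (L * Im z)"
    by (rule mult_right_mono) simp
  thus ?thesis by (simp only: mult.assoc mult_exp_exp) simp
qed

lemma strip_bound:
  assumes f: "trig_entire N f" and B: "\<And>t::real. norm (f (of_real t)) \<le> B" and b: "0 < b"
    and M: "\<And>t::real. norm (f (of_real t)) * exp (- b * (t - a)\<^sup>2) \<le> M"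
    and L: "B * exp (real N * R + b * R\<^sup>2 - L * R) \<le> M" and R: "0 < R"
    and z: "\<bar>Im z\<bar> \<le> R"
  shows "norm (f z * exp (- of_real b * (z - of_real a)\<^sup>2)) \<le> M * exp (L * \<bar>Im z\<bar>)"
proof (cases "0 \<le> Im z")
  case True
  thus ?thesis using strip_bound_upper[OF f B b M L R, of z] z by simp
next
  case False
  have B': "norm (f (- of_real t)) \<le> B" for t :: real using B[of "-t"] by simp
  have M': "norm (f (- of_real t)) * exp (- b * (t - (- a))\<^sup>2) \<le> M" for t :: real
    using M[of "- t"] by (simp add: power2_commute add.commute)
  from strip_bound_upper[OF trig_entire_reflect[OF f] B' b M' L R, of "- z"] False z
  show ?thesis by (simp add: power2_eq_square algebra_simps)
qed

text \<open>
  Cauchy's estimate for the derivative of \<open>f z * exp (- b * (z - a)\<^sup>2)\<close> turns the strip bound into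
  a lower bound near a point where the maximum \<open>M\<close> is attained.
\<close>
lemma near_maximum:
  assumes f: "trig_entire N f" and B: "\<And>t::real. norm (f (of_real t)) \<le> B" and b: "0 < b"
    and M: "\<And>t::real. norm (f (of_real t)) * exp (- b * (t - a)\<^sup>2) \<le> M"
    and L: "B * exp (real N * R + b * R\<^sup>2 - L * R) \<le> M"
    and r: "0 < r" "r \<le> R" and L0: "0 \<le> L"
    and x0: "norm (f (of_real x0)) * exp (- b * (x0 - a)\<^sup>2) = M"
    and y: "\<bar>y - x0\<bar> \<le> r / (2 * exp (L * r))"
  shows "M / 2 \<le> norm (f (of_real y)) * exp (- b * (y - a)\<^sup>2)"
proof -
  define u where "u w = f w * exp (- of_real b * (w - of_real a)\<^sup>2)" for w
  have R: "0 < R" using r by simp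
  have M0: "0 \<le> M" using x0 by (metis exp_ge_zero mult_nonneg_nonneg norm_ge_zero)
  have nu: "norm (u (of_real t)) = norm (f (of_real t)) * exp (- b * (t - a)\<^sup>2)" for t
    unfolding u_def norm_mult norm_gauss by simp
  have hol: "u holomorphic_on S" for S
    unfolding u_def by (intro holomorphic_intros trig_entire_holomorphic[OF f])
  have d: "norm (deriv u (of_real t)) \<le> M * exp (L * r) / r" for t :: real
  proof -
    have "norm ((deriv ^^ 1) u (of_real t)) \<le> fact 1 * (M * exp (L * r)) / r ^ 1"
    proof (rule Cauchy_inequality)
      show "u holomorphic_on ball (of_real t) r" by (rule hol)
      show "continuous_on (cball (of_real t) r) u" by (intro holomorphic_on_imp_continuous_on hol)
      show "0 < r" by fact
      fix w :: complex assume w: "norm (of_real t - w) = r"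
      have "\<bar>Im w\<bar> \<le> r" using abs_Im_le_cmod[of "of_real t - w"] w by simp
      hence "norm (u w) \<le> M * exp (L * \<bar>Im w\<bar>)"
        unfolding u_def using r by (intro strip_bound[OF f B b M L R]) auto
      also have "\<dots> \<le> M * exp (L * r)"
        using \<open>\<bar>Im w\<bar> \<le> r\<close> M0 L0 by (intro mult_left_mono) (auto intro: mult_left_mono)
      finally show "norm (u w) \<le> M * exp (L * r)" .
    qed
    thus ?thesis by simp
  qed
  have "norm (u (of_real y) - u (of_real x0)) \<le> (M * exp (L * r) / r) * norm (of_real y - of_real x0 :: complex)"
  proof (rule field_differentiable_bound[of "closed_segment (of_real x0) (of_real y)"])
    fix w :: complex assume w: "w \<in> closed_segment (of_real x0) (of_real y)"
    then obtain t where "w = of_real t" by (auto simp: closed_segment_of_real)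
    thus "norm (deriv u w) \<le> M * exp (L * r) / r" using d by simp
    show "(u has_field_derivative deriv u w) (at w within closed_segment (of_real x0) (of_real y))"
      using holomorphic_derivI[OF hol[of UNIV], of w] has_field_derivative_at_within by auto
  qed auto
  also have "norm (of_real y - of_real x0 :: complex) = \<bar>y - x0\<bar>"
    by (metis norm_of_real of_real_diff)
  also have "(M * exp (L * r) / r) * \<bar>y - x0\<bar> \<le> (M * exp (L * r) / r) * (r / (2 * exp (L * r)))"
    using y r M0 by (intro mult_left_mono) auto
  also have "\<dots> = M / 2" using r by simp
  finally have "norm (u (of_real y) - u (of_real x0)) \<le> M / 2" .
  moreover have "norm (u (of_real x0)) = M" using nu x0 by simp
  moreover have "norm (u (of_real x0)) \<le> norm (u (of_real y)) + norm (u (of_real y) - u (of_real x0))"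
    by (metis norm_minus_commute norm_triangle_sub)
  ultimately show ?thesis using nu[of y] by linarith
qed

section \<open>The half-maximum property\<close>

lemma periodic_int:
  assumes "\<And>t::real. f (t + 2 * pi) = f t"
  shows "f (t + 2 * pi * of_int k) = f t"
proof -
  have n: "f (t + 2 * pi * real m) = f t" for t m
  proof (induction m)
    case (Suc m)
    have "f (t + 2 * pi * real (Suc m)) = f ((t + 2 * pi * real m) + 2 * pi)"
      by (simp add: algebra_simps)
    thus ?case using assms Suc by simp
  qed simp
  show ?thesis
  proof (cases "k \<ge> 0")
    case True
    thus ?thesis using n[of t "nat k"] by simp
  next
    case False
    thus ?thesis using n[of "t + 2 * pi * of_int k" "nat (- k)"] by (simp add: algebra_simps)
  qed
qed

lemma reduce_2pi:
  obtains k :: int where "\<bar>t + 2 * pi * of_int k - x0\<bar> \<le> pi"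
proof
  define j where "j = \<lfloor>(t - x0 + pi) / (2 * pi)\<rfloor>"
  have "of_int j \<le> (t - x0 + pi) / (2 * pi)" "(t - x0 + pi) / (2 * pi) < of_int j + 1"
    unfolding j_def by linarith+
  hence "of_int j * (2 * pi) \<le> t - x0 + pi" "t - x0 + pi < (of_int j + 1) * (2 * pi)"
    using pi_gt_zero by (simp_all add: pos_le_divide_eq pos_divide_less_eq)
  thus "\<bar>t + 2 * pi * of_int (- j) - x0\<bar> \<le> pi" by (simp add: algebra_simps abs_le_iff)
qed

lemma periodic_bound:
  assumes "\<And>t::real. f (t + 2 * pi) = f t" and "\<And>t. \<bar>t - c\<bar> \<le> pi \<Longrightarrow> P (f t)"
  shows "P (f t)"
proof -
  obtain k :: int where "\<bar>t + 2 * pi * of_int k - c\<bar> \<le> pi" using reduce_2pi[of t c] by blast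
  from assms(2)[OF this] show ?thesis by (simp only: periodic_int[of f, OF assms(1)])
qed

text \<open>The damping device. The factor is 1 at \<open>x\<close> and lies in [0, 1] on the real
  line, so it keeps the value at \<open>x\<close> and increases no other; a power proportional to n
  is exponentially small at a fixed distance from \<open>x\<close> while the degree stays
  O(n).\<close>

lemma trig_entire_raised_cos:
  assumes "trig_entire n f"
  shows "trig_entire (n + j) (\<lambda>z. f z * ((1 + cos (z - of_real x)) / 2) ^ j)"
proof -
  have "trig_entire 1 (\<lambda>z. 1/2 + 1/2 * cos (z - of_real x))"
    using trig_entire_mult[OF trig_entire_const[of 0 "1/2"] trig_entire_cos[of x]]
    by (intro trig_entire_add trig_entire_const) simp
  hence "trig_entire 1 (\<lambda>z. (1 + cos (z - of_real x)) / 2)"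
    by (simp add: add_divide_distrib)
  from trig_entire_mult[OF assms trig_entire_power[OF this, of j]] show ?thesis by simp
qed

lemma norm_raised_cos:
  "norm ((w::complex) * ((1 + cos (of_real t - of_real x)) / 2) ^ j) = norm w * ((1 + cos (t - x)) / 2) ^ j"
proof -
  have "(1 + cos (of_real t - of_real x)) / 2 = (of_real ((1 + cos (t - x)) / 2) :: complex)"
    by (simp add: cos_of_real flip: of_real_diff)
  moreover have "0 \<le> (1 + cos (t - x)) / 2" by (smt (verit) cos_ge_minus_one divide_nonneg_nonneg)
  ultimately show ?thesis by (simp only: norm_mult norm_power norm_of_real abs_of_nonneg)
qed

lemma raised_cos_nonneg: "0 \<le> (1 + cos (t::real)) / 2"
  by (smt (verit) cos_ge_minus_one divide_nonneg_nonneg)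

lemma raised_cos_le_one: "(1 + cos (t::real)) / 2 \<le> 1"
  by simp

lemma raised_cos_power_le_one: "((1 + cos (t::real)) / 2) ^ j \<le> 1"
  by (intro power_le_one raised_cos_nonneg raised_cos_le_one)

lemma cos_le_of_abs_ge:
  assumes "0 \<le> \<eta>" "\<eta> \<le> \<bar>t\<bar>" "\<bar>t\<bar> \<le> pi"
  shows "cos t \<le> cos \<eta>"
  using cos_monotone_0_pi_le[of \<eta> "\<bar>t\<bar>"] assms by simp

lemma trig_entire_max:
  assumes f: "trig_entire n f" and w: "continuous_on UNIV w" and per: "\<And>t. w (t + 2 * pi) = w t"
  shows "\<exists>x0. \<forall>t::real. norm (f (of_real t)) * w t \<le> norm (f (of_real x0)) * w x0"
proof -
  have "continuous_on {-pi..pi} (\<lambda>t::real. norm (f (of_real t)) * w t)"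
    by (intro continuous_intros continuous_on_compose2[OF trig_entire_continuous[OF f, of UNIV]]
        continuous_on_subset[OF w]) auto
  from continuous_attains_sup[OF _ _ this] obtain x0
    where x0: "\<forall>t\<in>{-pi..pi}. norm (f (of_real t)) * w t \<le> norm (f (of_real x0)) * w x0"
    by auto
  show ?thesis
  proof (intro exI[of _ x0] allI)
    fix t :: real
    show "norm (f (of_real t)) * w t \<le> norm (f (of_real x0)) * w x0"
      by (rule periodic_bound[where c = 0 and f = "\<lambda>t. norm (f (of_real t)) * w t"
            and P = "\<lambda>s. s \<le> norm (f (of_real x0)) * w x0"])
         (use trig_entire_periodic[OF f] per in simp, intro x0[rule_format], auto)
  qed
qed

lemma concave_tangent_max:
  fixes \<phi> \<phi>' \<phi>'' :: "real \<Rightarrow> real"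
  assumes d1: "\<And>x. \<bar>x - x0\<bar> \<le> R \<Longrightarrow> (\<phi> has_real_derivative \<phi>' x) (at x)"
    and d2: "\<And>x. \<bar>x - x0\<bar> \<le> R \<Longrightarrow> (\<phi>' has_real_derivative \<phi>'' x) (at x)"
    and le: "\<And>x. \<bar>x - x0\<bar> \<le> R \<Longrightarrow> \<phi>'' x \<le> 0" and 0: "\<phi>' x0 = 0" and x: "\<bar>x - x0\<bar> \<le> R"
  shows "\<phi> x \<le> \<phi> x0"
proof -
  have anti: "\<phi>' v \<le> \<phi>' u" if "u \<le> v" "\<bar>u - x0\<bar> \<le> R" "\<bar>v - x0\<bar> \<le> R" for u v
  proof (rule DERIV_nonpos_imp_nonincreasing[OF that(1)])
    fix w assume "u \<le> w" "w \<le> v"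
    hence "\<bar>w - x0\<bar> \<le> R" using that by auto
    thus "\<exists>y. (\<phi>' has_real_derivative y) (at w) \<and> y \<le> 0" using d2 le by blast
  qed
  show ?thesis
  proof (cases "x0 \<le> x")
    case True
    show ?thesis
    proof (rule DERIV_nonpos_imp_nonincreasing[OF True])
      fix w assume "x0 \<le> w" "w \<le> x"
      hence "\<bar>w - x0\<bar> \<le> R" using x by auto
      moreover have "\<phi>' w \<le> 0" using anti[of x0 w] 0 \<open>x0 \<le> w\<close> calculation by auto
      ultimately show "\<exists>y. (\<phi> has_real_derivative y) (at w) \<and> y \<le> 0" using d1 by blast
    qed
  next
    case False
    hence "x \<le> x0" by simp
    thus ?thesis
    proof (rule DERIV_nonneg_imp_nondecreasing)
      fix w assume "x \<le> w" "w \<le> x0"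
      hence "\<bar>w - x0\<bar> \<le> R" using x by auto
      moreover have "0 \<le> \<phi>' w" using anti[of w x0] 0 \<open>w \<le> x0\<close> calculation by auto
      ultimately show "\<exists>y. (\<phi> has_real_derivative y) (at w) \<and> 0 \<le> y" using d1 by blast
    qed
  qed
qed

text \<open>Abstracts the factors \<open>exp (- F (g t))\<close> of \<omega>: \<open>g i\<close> is
  the inner function, \<open>H i\<close> the composition of F with it, \<open>H1 i\<close> and
  \<open>H2 i\<close> its derivatives off the zeros; one constant \<open>C\<close> serves all.
  \<open>g_separation\<close> is the quantitative form of simple zeros: with
  \<open>g i x = 0\<close> it makes \<bar>g i\<bar> grow at least linearly near \<open>x\<close>.
  \<open>g_pair\<close> says that two inner functions that are both small at a point are comparable
  there, in effect because of a common zero nearby. \<open>H_decay\<close> and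
  \<open>H_doubling\<close> compare \<open>H i\<close> with the powers of \<bar>g i\<bar> of
  exponents \<open>- 1 / C\<close> and \<open>- C\<close>.\<close>

locale tame_family =
  fixes I :: "'i set" and g H H1 H2 :: "'i \<Rightarrow> real \<Rightarrow> real" and C :: real and \<omega> :: "real \<Rightarrow> real"
  assumes finite_I: "finite I" and nonempty_I: "I \<noteq> {}" and C_ge_1: "1 \<le> C"
    and g_periodic: "i \<in> I \<Longrightarrow> g i (x + 2 * pi) = g i x"
    and g_lipschitz: "i \<in> I \<Longrightarrow> \<bar>g i x - g i y\<bar> \<le> C * \<bar>x - y\<bar>"
    and g_separation: "i \<in> I \<Longrightarrow> \<bar>x - y\<bar> \<le> 1 / C \<Longrightarrow> \<bar>x - y\<bar> / C \<le> \<bar>g i x\<bar> + \<bar>g i y\<bar>"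
    and g_pair: "i \<in> I \<Longrightarrow> k \<in> I \<Longrightarrow> 1 / C \<le> \<bar>g i x\<bar> \<or> 1 / C \<le> \<bar>g k x\<bar> \<or> \<bar>g i x\<bar> \<le> C * \<bar>g k x\<bar>"
    and H_lower: "i \<in> I \<Longrightarrow> g i x \<noteq> 0 \<Longrightarrow> 1 / C \<le> H i x"
    and H_decay: "i \<in> I \<Longrightarrow> g i x \<noteq> 0 \<Longrightarrow> \<bar>g i x\<bar> \<le> \<bar>g i y\<bar> \<Longrightarrow>
           H i y \<le> (\<bar>g i x\<bar> / \<bar>g i y\<bar>) powr (1 / C) * H i x"
    and H_doubling: "i \<in> I \<Longrightarrow> g i x \<noteq> 0 \<Longrightarrow> \<bar>g i x\<bar> \<le> \<bar>g i y\<bar> \<Longrightarrow>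
           H i x \<le> (\<bar>g i y\<bar> / \<bar>g i x\<bar>) powr C * H i y"
    and H_bounded: "0 < \<gamma> \<Longrightarrow> \<exists>V. \<forall>i\<in>I. \<forall>x. \<gamma> \<le> \<bar>g i x\<bar> \<longrightarrow> H i x \<le> V"
    and H_blowup: "\<exists>\<gamma>>0. \<forall>i\<in>I. \<forall>x. g i x \<noteq> 0 \<longrightarrow> \<bar>g i x\<bar> < \<gamma> \<longrightarrow> V \<le> H i x"
    and H_deriv1: "i \<in> I \<Longrightarrow> g i x \<noteq> 0 \<Longrightarrow> (H i has_real_derivative H1 i x) (at x)"
    and H_deriv2: "i \<in> I \<Longrightarrow> g i x \<noteq> 0 \<Longrightarrow> (H1 i has_real_derivative H2 i x) (at x)"
    and H1_bound: "i \<in> I \<Longrightarrow> g i x \<noteq> 0 \<Longrightarrow> \<bar>H1 i x\<bar> \<le> C * H i x / \<bar>g i x\<bar>"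
    and H2_bound: "i \<in> I \<Longrightarrow> g i x \<noteq> 0 \<Longrightarrow> \<bar>H2 i x\<bar> \<le> C * H i x / (g i x)\<^sup>2"
    and weight_eq: "\<omega> x = (if \<exists>i\<in>I. g i x = 0 then 0 else exp (- (\<Sum>i\<in>I. H i x)))"
    and weight_continuous: "continuous_on UNIV \<omega>"
    and weight_periodic: "\<omega> (x + 2 * pi) = \<omega> x"
begin

definition h :: "real \<Rightarrow> real" where "h x = (\<Sum>i\<in>I. H i x)"

definition nz :: "real \<Rightarrow> bool" where "nz x \<longleftrightarrow> (\<forall>i\<in>I. g i x \<noteq> 0)"

text \<open>The radius of what counts as near: since \<open>C * \<eta> = 1 / (2 * C)\<close>, the
  Lipschitz bound keeps half of the threshold \<open>1 / C\<close> in \<open>g_pair\<close>, and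
  \<open>\<eta> \<le> 1 / C\<close> admits \<open>g_separation\<close>. The number \<theta> bounds
  the raised cosine beyond this radius.\<close>

definition \<eta> :: real where "\<eta> = 1 / (2 * C\<^sup>2)"

definition \<theta> :: real where "\<theta> = (1 + cos \<eta>) / 2"

lemma weight_nz: "nz x \<Longrightarrow> \<omega> x = exp (- h x)"
  unfolding weight_eq nz_def h_def by auto

lemma weight_not_nz: "\<not> nz x \<Longrightarrow> \<omega> x = 0"
  unfolding weight_eq nz_def by auto

lemma weight_nonneg: "0 \<le> \<omega> x"
  unfolding weight_eq by auto

lemma H_pos: "i \<in> I \<Longrightarrow> g i x \<noteq> 0 \<Longrightarrow> 0 < H i x"
  using H_lower[of i x] C_ge_1 by (smt (verit) divide_pos_pos)

lemma H_le_h: "nz x \<Longrightarrow> i \<in> I \<Longrightarrow> H i x \<le> h x"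
  unfolding h_def nz_def using finite_I H_pos by (intro member_le_sum) (auto intro: less_imp_le)

lemma h_lower: "nz x \<Longrightarrow> 1 / C \<le> h x"
proof -
  assume x: "nz x"
  obtain i where "i \<in> I" using nonempty_I by blast
  thus ?thesis using H_le_h[OF x] H_lower[of i x] x unfolding nz_def by fastforce
qed

lemma h_pos: "nz x \<Longrightarrow> 0 < h x"
  using h_lower[of x] C_ge_1 by (smt (verit) divide_pos_pos)

lemma weight_le_one: "\<omega> x \<le> 1"
  using weight_nz[of x] weight_not_nz[of x] h_pos[of x] by (cases "nz x") auto

lemma eta_pos: "0 < \<eta>"
  using C_ge_1 by (simp add: \<eta>_def)

lemma eta_le: "\<eta> \<le> 1 / C" "C * \<eta> \<le> 1 / (2 * C)" "\<eta> \<le> 1"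
proof -
  have "C \<le> C * C" "1 \<le> C * C" using C_ge_1 mult_mono[of 1 C 1 C] by auto
  thus "\<eta> \<le> 1 / C" "C * \<eta> \<le> 1 / (2 * C)" "\<eta> \<le> 1"
    using C_ge_1 by (auto simp: \<eta>_def field_simps power2_eq_square)
qed

lemma theta: "0 < \<theta>" "\<theta> < 1"
proof -
  have "cos \<eta> < cos 0" using eta_pos eta_le(3) pi_gt3 by (intro cos_monotone_0_pi) auto
  thus "\<theta> < 1" by (simp add: \<theta>_def)
  have "cos pi < cos \<eta>" using eta_pos eta_le(3) pi_gt3 by (intro cos_monotone_0_pi) auto
  thus "0 < \<theta>" by (simp add: \<theta>_def)
qed

lemma raised_cos_far:
  assumes "\<eta> \<le> \<bar>t - x\<bar>" "\<bar>t - x\<bar> \<le> pi"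
  shows "((1 + cos (t - x)) / 2) ^ j \<le> \<theta> ^ j"
  using cos_le_of_abs_ge[of \<eta> "t - x"] assms eta_pos
  by (intro power_mono raised_cos_nonneg) (auto simp: \<theta>_def)

text \<open>By \<open>g_pair\<close> and the bound on \<rho>, each \<open>g i\<close> falls into one
  of two cases. If it is at least \<open>1 / C\<close> at \<open>x\<close>, it stays at least
  \<open>1 / (2 * C)\<close> at \<open>y\<close> by the choice of \<eta>. Otherwise it is at most
  \<open>C * \<rho>\<close> at \<open>x\<close>, and separation leaves at least
  \<open>(C + 1) * \<rho> - C * \<rho>\<close> at \<open>y\<close>; hence the gap width
  \<open>C * (C + 1) * \<rho>\<close>. The final disjunction records the case, as the estimates of
  \<open>H i y\<close> depend on it.\<close>

lemma gap:
  assumes k: "k \<in> I" "\<bar>g k x\<bar> \<le> \<rho>" and \<rho>: "\<rho> \<le> 1 / (2 * C)"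
    and y: "C * (C + 1) * \<rho> \<le> \<bar>y - x\<bar>" "\<bar>y - x\<bar> \<le> \<eta>" and i: "i \<in> I"
  shows "\<rho> \<le> \<bar>g i y\<bar> \<and> (\<bar>g i x\<bar> \<le> C * \<bar>g k x\<bar> \<or> 1 / (2 * C) \<le> \<bar>g i y\<bar>)"
proof -
  have C: "1 / C > 0" "1 / C = 1 / (2 * C) + 1 / (2 * C)" using C_ge_1 by (auto simp: field_simps)
  have lip: "\<bar>g i x\<bar> \<le> \<bar>g i y\<bar> + C * \<eta>"
  proof -
    have "\<bar>g i x - g i y\<bar> \<le> C * \<bar>x - y\<bar>" using g_lipschitz i by blast
    also have "\<dots> \<le> C * \<eta>" using y C_ge_1 by (intro mult_left_mono) auto
    finally show ?thesis by linarith
  qed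
  consider "1 / C \<le> \<bar>g i x\<bar>" | "1 / C \<le> \<bar>g k x\<bar>" | "\<bar>g i x\<bar> \<le> C * \<bar>g k x\<bar>"
    using g_pair[OF i k(1)] by blast
  thus ?thesis
  proof cases
    case 1
    hence "1 / (2 * C) \<le> \<bar>g i y\<bar>" using lip eta_le(2) C by linarith
    thus ?thesis using \<rho> by linarith
  next
    case 2
    thus ?thesis using k \<rho> C by linarith
  next
    case 3
    have "\<bar>x - y\<bar> / C \<le> \<bar>g i x\<bar> + \<bar>g i y\<bar>"
      using y eta_le i by (intro g_separation) auto
    moreover have "(C + 1) * \<rho> \<le> \<bar>x - y\<bar> / C" using y C_ge_1 by (simp add: field_simps abs_minus_commute)
    moreover have "C * \<bar>g k x\<bar> \<le> C * \<rho>" using k C_ge_1 by (intro mult_left_mono) auto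
    ultimately have "\<rho> \<le> \<bar>g i y\<bar>" using 3 by (simp add: algebra_simps)
    thus ?thesis using 3 by blast
  qed
qed

section \<open>Bounding a polynomial by its weighted maximum\<close>

lemma h_bounded:
  assumes "0 < \<gamma>"
  obtains V where "0 \<le> V" "\<And>x. (\<And>i. i \<in> I \<Longrightarrow> \<gamma> \<le> \<bar>g i x\<bar>) \<Longrightarrow> nz x \<and> h x \<le> V"
proof -
  obtain V where V: "\<And>i x. i \<in> I \<Longrightarrow> \<gamma> \<le> \<bar>g i x\<bar> \<Longrightarrow> H i x \<le> V"
    using H_bounded[OF assms] by blast
  show ?thesis
  proof (rule that)
    show "0 \<le> real (card I) * \<bar>V\<bar>" by simp
    fix x assume x: "\<And>i. i \<in> I \<Longrightarrow> \<gamma> \<le> \<bar>g i x\<bar>"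
    have "h x \<le> (\<Sum>i\<in>I. \<bar>V\<bar>)" unfolding h_def using V x by (intro sum_mono) fastforce
    moreover have "nz x" unfolding nz_def using x assms by fastforce
    ultimately show "nz x \<and> h x \<le> real (card I) * \<bar>V\<bar>" by simp
  qed
qed

lemma poly_le_of_weight:
  assumes "norm s * \<omega> t \<le> A" "nz t" "h t \<le> m" "0 \<le> A"
  shows "norm (s::complex) \<le> A * exp m"
proof -
  have "norm s = norm s * exp (- h t) * exp (h t)" by (simp add: exp_minus)
  also have "\<dots> \<le> A * exp (h t)"
    using assms weight_nz by (intro mult_right_mono) auto
  also have "\<dots> \<le> A * exp m" using assms by (intro mult_left_mono) auto
  finally show ?thesis .
qed

text \<open>Self-improvement at the point \<open>x\<close> where \<open>norm f\<close> attains its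
  maximum \<open>B\<close>. After damping by the \<open>n\<close>-th power of the raised cosine, the
  values beyond the radius \<eta> are at most \<open>B * \<theta> ^ n\<close>. The gap is so narrow
  that the Remez loss does not undo this factor; so these values cannot account for \<open>B\<close>
  unless \<open>B = 0\<close>, and those at points with \<open>h \<le> V\<close> must.\<close>

lemma crude_bound:
  obtains c where "0 \<le> c" "\<And>n f A t. n \<ge> 1 \<Longrightarrow> trig_entire n f \<Longrightarrow>
     (\<And>t. norm (f (of_real t)) * \<omega> t \<le> A) \<Longrightarrow> norm (f (of_real t)) \<le> A * exp (c * real n)"
proof -
  define \<kappa> where "\<kappa> = - ln \<theta>"
  have \<kappa>: "\<kappa> > 0" using theta by (simp add: \<kappa>_def)
  \<comment> \<open>The damped polynomial has degree 2 n, so Remez loses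
    \<open>exp (8 * n * \<rho>g)\<close>, at most \<open>exp (\<kappa> * n / 2)\<close>, against the
    gain \<open>\<theta> ^ n = exp (- \<kappa> * n)\<close>. The bound 1 is demanded by
    \<open>remez\<close>, and \<open>(C + 1) / 2\<close> gives
    \<open>\<rho> \<le> 1 / (2 * C)\<close> for \<open>gap\<close>.\<close>
  define \<rho>g where "\<rho>g = min (\<kappa> / 16) (min 1 ((C + 1) / 2))"
  define \<rho> where "\<rho> = \<rho>g / (C * (C + 1))"
  have CC: "C * (C + 1) > 0" "C > 0" using C_ge_1 by auto
  have \<rho>g: "0 < \<rho>g" "\<rho>g \<le> 1" "\<rho>g \<le> \<kappa> / 16" using \<kappa> C_ge_1 by (auto simp: \<rho>g_def)
  have \<rho>: "0 < \<rho>" "C * (C + 1) * \<rho> = \<rho>g" "\<rho> \<le> 1 / (2 * C)"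
  proof -
    show "0 < \<rho>" "C * (C + 1) * \<rho> = \<rho>g" using \<rho>g CC by (auto simp: \<rho>_def)
    have "\<rho>g \<le> (C + 1) / 2" unfolding \<rho>g_def
      by (intro min.coboundedI2 order_refl)
    hence "\<rho> \<le> ((C + 1) / 2) / (C * (C + 1))" unfolding \<rho>_def using CC
      by (intro divide_right_mono) auto
    also have "\<dots> = (1 * (C + 1)) / ((2 * C) * (C + 1))" by simp
    also have "\<dots> = 1 / (2 * C)" using C_ge_1 by (intro mult_divide_mult_cancel_right) simp
    finally show "\<rho> \<le> 1 / (2 * C)" .
  qed
  obtain V where V: "0 \<le> V" "\<And>x. (\<And>i. i \<in> I \<Longrightarrow> \<rho> \<le> \<bar>g i x\<bar>) \<Longrightarrow> nz x \<and> h x \<le> V"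
    using h_bounded[OF \<rho>(1)] by blast
  show ?thesis
  proof (rule that[of "V + \<kappa>"])
    show "0 \<le> V + \<kappa>" using V \<kappa> by simp
    fix n :: nat and f A and t0 :: real
    assume n: "1 \<le> n" and f: "trig_entire n f" and A: "\<And>t. norm (f (of_real t)) * \<omega> t \<le> A"
    have A0: "0 \<le> A" using order_trans[OF mult_nonneg_nonneg[OF norm_ge_zero weight_nonneg] A[of 0]] .
    obtain x where x: "\<And>t::real. norm (f (of_real t)) * 1 \<le> norm (f (of_real x)) * 1"
      using trig_entire_max[OF f, of "\<lambda>_. 1"] by auto
    define B where "B = norm (f (of_real x))"
    have n': "V + 8 * real n * \<rho>g \<le> (V + \<kappa>) * real n"
    proof -
      have "V * 1 \<le> V * real n" using n V by (intro mult_left_mono) auto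
      moreover have "(8 * \<rho>g) * real n \<le> \<kappa> * real n" using \<rho>g \<kappa> by (intro mult_right_mono) auto
      ultimately show ?thesis by (simp add: algebra_simps)
    qed
    have "B \<le> A * exp (V + 8 * real n * \<rho>g)"
    proof (cases "\<exists>k\<in>I. \<bar>g k x\<bar> \<le> \<rho>")
      case False
      hence "nz x \<and> h x \<le> V" by (intro V) auto
      hence "B \<le> A * exp V" unfolding B_def by (intro poly_le_of_weight[OF A _ _ A0]) auto
      also have "\<dots> \<le> A * exp (V + 8 * real n * \<rho>g)" using A0 \<rho>g by (intro mult_left_mono) auto
      finally show ?thesis .
    next
      case True
      then obtain k where k: "k \<in> I" "\<bar>g k x\<bar> \<le> \<rho>" by blast
      define f2 where "f2 z = f z * ((1 + cos (z - of_real x)) / 2) ^ n" for z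
      have f2: "trig_entire (n + n) f2" unfolding f2_def by (rule trig_entire_raised_cos[OF f])
      have nf2: "norm (f2 (of_real t)) = norm (f (of_real t)) * ((1 + cos (t - x)) / 2) ^ n" for t
        unfolding f2_def by (rule norm_raised_cos)
      have B0: "0 \<le> B" by (simp add: B_def)
      have "norm (f2 (of_real x)) \<le> max (A * exp V) (B * \<theta> ^ n) * exp (4 * real (n + n) * \<rho>g)"
      proof (rule remez[OF f2 \<rho>g(1,2)])
        show "\<bar>x - x\<bar> \<le> pi" by simp
        fix t assume t: "\<rho>g \<le> \<bar>t - x\<bar>" "\<bar>t - x\<bar> \<le> pi"
        show "norm (f2 (of_real t)) \<le> max (A * exp V) (B * \<theta> ^ n)"
        proof (cases "\<bar>t - x\<bar> \<le> \<eta>")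
          case True
          have "nz t \<and> h t \<le> V" using gap[OF k \<rho>(3), of t] t True \<rho>(2) by (intro V) auto
          hence "norm (f (of_real t)) \<le> A * exp V" by (intro poly_le_of_weight[OF A _ _ A0]) auto
          moreover have "norm (f2 (of_real t)) \<le> norm (f (of_real t)) * 1"
            unfolding nf2 by (intro mult_left_mono raised_cos_power_le_one) auto
          ultimately show ?thesis by simp
        next
          case False
          have "norm (f2 (of_real t)) \<le> B * \<theta> ^ n" unfolding nf2 B_def
            using False t x[of t] by (intro mult_mono raised_cos_far zero_le_power raised_cos_nonneg) auto
          thus ?thesis by simp
        qed
      qed
      hence r: "B \<le> max (A * exp V) (B * \<theta> ^ n) * exp (8 * real n * \<rho>g)"
        by (simp add: nf2 B_def)
      show ?thesis
      proof (cases "B * \<theta> ^ n \<le> A * exp V")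
        case True
        thus ?thesis using r by (simp add: max_def exp_add split: if_splits)
      next
        case False
        hence r': "B \<le> B * (\<theta> ^ n * exp (8 * real n * \<rho>g))" using r by (simp add: max_def mult_ac)
        have "\<theta> ^ n = exp (- \<kappa> * real n)"
          using theta by (simp add: \<kappa>_def mult.commute exp_of_nat_mult)
        hence "\<theta> ^ n * exp (8 * real n * \<rho>g) = exp (- ((\<kappa> - 8 * \<rho>g) * real n))"
          by (simp add: exp_add [symmetric] algebra_simps)
        also have "\<dots> < 1" using \<rho>g \<kappa> n by simp
        finally have q: "\<theta> ^ n * exp (8 * real n * \<rho>g) < 1" .
        have "B = 0"
        proof (rule ccontr)
          assume "B \<noteq> 0"
          hence "B * (\<theta> ^ n * exp (8 * real n * \<rho>g)) < B * 1"
            using B0 q by (intro mult_strict_left_mono) auto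
          thus False using r' by simp
        qed
        thus ?thesis using A0 by simp
      qed
    qed
    also have "\<dots> \<le> A * exp ((V + \<kappa>) * real n)" using n' A0 by (intro mult_left_mono) auto
    finally show "norm (f (of_real t0)) \<le> A * exp ((V + \<kappa>) * real n)"
      using x[of t0] by (simp add: B_def)
  qed
qed

text \<open>The damping power \<open>K * n\<close> is strong enough to absorb the crude exponential
  bound, so beyond the radius \<eta> the damped polynomial is at most \<open>A\<close>, and only the
  gap around \<open>x\<close>, of width proportional to \<rho>, costs anything. The bound
  \<open>m\<close> for \<open>h\<close> outside the gap is left open: it will be half of
  \<open>h x\<close> when \<open>h\<close> is bounded at a maximum, and a multiple of it when the
  polynomial is bounded on the whole circle.\<close>

lemma gap_bound:
  obtains K c where "0 \<le> c" "\<And>n f A x k \<rho> m t. n \<ge> 1 \<Longrightarrow> trig_entire n f \<Longrightarrow>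
     (\<And>t. norm (f (of_real t)) * \<omega> t \<le> A) \<Longrightarrow> k \<in> I \<Longrightarrow> 0 < \<rho> \<Longrightarrow> \<bar>g k x\<bar> \<le> \<rho> \<Longrightarrow> 0 \<le> m \<Longrightarrow>
     (\<And>y. (\<And>i. i \<in> I \<Longrightarrow> \<rho> \<le> \<bar>g i y\<bar> \<and> (\<bar>g i x\<bar> \<le> C * \<bar>g k x\<bar> \<or> 1 / (2 * C) \<le> \<bar>g i y\<bar>)) \<Longrightarrow> h y \<le> m) \<Longrightarrow>
     norm (f (of_real t)) * ((1 + cos (t - x)) / 2) ^ (K * n) \<le> A * exp (m + c * real n * \<rho>)"
proof (rule crude_bound)
  fix c1 assume c1: "0 \<le> c1" "\<And>n f A t. n \<ge> 1 \<Longrightarrow> trig_entire n f \<Longrightarrow>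
       (\<And>t. norm (f (of_real t)) * \<omega> t \<le> A) \<Longrightarrow> norm (f (of_real t)) \<le> A * exp (c1 * real n)"
  obtain K where K: "\<theta> ^ K < exp (- c1)"
    using real_arch_pow_inv[of "exp (- c1)" \<theta>] theta by auto
  define K2 where "K2 = C * (C + 1)"
  have K2: "K2 > 0" using C_ge_1 by (simp add: K2_def)
  define \<rho>0 where "\<rho>0 = min (1 / (2 * C)) (1 / K2)"
  have \<rho>0: "\<rho>0 > 0" using C_ge_1 K2 by (simp add: \<rho>0_def)
  \<comment> \<open>First summand: the Remez exponent for degree \<open>n + K * n\<close> and gap
    \<open>K2 * \<rho>\<close>. Second summand: for \<open>\<rho> > \<rho>0\<close> the gap would be
    too wide for \<open>gap\<close> and \<open>remez\<close>, but then the crude bound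
    \<open>exp (c1 * n)\<close> suffices.\<close>
  define c where "c = 4 * (1 + real K) * K2 + c1 / \<rho>0"
  have c: "0 \<le> c" "4 * (1 + real K) * K2 \<le> c" "c1 / \<rho>0 \<le> c" using c1 \<rho>0 K2 by (auto simp: c_def)
  show ?thesis
  proof (rule that[of c K])
    show "0 \<le> c" by (rule c)
    fix n :: nat and f A x k \<rho> m and t0 :: real
    assume n: "1 \<le> n" and f: "trig_entire n f" and A: "\<And>t. norm (f (of_real t)) * \<omega> t \<le> A"
      and k: "k \<in> I" and \<rho>: "0 < \<rho>" "\<bar>g k x\<bar> \<le> \<rho>" and m: "0 \<le> m"
      and hm: "\<And>y. (\<And>i. i \<in> I \<Longrightarrow> \<rho> \<le> \<bar>g i y\<bar> \<and> (\<bar>g i x\<bar> \<le> C * \<bar>g k x\<bar> \<or> 1 / (2 * C) \<le> \<bar>g i y\<bar>)) \<Longrightarrow> h y \<le> m"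
    have A0: "0 \<le> A" using order_trans[OF mult_nonneg_nonneg[OF norm_ge_zero weight_nonneg] A[of 0]] .
    define f2 where "f2 z = f z * ((1 + cos (z - of_real x)) / 2) ^ (K * n)" for z
    have f2: "trig_entire (n + K * n) f2" unfolding f2_def by (rule trig_entire_raised_cos[OF f])
    have nf2: "norm (f2 (of_real t)) = norm (f (of_real t)) * ((1 + cos (t - x)) / 2) ^ (K * n)" for t
      unfolding f2_def by (rule norm_raised_cos)
    have nf2_le: "norm (f2 (of_real t)) \<le> norm (f (of_real t))" for t
    proof -
      have "norm (f2 (of_real t)) \<le> norm (f (of_real t)) * 1"
        unfolding nf2 by (intro mult_left_mono raised_cos_power_le_one) auto
      thus ?thesis by simp
    qed
    have c1': "norm (f (of_real t)) \<le> A * exp (c1 * real n)" for t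
      using A by (intro c1 n f) auto
    have "norm (f2 (of_real t0)) \<le> A * exp (m + c * real n * \<rho>)"
    proof (cases "\<rho> \<le> \<rho>0")
      case False
      have "c1 * real n = (c1 / \<rho>0) * real n * \<rho>0" using \<rho>0 by simp
      also have "\<dots> \<le> c * real n * \<rho>" using False c \<rho>0 \<rho> c1 by (intro mult_mono) auto
      finally have "exp (c1 * real n) \<le> exp (m + c * real n * \<rho>)" using m by simp
      hence "A * exp (c1 * real n) \<le> A * exp (m + c * real n * \<rho>)" using A0 by (rule mult_left_mono)
      thus ?thesis using c1'[of t0] nf2_le[of t0] by linarith
    next
      case True
      have \<rho>': "\<rho> \<le> 1 / (2 * C)" "\<rho> \<le> 1 / K2" using True by (auto simp: \<rho>0_def)
      show ?thesis
      proof (rule periodic_bound[where f = "\<lambda>t. f2 (complex_of_real t)" and c = x and P = "\<lambda>s. norm s \<le> A * exp (m + c * real n * \<rho>)"])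
        show "f2 (of_real (t + 2 * pi)) = f2 (of_real t)" for t by (rule trig_entire_periodic[OF f2])
        fix t assume tx: "\<bar>t - x\<bar> \<le> pi"
        have "norm (f2 (of_real t)) \<le> (A * exp m) * exp (4 * real (n + K * n) * (K2 * \<rho>))"
        proof (rule remez[OF f2 _ _ tx])
          show "0 < K2 * \<rho>" using K2 \<rho> by simp
          show "K2 * \<rho> \<le> 1" using \<rho>' K2 by (simp add: field_simps)
          fix y assume y: "K2 * \<rho> \<le> \<bar>y - x\<bar>" "\<bar>y - x\<bar> \<le> pi"
          show "norm (f2 (of_real y)) \<le> A * exp m"
          proof (cases "\<bar>y - x\<bar> \<le> \<eta>")
            case True
            have gp: "\<And>i. i \<in> I \<Longrightarrow> \<rho> \<le> \<bar>g i y\<bar> \<and> (\<bar>g i x\<bar> \<le> C * \<bar>g k x\<bar> \<or> 1 / (2 * C) \<le> \<bar>g i y\<bar>)"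
              using gap[OF k \<rho>(2) \<rho>'(1), of y] y True by (auto simp: K2_def)
            have "nz y" unfolding nz_def using \<rho> gp by fastforce
            with hm[OF gp] have "norm (f (of_real y)) \<le> A * exp m"
              by (intro poly_le_of_weight[OF A _ _ A0])
            thus ?thesis using nf2_le[of y] by linarith
          next
            case False
            have "norm (f2 (of_real y)) \<le> (A * exp (c1 * real n)) * \<theta> ^ (K * n)" unfolding nf2
              using False y c1'[of y] A0
              by (intro mult_mono raised_cos_far zero_le_power raised_cos_nonneg) auto
            also have "\<theta> ^ (K * n) \<le> exp (- c1) ^ n"
              unfolding power_mult using K theta by (intro power_mono) auto
            also have "exp (- c1) ^ n = exp (- (c1 * real n))"
              by (simp add: exp_of_nat_mult [symmetric] mult.commute)
            finally have "norm (f2 (of_real y)) \<le> A * exp (c1 * real n) * exp (- (c1 * real n))"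
              using A0 by (simp add: mult_left_mono)
            hence "norm (f2 (of_real y)) \<le> A" by (simp only: mult.assoc mult_exp_exp) simp
            also have "A \<le> A * exp m" using A0 m by (simp add: mult_le_cancel_left1)
            finally show ?thesis .
          qed
        qed
        also have "\<dots> = A * exp (m + 4 * real (n + K * n) * (K2 * \<rho>))"
          by (simp only: mult.assoc mult_exp_exp)
        also have "\<dots> \<le> A * exp (m + c * real n * \<rho>)"
        proof -
          have "4 * real (n + K * n) * (K2 * \<rho>) = (4 * (1 + real K) * K2) * (real n * \<rho>)"
            by (simp add: algebra_simps)
          also have "\<dots> \<le> c * (real n * \<rho>)" using c(2) \<rho> by (intro mult_right_mono) auto
          finally show ?thesis using A0 by (intro mult_left_mono) (simp_all add: mult.assoc)
        qed
        finally show "norm (f2 (of_real t)) \<le> A * exp (m + c * real n * \<rho>)" .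
      qed
    qed
    thus "norm (f (of_real t0)) * ((1 + cos (t0 - x)) / 2) ^ (K * n) \<le> A * exp (m + c * real n * \<rho>)"
      unfolding nf2 .
  qed
qed

text \<open>A gap at level \<open>G / \<epsilon>\<close>, with \<open>G = \<bar>g k x\<bar>\<close>,
  is wide enough for \<open>H_decay\<close> to bring \<open>h\<close> below \<open>h x / 2\<close>
  outside it. Evaluating \<open>gap_bound\<close> at \<open>t = x\<close>, where the damping factor
  is 1, and cancelling the positive value of \<open>norm f\<close> leaves
  \<open>h x \<le> h x / 2 + O(n * G)\<close>.\<close>

lemma exponent_le_at_max:
  obtains \<Lambda> where "0 < \<Lambda>" "\<And>n f x k. n \<ge> 1 \<Longrightarrow> trig_entire n f \<Longrightarrow>
     (\<And>t. norm (f (of_real t)) * \<omega> t \<le> norm (f (of_real x)) * \<omega> x) \<Longrightarrow> 0 < norm (f (of_real x)) * \<omega> x \<Longrightarrow>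
     k \<in> I \<Longrightarrow> (\<And>i. i \<in> I \<Longrightarrow> \<bar>g k x\<bar> \<le> \<bar>g i x\<bar>) \<Longrightarrow> h x \<le> \<Lambda> * real n * \<bar>g k x\<bar>"
proof (rule gap_bound)
  fix K c assume c: "0 \<le> c" and gb: "\<And>n f A x k \<rho> m t. n \<ge> 1 \<Longrightarrow> trig_entire n f \<Longrightarrow>
     (\<And>t. norm (f (of_real t)) * \<omega> t \<le> A) \<Longrightarrow> k \<in> I \<Longrightarrow> 0 < \<rho> \<Longrightarrow> \<bar>g k x\<bar> \<le> \<rho> \<Longrightarrow> 0 \<le> m \<Longrightarrow>
     (\<And>y. (\<And>i. i \<in> I \<Longrightarrow> \<rho> \<le> \<bar>g i y\<bar> \<and> (\<bar>g i x\<bar> \<le> C * \<bar>g k x\<bar> \<or> 1 / (2 * C) \<le> \<bar>g i y\<bar>)) \<Longrightarrow> h y \<le> m) \<Longrightarrow>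
     norm (f (of_real t)) * ((1 + cos (t - x)) / 2) ^ (K * n) \<le> A * exp (m + c * real n * \<rho>)"
  have C0: "C > 0" using C_ge_1 by simp
  \<comment> \<open>Chosen to give \<open>(C * \<epsilon>) powr (1 / C) = 1 / 4\<close>: if \<bar>g
    i x\<bar> is at most \<open>C * G\<close>, then \<open>H i\<close> drops to a quarter where
    \<bar>g i\<bar> is at least \<open>G / \<epsilon>\<close>.\<close>
  define \<epsilon> where "\<epsilon> = (1/4) powr C / C"
  have \<epsilon>: "0 < \<epsilon>" "(C * \<epsilon>) powr (1 / C) = 1/4" "C * \<epsilon> \<le> 1" "\<epsilon> \<le> 1"
  proof -
    show "0 < \<epsilon>" using C0 by (simp add: \<epsilon>_def)
    have Ce: "C * \<epsilon> = (1/4) powr C" using C0 by (simp add: \<epsilon>_def)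
    show "(C * \<epsilon>) powr (1 / C) = 1/4" unfolding Ce powr_powr using C0 by simp
    show Ce1: "C * \<epsilon> \<le> 1" unfolding Ce using C0 by (intro powr_le1) auto
    have "1 * \<epsilon> \<le> C * \<epsilon>" using C_ge_1 \<open>0 < \<epsilon>\<close> by (intro mult_right_mono) auto
    thus "\<epsilon> \<le> 1" using Ce1 by simp
  qed
  have "0 < 1 / (2 * C)" using C0 by simp
  then obtain V' where V': "\<forall>i\<in>I. \<forall>x. 1 / (2 * C) \<le> \<bar>g i x\<bar> \<longrightarrow> H i x \<le> V'"
    using H_bounded by blast
  define V where "V = \<bar>V'\<bar>"
  have V0: "0 \<le> V" by (simp add: V_def)
  have V: "H i x \<le> V" if "i \<in> I" "1 / (2 * C) \<le> \<bar>g i x\<bar>" for i x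
    using V' that by (fastforce simp: V_def)
  define W where "W = real (card I) * V"
  obtain \<gamma> where \<gamma>: "\<gamma> > 0" "\<And>i x. i \<in> I \<Longrightarrow> g i x \<noteq> 0 \<Longrightarrow> \<bar>g i x\<bar> < \<gamma> \<Longrightarrow> 4 * W \<le> H i x"
    using H_blowup[of "4 * W"] by blast
  obtain U where U: "0 \<le> U" "\<And>x. (\<And>i. i \<in> I \<Longrightarrow> \<gamma> \<le> \<bar>g i x\<bar>) \<Longrightarrow> nz x \<and> h x \<le> U"
    using h_bounded[OF \<gamma>(1)] by blast
  \<comment> \<open>The summand \<open>2 * c / \<epsilon>\<close> comes from the comparison at
    \<open>x\<close>. If \<open>G \<ge> \<gamma>\<close>, then \<open>h x\<close> is bounded by
    \<open>U\<close> and \<open>U / \<gamma>\<close> suffices; if \<open>G < \<gamma>\<close>, the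
    blow-up makes \<open>h x \<ge> 4 * W\<close>, which absorbs the bounded contributions.\<close>
  define \<Lambda> where "\<Lambda> = 1 + 2 * c / \<epsilon> + U / \<gamma>"
  have \<Lambda>: "0 < \<Lambda>" "2 * c / \<epsilon> \<le> \<Lambda>" "U / \<gamma> \<le> \<Lambda>"
  proof -
    have "0 \<le> 2 * c / \<epsilon>" "0 \<le> U / \<gamma>" using c \<epsilon> U \<gamma> by simp_all
    thus "0 < \<Lambda>" "2 * c / \<epsilon> \<le> \<Lambda>" "U / \<gamma> \<le> \<Lambda>" unfolding \<Lambda>_def by linarith+
  qed
  show ?thesis
  proof (rule that[of \<Lambda>])
    show "0 < \<Lambda>" by (rule \<Lambda>)
    fix n :: nat and f x k
    assume n: "1 \<le> n" and f: "trig_entire n f"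
      and A: "\<And>t. norm (f (of_real t)) * \<omega> t \<le> norm (f (of_real x)) * \<omega> x"
      and pos: "0 < norm (f (of_real x)) * \<omega> x" and k: "k \<in> I" and min: "\<And>i. i \<in> I \<Longrightarrow> \<bar>g k x\<bar> \<le> \<bar>g i x\<bar>"
    have nz: "nz x" using pos weight_not_nz[of x] by fastforce
    define G where "G = \<bar>g k x\<bar>"
    have G0: "0 < G" using nz k by (auto simp: G_def nz_def)
    have "h x \<le> \<Lambda> * real n * G"
    proof (cases "G < \<gamma>")
      case False
      hence "h x \<le> U" using U(2)[of x] min by (fastforce simp: G_def)
      also have "U = (U / \<gamma>) * 1 * \<gamma>" using \<gamma> by simp
      also have "\<dots> \<le> \<Lambda> * real n * G"
        using False n \<Lambda> \<gamma> U by (intro mult_mono) auto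
      finally show ?thesis .
    next
      case True
      have "4 * W \<le> H k x" using \<gamma>(2)[OF k] True G0 by (auto simp: G_def)
      hence W: "W \<le> h x / 4" using H_le_h[OF nz k] by simp
      have hx: "0 < h x" by (rule h_pos[OF nz])
      have "norm (f (of_real x)) * ((1 + cos (x - x)) / 2) ^ (K * n) \<le>
        (norm (f (of_real x)) * \<omega> x) * exp (h x / 2 + c * real n * (G / \<epsilon>))"
      proof (rule gb[OF n f _ k])
        show "norm (f (of_real t)) * \<omega> t \<le> norm (f (of_real x)) * \<omega> x" for t using A by blast
        show "0 < G / \<epsilon>" using G0 \<epsilon> by simp
        show "\<bar>g k x\<bar> \<le> G / \<epsilon>" using G0 \<epsilon> by (simp add: G_def pos_le_divide_eq mult_left_le)
        show "0 \<le> h x / 2" using hx by simp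
        fix y assume y: "\<And>i. i \<in> I \<Longrightarrow> G / \<epsilon> \<le> \<bar>g i y\<bar> \<and> (\<bar>g i x\<bar> \<le> C * \<bar>g k x\<bar> \<or> 1 / (2 * C) \<le> \<bar>g i y\<bar>)"
        have "H i y \<le> H i x / 4 + V" if i: "i \<in> I" for i
        proof (cases "1 / (2 * C) \<le> \<bar>g i y\<bar>")
          case True
          have "0 < H i x" using nz i by (intro H_pos) (auto simp: nz_def)
          thus ?thesis using V[OF i True] by simp
        next
          case False
          hence gi: "\<bar>g i x\<bar> \<le> C * G" using y[OF i] by (simp add: G_def)
          have gi0: "g i x \<noteq> 0" using nz i by (simp add: nz_def)
          have "\<bar>g i x\<bar> \<le> (C * \<epsilon>) * (G / \<epsilon>)" using gi \<epsilon> by simp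
          also have "\<dots> \<le> (C * \<epsilon>) * \<bar>g i y\<bar>" using y[OF i] C0 \<epsilon> by (intro mult_left_mono) auto
          finally have le: "\<bar>g i x\<bar> \<le> (C * \<epsilon>) * \<bar>g i y\<bar>" .
          also have "\<dots> \<le> 1 * \<bar>g i y\<bar>" using \<epsilon> by (intro mult_right_mono) auto
          finally have le1: "\<bar>g i x\<bar> \<le> \<bar>g i y\<bar>" by simp
          hence gy0: "0 < \<bar>g i y\<bar>" using gi0 by linarith
          have "H i y \<le> (\<bar>g i x\<bar> / \<bar>g i y\<bar>) powr (1 / C) * H i x"
            by (rule H_decay[OF i gi0 le1])
          also have "\<dots> \<le> (C * \<epsilon>) powr (1 / C) * H i x"
            using le gy0 C0 H_pos[OF i gi0]
            by (intro mult_right_mono powr_mono2) (auto simp: pos_divide_le_eq)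
          finally show ?thesis using \<epsilon> V0 by simp
        qed
        hence "h y \<le> (\<Sum>i\<in>I. H i x / 4 + V)" unfolding h_def by (intro sum_mono)
        also have "\<dots> = h x / 4 + W" by (simp add: h_def W_def sum.distrib sum_divide_distrib)
        finally show "h y \<le> h x / 2" using W by simp
      qed
      hence "norm (f (of_real x)) * 1 \<le> norm (f (of_real x)) * (\<omega> x * exp (h x / 2 + c * real n * (G / \<epsilon>)))"
        by (simp add: mult.assoc)
      moreover have "0 < norm (f (of_real x))" using pos by (auto simp: zero_less_mult_iff)
      ultimately have "1 \<le> \<omega> x * exp (h x / 2 + c * real n * (G / \<epsilon>))"
        using mult_left_le_imp_le by blast
      hence "1 \<le> exp (c * real n * (G / \<epsilon>) - h x / 2)"
        unfolding weight_nz[OF nz] mult_exp_exp by (simp add: algebra_simps)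
      hence "h x \<le> (2 * c / \<epsilon>) * real n * G" by (simp add: mult_ac)
      also have "\<dots> \<le> \<Lambda> * real n * G" using \<Lambda> G0 by (intro mult_right_mono) auto
      finally show ?thesis .
    qed
    thus "h x \<le> \<Lambda> * real n * \<bar>g k x\<bar>" by (simp add: G_def)
  qed
qed

text \<open>Within this radius the Lipschitz bound lets \<open>g i\<close> change by at most
  \<open>G / 2\<close>, that is by at most half of \<open>\<bar>g i x0\<bar>\<close>; by doubling,
  \<open>H i\<close> then grows at most by the factor \<open>2 powr C\<close>.\<close>

lemma local_bounds:
  assumes i: "i \<in> I" and x0: "nz x0" and G: "\<bar>G\<bar> \<le> \<bar>g i x0\<bar>" and x: "\<bar>x - x0\<bar> \<le> G / (2 * C)"
  shows "g i x \<noteq> 0" "\<bar>g i x0\<bar> \<le> 2 * \<bar>g i x\<bar>" "H i x \<le> 2 powr C * H i x0"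
proof -
  have C0: "C > 0" using C_ge_1 by simp
  have gx0: "g i x0 \<noteq> 0" using x0 i by (simp add: nz_def)
  have "\<bar>g i x0 - g i x\<bar> \<le> C * \<bar>x0 - x\<bar>" using g_lipschitz i by blast
  also have "\<dots> \<le> C * (G / (2 * C))" using x C0 by (intro mult_left_mono) (auto simp: abs_minus_commute)
  also have "\<dots> = G / 2" using C0 by simp
  finally show 1: "\<bar>g i x0\<bar> \<le> 2 * \<bar>g i x\<bar>" using G by linarith
  thus gx: "g i x \<noteq> 0" using gx0 by auto
  have Hx0: "0 < H i x0" "0 < H i x" using H_pos i gx0 gx by auto
  have two: "1 \<le> (2::real) powr C" using C0 by (intro ge_one_powr_ge_zero) auto
  show "H i x \<le> 2 powr C * H i x0"
  proof (cases "\<bar>g i x\<bar> \<le> \<bar>g i x0\<bar>")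
    case True
    have "H i x \<le> (\<bar>g i x0\<bar> / \<bar>g i x\<bar>) powr C * H i x0" by (rule H_doubling[OF i gx True])
    also have "\<dots> \<le> 2 powr C * H i x0"
      using 1 gx C0 Hx0 by (intro mult_right_mono powr_mono2) (auto simp: pos_divide_le_eq)
    finally show ?thesis .
  next
    case False
    have "H i x \<le> (\<bar>g i x0\<bar> / \<bar>g i x\<bar>) powr (1 / C) * H i x0" using False by (intro H_decay[OF i gx0]) auto
    also have "\<dots> \<le> 1 * H i x0"
      using False C0 Hx0 by (intro mult_right_mono powr_le1) (auto simp: divide_le_eq_1)
    also have "\<dots> \<le> 2 powr C * H i x0" using two Hx0 by (intro mult_right_mono) auto
    finally show ?thesis .
  qed
qed

text \<open>Here the gap is at the level \<bar>g k x\<bar> itself, so \<open>H i\<close> need not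
  shrink, but it is multiplied at most by a constant: bounded values are compared with the lower
  bound \<open>1 / C\<close> of \<open>H i x\<close>, and if \<open>g i\<close> is comparable with
  \<open>g k\<close> at \<open>x\<close>, doubling applies with ratio at most \<open>C\<close>. With
  \<open>h x = O(n * G)\<close> this controls the damped polynomial on the whole circle.\<close>

lemma h_away_from_gap:
  obtains c where "0 \<le> c" "\<And>x k y. nz x \<Longrightarrow> k \<in> I \<Longrightarrow>
     (\<And>i. i \<in> I \<Longrightarrow> \<bar>g k x\<bar> \<le> \<bar>g i y\<bar> \<and> (\<bar>g i x\<bar> \<le> C * \<bar>g k x\<bar> \<or> 1 / (2 * C) \<le> \<bar>g i y\<bar>)) \<Longrightarrow> h y \<le> c * h x"
proof -
  have C0: "C > 0" using C_ge_1 by simp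
  have "0 < 1 / (2 * C)" using C0 by simp
  then obtain V' where V': "\<forall>i\<in>I. \<forall>x. 1 / (2 * C) \<le> \<bar>g i x\<bar> \<longrightarrow> H i x \<le> V'"
    using H_bounded by blast
  define V where "V = \<bar>V'\<bar>"
  have V0: "0 \<le> V" by (simp add: V_def)
  have V: "H i x \<le> V" if "i \<in> I" "1 / (2 * C) \<le> \<bar>g i x\<bar>" for i x
    using V' that by (fastforce simp: V_def)
  define c where "c = max 1 (max (V * C) (C powr C))"
  have c: "1 \<le> c" "V * C \<le> c" "C powr C \<le> c" by (auto simp: c_def)
  show ?thesis
  proof (rule that[of c])
    show "0 \<le> c" using c by simp
    fix x k y
    assume nz: "nz x" and k: "k \<in> I"
      and y: "\<And>i. i \<in> I \<Longrightarrow> \<bar>g k x\<bar> \<le> \<bar>g i y\<bar> \<and> (\<bar>g i x\<bar> \<le> C * \<bar>g k x\<bar> \<or> 1 / (2 * C) \<le> \<bar>g i y\<bar>)"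
    have "H i y \<le> c * H i x" if i: "i \<in> I" for i
    proof -
      have gx: "g i x \<noteq> 0" "g k x \<noteq> 0" using nz i k by (auto simp: nz_def)
      hence gy: "g i y \<noteq> 0" using y[OF i] by auto
      have Hx: "0 < H i x" "1 / C \<le> H i x" using H_pos H_lower i gx by auto
      consider "1 / (2 * C) \<le> \<bar>g i y\<bar>" | "\<bar>g i x\<bar> \<le> \<bar>g i y\<bar>" | "\<bar>g i y\<bar> \<le> \<bar>g i x\<bar>" "\<bar>g i x\<bar> \<le> C * \<bar>g k x\<bar>"
        using y[OF i] by linarith
      thus ?thesis
      proof cases
        case 1
        have "H i y \<le> V" by (rule V[OF i 1])
        also have "V = (V * C) * (1 / C)" using C0 by simp
        also have "\<dots> \<le> c * H i x" using c Hx C0 V0 by (intro mult_mono) auto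
        finally show ?thesis .
      next
        case 2
        have "H i y \<le> (\<bar>g i x\<bar> / \<bar>g i y\<bar>) powr (1 / C) * H i x" by (rule H_decay[OF i gx(1) 2])
        also have "\<dots> \<le> 1 * H i x"
          using 2 C0 Hx gy by (intro mult_right_mono powr_le1) (auto simp: divide_le_eq_1)
        also have "\<dots> \<le> c * H i x" using c Hx by (intro mult_right_mono) auto
        finally show ?thesis .
      next
        case 3
        have "C * \<bar>g k x\<bar> \<le> C * \<bar>g i y\<bar>" using y[OF i] C0 by (intro mult_left_mono) auto
        hence le: "\<bar>g i x\<bar> / \<bar>g i y\<bar> \<le> C" using 3 gy by (simp add: pos_divide_le_eq)
        have "H i y \<le> (\<bar>g i x\<bar> / \<bar>g i y\<bar>) powr C * H i x" by (rule H_doubling[OF i gy 3(1)])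
        also have "\<dots> \<le> C powr C * H i x" using le C0 Hx by (intro mult_right_mono powr_mono2) auto
        also have "\<dots> \<le> c * H i x" using c Hx by (intro mult_right_mono) auto
        finally show ?thesis .
      qed
    qed
    hence "h y \<le> (\<Sum>i\<in>I. c * H i x)" unfolding h_def by (intro sum_mono)
    thus "h y \<le> c * h x" by (simp add: h_def sum_distrib_left)
  qed
qed

text \<open>
  Near a maximum \<open>x0\<close> of \<open>norm f * \<omega>\<close> compare \<open>\<omega>\<close> with a Gaussian \<open>exp (- b * (x - a)\<^sup>2)\<close> tangent to it
  at \<open>x0\<close>: since \<open>h'' \<le> 2 * b\<close> near \<open>x0\<close>, it lies above \<open>\<omega>\<close> up to the factor making both agree at
  \<open>x0\<close>, so \<open>x0\<close> also maximises \<open>norm f\<close> times the Gaussian.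
\<close>
lemma half_maximum_interval:
  obtains \<epsilon> where "0 < \<epsilon>" "\<epsilon> \<le> 1" "\<And>n f. n \<ge> 1 \<Longrightarrow> trig_entire n f \<Longrightarrow>
     \<exists>x0. \<forall>t y. \<bar>y - x0\<bar> \<le> \<epsilon> / real n \<longrightarrow> norm (f (of_real t)) * \<omega> t \<le> 2 * (norm (f (of_real y)) * \<omega> y)"
proof (rule gap_bound)
  fix K c3 assume c3: "0 \<le> c3" and gb: "\<And>n f A x k \<rho> m t. n \<ge> 1 \<Longrightarrow> trig_entire n f \<Longrightarrow>
     (\<And>t. norm (f (of_real t)) * \<omega> t \<le> A) \<Longrightarrow> k \<in> I \<Longrightarrow> 0 < \<rho> \<Longrightarrow> \<bar>g k x\<bar> \<le> \<rho> \<Longrightarrow> 0 \<le> m \<Longrightarrow>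
     (\<And>y. (\<And>i. i \<in> I \<Longrightarrow> \<rho> \<le> \<bar>g i y\<bar> \<and> (\<bar>g i x\<bar> \<le> C * \<bar>g k x\<bar> \<or> 1 / (2 * C) \<le> \<bar>g i y\<bar>)) \<Longrightarrow> h y \<le> m) \<Longrightarrow>
     norm (f (of_real t)) * ((1 + cos (t - x)) / 2) ^ (K * n) \<le> A * exp (m + c3 * real n * \<rho>)"
  show thesis
  proof (rule exponent_le_at_max)
    fix \<Lambda> assume \<Lambda>: "0 < \<Lambda>" and le\<Lambda>: "\<And>n f x k. n \<ge> 1 \<Longrightarrow> trig_entire n f \<Longrightarrow>
     (\<And>t. norm (f (of_real t)) * \<omega> t \<le> norm (f (of_real x)) * \<omega> x) \<Longrightarrow> 0 < norm (f (of_real x)) * \<omega> x \<Longrightarrow>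
     k \<in> I \<Longrightarrow> (\<And>i. i \<in> I \<Longrightarrow> \<bar>g k x\<bar> \<le> \<bar>g i x\<bar>) \<Longrightarrow> h x \<le> \<Lambda> * real n * \<bar>g k x\<bar>"
    show thesis
    proof (rule h_away_from_gap)
      fix c4 assume c4: "0 \<le> c4" and away: "\<And>x k y. nz x \<Longrightarrow> k \<in> I \<Longrightarrow>
     (\<And>i. i \<in> I \<Longrightarrow> \<bar>g k x\<bar> \<le> \<bar>g i y\<bar> \<and> (\<bar>g i x\<bar> \<le> C * \<bar>g k x\<bar> \<or> 1 / (2 * C) \<le> \<bar>g i y\<bar>)) \<Longrightarrow> h y \<le> c4 * h x"
      have C0: "0 < C" using C_ge_1 by simp
      \<comment> \<open>The damped polynomial will be at most \<open>A * exp (C5 * n * G)\<close>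
        everywhere: \<open>c4 * \<Lambda>\<close> stems from \<open>h\<close> outside the gap,
        \<open>c3\<close> from Remez.\<close>
      define C5 where "C5 = c4 * \<Lambda> + c3"
      have C5: "0 \<le> C5" using c3 c4 \<Lambda> by (simp add: C5_def)
      define D2 where "D2 = 4 * C * 2 powr C * \<Lambda>"
      have D2: "0 < D2" using C0 \<Lambda> by (simp add: D2_def)
      \<comment> \<open>\<open>D2 * n / G\<close> bounds the second derivative of \<open>h\<close>
        near \<open>x0\<close>, so \<open>M \<ge> D2\<close> makes \<phi> concave there. The summand
        \<open>8 * C\<^sup>2 * \<Lambda>\<close> puts the centre \<open>a\<close> within
        \<open>R / 8\<close> of \<open>x0\<close>, and \<open>16 * C\<^sup>2 * C5\<close> lets the
        Gaussian beat \<open>exp (C5 * n * G)\<close> at distance \<open>R\<close>.\<close>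
      define M where "M = 1 + D2 + 8 * C\<^sup>2 * \<Lambda> + 16 * C\<^sup>2 * C5"
      have M: "0 < M" "D2 \<le> M" "8 * C\<^sup>2 * \<Lambda> \<le> M" "16 * C\<^sup>2 * C5 \<le> M"
      proof -
        have "0 \<le> 8 * C\<^sup>2 * \<Lambda>" "0 \<le> 16 * C\<^sup>2 * C5" using C5 \<Lambda> by simp_all
        thus "0 < M" "D2 \<le> M" "8 * C\<^sup>2 * \<Lambda> \<le> M" "16 * C\<^sup>2 * C5 \<le> M" using D2 unfolding M_def by linarith+
      qed
      \<comment> \<open>Arranged so that
        \<open>L0 * n * R = C5 * n * G + N * R + 2 * b * R\<^sup>2\<close>, as
        \<open>G = 2 * C * R\<close> and \<open>b * R\<^sup>2 = M * n * R / (2 * C)\<close>. One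
        copy of \<open>b * R\<^sup>2\<close> meets the growth of the Gaussian in the strip, the
        other covers the loss \<open>b * R\<^sup>2 / 64\<close> at \<open>x0\<close>.\<close>
      define L0 where "L0 = 2 * C * C5 + 1 + real K + M / C"
      have L0: "0 \<le> L0" using C0 C5 M by (simp add: L0_def)
      \<comment> \<open>\<open>1 / C \<le> h x0 \<le> \<Lambda> * n * G\<close> forces
        \<open>R = G / (2 * C)\<close> to be at least \<open>r0 / n\<close>, so that discs of this
        radius fit into the strip.\<close>
      define r0 where "r0 = 1 / (2 * C\<^sup>2 * \<Lambda>)"
      have r0: "0 < r0" using C0 \<Lambda> by (simp add: r0_def)
      define \<epsilon> where "\<epsilon> = min 1 (r0 / (2 * exp (L0 * r0)))"
      show thesis
      proof (rule that[of \<epsilon>])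
        show "0 < \<epsilon>" "\<epsilon> \<le> 1" using r0 by (simp_all add: \<epsilon>_def)
        fix n :: nat and f
        assume n: "1 \<le> n" and f: "trig_entire n f"
        obtain x0 where x0: "\<And>t. norm (f (of_real t)) * \<omega> t \<le> norm (f (of_real x0)) * \<omega> x0"
          using trig_entire_max[OF f weight_continuous weight_periodic] by blast
        define A where "A = norm (f (of_real x0)) * \<omega> x0"
        have A0: "0 \<le> A" using weight_nonneg by (simp add: A_def)
        show "\<exists>x0. \<forall>t y. \<bar>y - x0\<bar> \<le> \<epsilon> / real n \<longrightarrow> norm (f (of_real t)) * \<omega> t \<le> 2 * (norm (f (of_real y)) * \<omega> y)"
        proof (cases "A = 0")
          case True
          have "norm (f (of_real t)) * \<omega> t \<le> 2 * (norm (f (of_real y)) * \<omega> y)" for t y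
          proof -
            have "norm (f (of_real t)) * \<omega> t \<le> 0" using x0[of t] True unfolding A_def by linarith
            moreover have "0 \<le> norm (f (of_real y)) * \<omega> y" using weight_nonneg by simp
            ultimately show ?thesis by simp
          qed
          thus ?thesis by blast
        next
          case False
          hence Apos: "0 < A" using A0 by simp
          have nz: "nz x0" using Apos weight_not_nz[of x0] by (fastforce simp: A_def)
          have "Min ((\<lambda>i. \<bar>g i x0\<bar>) ` I) \<in> (\<lambda>i. \<bar>g i x0\<bar>) ` I"
            using finite_I nonempty_I by (intro Min_in) auto
          then obtain k where k: "k \<in> I" "\<bar>g k x0\<bar> = Min ((\<lambda>i. \<bar>g i x0\<bar>) ` I)" by force
          have kmin: "\<bar>g k x0\<bar> \<le> \<bar>g i x0\<bar>" if "i \<in> I" for i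
            using that finite_I unfolding k(2) by (intro Min_le) auto
          define G where "G = \<bar>g k x0\<bar>"
          have G: "0 < G" using nz k by (auto simp: G_def nz_def)
          have hG: "h x0 \<le> \<Lambda> * real n * G" unfolding G_def
            using Apos by (intro le\<Lambda>[OF n f x0 _ k(1) kmin]) (auto simp: A_def)
          have hpos: "0 < h x0" by (rule h_pos[OF nz])
          have nn: "1 \<le> real n" using n by simp
          define R where "R = G / (2 * C)"
          have R: "0 < R" "G = 2 * C * R" using G C0 by (simp_all add: R_def)
          define b where "b = M * real n / G"
          have b: "0 < b" using M nn G by (simp add: b_def)
          have bR: "b * R\<^sup>2 = M * real n * R / (2 * C)"
            using R(1) C0 by (simp add: b_def R(2) power2_eq_square field_simps)
          define N where "N = n + K * n"
          \<comment> \<open>Damping leaves the value at \<open>x0\<close> unchanged and makes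
            \<open>gap_bound\<close> available on the whole circle.\<close>
          define f2 where "f2 z = f z * ((1 + cos (z - of_real x0)) / 2) ^ (K * n)" for z
          have f2: "trig_entire N f2" unfolding f2_def N_def by (rule trig_entire_raised_cos[OF f])
          have nf2: "norm (f2 (of_real t)) = norm (f (of_real t)) * ((1 + cos (t - x0)) / 2) ^ (K * n)" for t
            unfolding f2_def by (rule norm_raised_cos)
          have nf2_le: "norm (f2 (of_real t)) \<le> norm (f (of_real t))" for t
          proof -
            have "norm (f2 (of_real t)) \<le> norm (f (of_real t)) * 1"
              unfolding nf2 by (intro mult_left_mono raised_cos_power_le_one) auto
            thus ?thesis by simp
          qed
          have f2x0: "norm (f2 (of_real x0)) = A * exp (h x0)"
            by (simp add: nf2 A_def weight_nz[OF nz] exp_minus)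
          define B where "B = A * exp (C5 * real n * G)"
          have B: "norm (f2 (of_real t)) \<le> B" for t
          proof -
            have "norm (f2 (of_real t)) \<le> A * exp (c4 * h x0 + c3 * real n * G)"
              unfolding nf2
            proof (rule gb[OF n f _ k(1) G])
              show "norm (f (of_real t)) * \<omega> t \<le> A" for t using x0 by (simp add: A_def)
              show "\<bar>g k x0\<bar> \<le> G" by (simp add: G_def)
              show "0 \<le> c4 * h x0" using c4 hpos by simp
              fix y assume y: "\<And>i. i \<in> I \<Longrightarrow> G \<le> \<bar>g i y\<bar> \<and> (\<bar>g i x0\<bar> \<le> C * \<bar>g k x0\<bar> \<or> 1 / (2 * C) \<le> \<bar>g i y\<bar>)"
              show "h y \<le> c4 * h x0" by (rule away[OF nz k(1)]) (use y in \<open>auto simp: G_def\<close>)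
            qed
            also have "c4 * h x0 + c3 * real n * G \<le> C5 * real n * G"
              using mult_left_mono[OF hG c4] by (simp add: C5_def algebra_simps)
            finally show ?thesis using A0 by (simp add: B_def mult_left_mono)
          qed
          \<comment> \<open>The centre for which \<open>2 * b * (x0 - a)\<close> equals the
            derivative of \<open>h\<close> at \<open>x0\<close>, so that \<phi> is stationary
            there.\<close>
          define a where "a = x0 - (\<Sum>i\<in>I. H1 i x0) / (2 * b)"
          have h1: "\<bar>\<Sum>i\<in>I. H1 i x0\<bar> \<le> C * \<Lambda> * real n"
          proof -
            have "\<bar>\<Sum>i\<in>I. H1 i x0\<bar> \<le> (\<Sum>i\<in>I. \<bar>H1 i x0\<bar>)" by (rule sum_abs)
            also have "\<dots> \<le> (\<Sum>i\<in>I. C * H i x0 / G)"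
            proof (intro sum_mono)
              fix i assume i: "i \<in> I"
              have gi: "g i x0 \<noteq> 0" using nz i by (simp add: nz_def)
              have "\<bar>H1 i x0\<bar> \<le> C * H i x0 / \<bar>g i x0\<bar>" by (rule H1_bound[OF i gi])
              also have "\<dots> \<le> C * H i x0 / G"
                using kmin[OF i] G H_pos[OF i gi] C0 by (intro divide_left_mono) (auto simp: G_def)
              finally show "\<bar>H1 i x0\<bar> \<le> C * H i x0 / G" .
            qed
            also have "\<dots> = C * h x0 / G" by (simp add: h_def sum_distrib_left sum_divide_distrib)
            also have "\<dots> \<le> C * (\<Lambda> * real n * G) / G"
              using hG C0 G by (intro divide_right_mono mult_left_mono) auto
            also have "\<dots> = C * \<Lambda> * real n" using G by simp
            finally show ?thesis .
          qed
          have ax0: "\<bar>x0 - a\<bar> \<le> R / 8"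
          proof -
            have "\<bar>x0 - a\<bar> = \<bar>\<Sum>i\<in>I. H1 i x0\<bar> / (2 * b)" using b by (simp add: a_def abs_divide)
            also have "\<dots> \<le> C * \<Lambda> * real n / (2 * b)" using h1 b by (intro divide_right_mono) auto
            also have "\<dots> = (8 * C\<^sup>2 * \<Lambda>) * R / (8 * M)"
              using nn M R(1) C0 by (simp add: b_def R(2) power2_eq_square field_simps)
            also have "\<dots> \<le> M * R / (8 * M)" using M R by (intro divide_right_mono mult_right_mono) auto
            also have "\<dots> = R / 8" using M by simp
            finally show ?thesis .
          qed
          define \<phi> where "\<phi> x = h x - b * (x - a)\<^sup>2" for x
          have loc: "g i x \<noteq> 0" "\<bar>g i x0\<bar> \<le> 2 * \<bar>g i x\<bar>" "H i x \<le> 2 powr C * H i x0"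
            if "i \<in> I" "\<bar>x - x0\<bar> \<le> R" for i x
            using local_bounds[of i x0 G x] that nz kmin[of i] G by (auto simp: R_def G_def)
          have \<phi>_le: "\<phi> x \<le> \<phi> x0" if x: "\<bar>x - x0\<bar> \<le> R" for x
          proof (rule concave_tangent_max[where \<phi> = \<phi> and x = x and R = R
                and \<phi>' = "\<lambda>x. (\<Sum>i\<in>I. H1 i x) - 2 * b * (x - a)" and \<phi>'' = "\<lambda>x. (\<Sum>i\<in>I. H2 i x) - 2 * b"])
            fix y assume y: "\<bar>y - x0\<bar> \<le> R"
            have "((\<lambda>x. \<Sum>i\<in>I. H i x) has_real_derivative (\<Sum>i\<in>I. H1 i y)) (at y)"
              using H_deriv1 loc(1)[OF _ y] by (intro DERIV_sum) auto
            moreover have "((\<lambda>x. b * (x - a)\<^sup>2) has_real_derivative 2 * b * (y - a)) (at y)"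
              by (auto intro!: derivative_eq_intros)
            ultimately show "(\<phi> has_real_derivative (\<Sum>i\<in>I. H1 i y) - 2 * b * (y - a)) (at y)"
              unfolding \<phi>_def h_def by (rule DERIV_diff)
            have "((\<lambda>x. \<Sum>i\<in>I. H1 i x) has_real_derivative (\<Sum>i\<in>I. H2 i y)) (at y)"
              using H_deriv2 loc(1)[OF _ y] by (intro DERIV_sum) auto
            moreover have "((\<lambda>x. 2 * b * (x - a)) has_real_derivative 2 * b) (at y)"
              by (auto intro!: derivative_eq_intros)
            ultimately show "((\<lambda>x. (\<Sum>i\<in>I. H1 i x) - 2 * b * (x - a)) has_real_derivative
                  (\<Sum>i\<in>I. H2 i y) - 2 * b) (at y)"
              by (rule DERIV_diff)
            have "(\<Sum>i\<in>I. H2 i y) \<le> (\<Sum>i\<in>I. 4 * C * 2 powr C / G\<^sup>2 * H i x0)"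
            proof (intro sum_mono)
              fix i assume i: "i \<in> I"
              have gi: "g i x0 \<noteq> 0" using nz i by (simp add: nz_def)
              have Gi: "G \<le> 2 * \<bar>g i y\<bar>" using kmin[OF i] loc(2)[OF i y] by (simp add: G_def)
              have "(G / 2)\<^sup>2 \<le> \<bar>g i y\<bar>\<^sup>2" using G Gi by (intro power_mono) auto
              hence G2: "(G / 2)\<^sup>2 \<le> (g i y)\<^sup>2" by simp
              have "H2 i y \<le> C * H i y / (g i y)\<^sup>2" using H2_bound[OF i loc(1)[OF i y]] by simp
              also have "\<dots> \<le> C * (2 powr C * H i x0) / (G / 2)\<^sup>2"
                using loc(3)[OF i y] C0 G2 G H_pos[OF i gi]
                by (intro frac_le mult_left_mono) auto
              also have "\<dots> = 4 * C * 2 powr C / G\<^sup>2 * H i x0" by (simp add: power2_eq_square)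
              finally show "H2 i y \<le> 4 * C * 2 powr C / G\<^sup>2 * H i x0" .
            qed
            also have "\<dots> = 4 * C * 2 powr C / G\<^sup>2 * h x0" by (simp add: h_def sum_distrib_left)
            also have "\<dots> \<le> 4 * C * 2 powr C / G\<^sup>2 * (\<Lambda> * real n * G)"
              using hG C0 by (intro mult_left_mono) auto
            also have "\<dots> = D2 * real n / G" using G by (simp add: D2_def power2_eq_square field_simps)
            also have "\<dots> \<le> M * real n / G" using M G by (intro divide_right_mono mult_right_mono) auto
            also have "\<dots> \<le> 2 * b" using b by (simp add: b_def)
            finally show "(\<Sum>i\<in>I. H2 i y) - 2 * b \<le> 0" by simp
          next
            show "(\<Sum>i\<in>I. H1 i x0) - 2 * b * (x0 - a) = 0" using b by (simp add: a_def)
            show "\<bar>x - x0\<bar> \<le> R" by (rule x)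
          qed
          define Mx where "Mx = norm (f2 (of_real x0)) * exp (- b * (x0 - a)\<^sup>2)"
          have Mx\<phi>: "Mx = A * exp (\<phi> x0)"
            by (simp add: Mx_def f2x0 \<phi>_def exp_diff exp_minus divide_inverse)
          have bR64: "b * (x0 - a)\<^sup>2 \<le> b * R\<^sup>2 / 64"
          proof -
            have "\<bar>x0 - a\<bar>\<^sup>2 \<le> (R / 8)\<^sup>2" using ax0 by (intro power_mono) auto
            hence "(x0 - a)\<^sup>2 \<le> R\<^sup>2 / 64" by (simp add: power_divide)
            thus ?thesis using b mult_left_mono[of "(x0 - a)\<^sup>2" "R\<^sup>2 / 64" b] by simp
          qed
          have Mx_lower: "A * exp (- (b * R\<^sup>2 / 64)) \<le> Mx"
            unfolding Mx\<phi> using bR64 hpos A0 by (intro mult_left_mono) (auto simp: \<phi>_def)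
          have Mx: "norm (f2 (of_real t)) * exp (- b * (t - a)\<^sup>2) \<le> Mx" for t
          proof (cases "\<bar>t - x0\<bar> \<le> R")
            case True
            have "nz t" unfolding nz_def using loc(1)[OF _ True] by blast
            hence "norm (f (of_real t)) \<le> A * exp (h t)"
              using x0[of t] by (intro poly_le_of_weight[OF _ _ _ A0]) (auto simp: A_def)
            hence "norm (f2 (of_real t)) \<le> A * exp (h t)" using nf2_le[of t] by linarith
            hence "norm (f2 (of_real t)) * exp (- b * (t - a)\<^sup>2) \<le> (A * exp (h t)) * exp (- b * (t - a)\<^sup>2)"
              by (rule mult_right_mono) simp
            also have "\<dots> = A * exp (\<phi> t)" by (simp add: \<phi>_def exp_diff exp_minus divide_inverse)
            also have "\<dots> \<le> Mx" unfolding Mx\<phi> using \<phi>_le[OF True] A0 by (intro mult_left_mono) auto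
            finally show ?thesis .
          next
            case False
            \<comment> \<open>Far from \<open>x0\<close> the global bound \<open>B\<close> takes
              over. Of the Gaussian exponent \<open>49 / 64 * b * R\<^sup>2\<close>, one part in 64
              is kept for \<open>Mx_lower\<close> and the other 48 outweigh
              \<open>C5 * n * G\<close>.\<close>
            have "7 * R / 8 \<le> \<bar>t - a\<bar>" using False ax0 by linarith
            hence "(7 * R / 8)\<^sup>2 \<le> \<bar>t - a\<bar>\<^sup>2" using R by (intro power_mono) auto
            hence "b * (49 * R\<^sup>2 / 64) \<le> b * (t - a)\<^sup>2"
              using b by (intro mult_left_mono) (auto simp: power_divide power_mult_distrib)
            moreover have "C5 * real n * G \<le> 48 / 64 * (b * R\<^sup>2)"
            proof -
              have "C5 * real n * G = (16 * C\<^sup>2 * C5) * (real n * R / (8 * C))"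
                using C0 by (simp add: R(2) power2_eq_square field_simps)
              also have "\<dots> \<le> M * (real n * R / (8 * C))"
                using M(4) R(1) C0 by (intro mult_right_mono) auto
              also have "\<dots> = 1 / 4 * (b * R\<^sup>2)" unfolding bR by (simp add: field_simps)
              also have "\<dots> \<le> 48 / 64 * (b * R\<^sup>2)" using b by (intro mult_right_mono) auto
              finally show ?thesis .
            qed
            ultimately have e: "C5 * real n * G + - b * (t - a)\<^sup>2 \<le> - (b * R\<^sup>2 / 64)" by simp
            have "norm (f2 (of_real t)) * exp (- b * (t - a)\<^sup>2) \<le> B * exp (- b * (t - a)\<^sup>2)"
              using B by (intro mult_right_mono) auto
            also have "\<dots> = A * exp (C5 * real n * G + - b * (t - a)\<^sup>2)"
              unfolding B_def by (simp only: mult.assoc mult_exp_exp)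
            also have "\<dots> \<le> A * exp (- (b * R\<^sup>2 / 64))" using e A0 by (intro mult_left_mono) auto
            finally show ?thesis using Mx_lower by linarith
          qed
          have L: "B * exp (real N * R + b * R\<^sup>2 - (L0 * real n) * R) \<le> Mx"
          proof -
            have "L0 * real n * R = C5 * real n * G + real N * R + 2 * (b * R\<^sup>2)"
              unfolding bR using C0 by (simp add: L0_def R(2) N_def field_simps)
            hence e: "C5 * real n * G + (real N * R + b * R\<^sup>2 - (L0 * real n) * R) \<le> - (b * R\<^sup>2 / 64)"
              using b R(1) by (simp add: mult_nonneg_nonneg)
            have "B * exp (real N * R + b * R\<^sup>2 - (L0 * real n) * R) =
                A * exp (C5 * real n * G + (real N * R + b * R\<^sup>2 - (L0 * real n) * R))"
              unfolding B_def by (simp only: mult.assoc mult_exp_exp)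
            also have "\<dots> \<le> A * exp (- (b * R\<^sup>2 / 64))" using e A0 by (intro mult_left_mono) auto
            finally show ?thesis using Mx_lower by linarith
          qed
          have rR: "r0 / real n \<le> R"
          proof -
            have "1 / C \<le> \<Lambda> * real n * G" using h_lower[OF nz] hG by linarith
            thus ?thesis using C0 \<Lambda> nn by (simp add: r0_def R_def power2_eq_square field_simps)
          qed
          show ?thesis
          proof (intro exI[of _ x0] allI impI)
            fix t y assume y: "\<bar>y - x0\<bar> \<le> \<epsilon> / real n"
            have "\<epsilon> / real n \<le> (r0 / (2 * exp (L0 * r0))) / real n"
              using nn by (intro divide_right_mono) (auto simp: \<epsilon>_def)
            also have "\<dots> = (r0 / real n) / (2 * exp ((L0 * real n) * (r0 / real n)))" using nn by simp
            finally have "\<epsilon> / real n \<le> (r0 / real n) / (2 * exp ((L0 * real n) * (r0 / real n)))" .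
            hence y': "\<bar>y - x0\<bar> \<le> (r0 / real n) / (2 * exp ((L0 * real n) * (r0 / real n)))" using y by linarith
            have near: "Mx / 2 \<le> norm (f2 (of_real y)) * exp (- b * (y - a)\<^sup>2)"
              by (rule near_maximum[OF f2 B b Mx L _ rR _ _ y']) (use r0 nn L0 in \<open>auto simp: Mx_def\<close>)
            have yR: "\<bar>y - x0\<bar> \<le> R"
            proof -
              have "0 \<le> (L0 * real n) * (r0 / real n)" using L0 r0 nn by simp
              hence "1 \<le> exp ((L0 * real n) * (r0 / real n))" by (rule one_le_exp_iff[THEN iffD2])
              hence "1 \<le> 2 * exp ((L0 * real n) * (r0 / real n))" by linarith
              hence "(r0 / real n) / (2 * exp ((L0 * real n) * (r0 / real n))) \<le> (r0 / real n) / 1"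
                using r0 nn by (intro divide_left_mono) auto
              thus ?thesis using y' rR by simp
            qed
            have nzy: "nz y" unfolding nz_def using loc(1)[OF _ yR] by blast
            have "norm (f (of_real t)) * \<omega> t \<le> A" using x0 by (simp add: A_def)
            \<comment> \<open>Passing from \<open>x0\<close> to \<open>y\<close> costs only the
              factor 2 of \<open>near\<close>: multiplication by \<open>exp (- \<phi> x)\<close>
              converts the Gaussian back into \<omega>, and \<phi> is largest at
              \<open>x0\<close>.\<close>
            also have "A = Mx * exp (- \<phi> x0)" by (simp add: Mx\<phi> exp_minus)
            also have "\<dots> \<le> (2 * (norm (f2 (of_real y)) * exp (- b * (y - a)\<^sup>2))) * exp (- \<phi> y)"
              using near \<phi>_le[OF yR] by (intro mult_mono) auto
            also have "\<dots> = 2 * (norm (f2 (of_real y)) * \<omega> y)"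
              by (simp add: \<phi>_def weight_nz[OF nzy] exp_diff exp_minus divide_inverse)
            also have "\<dots> \<le> 2 * (norm (f (of_real y)) * \<omega> y)"
              using nf2_le[of y] weight_nonneg[of y] by (intro mult_left_mono mult_right_mono) auto
            finally show "norm (f (of_real t)) * \<omega> t \<le> 2 * (norm (f (of_real y)) * \<omega> y)" .
          qed
        qed
      qed
    qed
  qed
qed

end

section \<open>Products of weights of the class Omega\<close>

lemma periodic_bound_centred:
  assumes "\<And>t::real. f (t + 2 * pi) = f t" and "\<And>t. t \<in> {-pi..pi} \<Longrightarrow> P (f t)"
  shows "P (f t)"
proof (rule periodic_bound[where c = 0 and f = f and P = P])
  show "P (f t)" if "\<bar>t - 0\<bar> \<le> pi" for t using that by (intro assms(2)) (simp add: abs_le_iff)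
qed (rule assms(1))

lemma derivs_onE:
  assumes "derivs_on S f d"
  shows "x \<in> S \<Longrightarrow> (f has_real_derivative d 1 x) (at x within S)"
    and "x \<in> S \<Longrightarrow> (d 1 has_real_derivative d 2 x) (at x within S)"
proof -
  show "(d 1 has_real_derivative d 2 x) (at x within S)" if "x \<in> S"
    using assms that unfolding derivs_on_def by (metis numeral_2_eq_2 One_nat_def)
  show "(f has_real_derivative d 1 x) (at x within S)" if "x \<in> S"
  proof -
    have "(d 0 has_real_derivative d 1 x) (at x within S)"
      using assms that unfolding derivs_on_def by (metis One_nat_def)
    moreover have "\<And>y. y \<in> S \<Longrightarrow> f y = d 0 y" using assms unfolding derivs_on_def by simp
    ultimately show ?thesis unfolding has_field_derivative_def
      using has_derivative_transform[OF that, of f "d 0"] by blast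
  qed
qed

lemma derivative_nonpos_of_antimono_on:
  assumes f: "antimono_on S f" and S: "open S" "t \<in> S" and d: "(f has_real_derivative D) (at t)"
  shows "D \<le> 0"
proof (rule ccontr)
  assume "\<not> D \<le> 0"
  then obtain \<delta> where \<delta>: "\<delta> > 0" "\<And>h. 0 < h \<Longrightarrow> h < \<delta> \<Longrightarrow> f t < f (t + h)"
    using DERIV_pos_inc_right[OF d] by auto
  obtain e where e: "e > 0" "ball t e \<subseteq> S" using S open_contains_ball by blast
  define k where "k = min \<delta> e / 2"
  have k: "0 < k" "k < \<delta>" "k < e" using \<delta> e by (auto simp: k_def)
  have "t + k \<in> S" using e k by (auto simp: dist_norm)
  hence "f (t + k) \<le> f t" using monotone_onD[OF f S(2), of "t + k"] k by auto
  thus False using \<delta>(2)[of k] k by auto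
qed

text \<open>Since \<open>F\<close> decreases, (F4) confines the derivative of \<open>ln F\<close> to
  the range from \<open>- b / t\<close> to \<open>- a / t\<close>; thus
  \<open>ln F + a * ln t\<close> decreases and \<open>ln F + b * ln t\<close> increases. At
  \<open>A\<close> the derivative is one-sided, so monotonicity is derived from derivatives in the
  open interval and continuity up to its ends.\<close>

lemma outer_power_bounds:
  fixes F :: "real \<Rightarrow> real"
  assumes pos: "\<And>x. x \<in> {0<..A} \<Longrightarrow> 0 < F x" and anti: "antimono_on {0<..A} F"
    and d: "\<And>x. x \<in> {0<..A} \<Longrightarrow> (F has_real_derivative D x) (at x within {0<..A})"
    and lo: "\<And>x. x \<in> {0<..A} \<Longrightarrow> a \<le> \<bar>D x\<bar> * x / F x"
    and up: "\<And>x. x \<in> {0<..A} \<Longrightarrow> \<bar>D x\<bar> * x / F x \<le> b"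
    and xy: "0 < x" "x \<le> y" "y \<le> A"
  shows "F y \<le> (x / y) powr a * F x" "F x \<le> (y / x) powr b * F y"
proof -
  have cF: "continuous_on {x..y} F"
    using d xy by (intro continuous_on_subset[OF DERIV_continuous_on[of "{0<..A}" F D]]) auto
  have cont: "continuous_on {x..y} (\<lambda>t. ln (F t) + c * ln t)" for c
  proof -
    have "F t \<noteq> 0" "t \<noteq> 0" if "t \<in> {x..y}" for t using pos[of t] that xy by auto
    thus ?thesis by (intro continuous_intros cF ballI)
  qed
  have der: "((\<lambda>t. ln (F t) + c * ln t) has_real_derivative (D t / F t + c / t)) (at t)"
    and D: "- (b / t) \<le> D t / F t" "D t / F t \<le> - (a / t)" if t: "x < t" "t < y" for t c
  proof -
    have tA: "t \<in> {0<..A}" "t \<in> {0<..<A}" using t xy by auto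
    have "(F has_real_derivative D t) (at t within {0<..<A})"
      by (rule has_field_derivative_subset[OF d[OF tA(1)]]) auto
    hence dt: "(F has_real_derivative D t) (at t)" using tA at_within_open[of t "{0<..<A}"] by simp
    have F0: "0 < F t" using pos tA by blast
    show "((\<lambda>t. ln (F t) + c * ln t) has_real_derivative (D t / F t + c / t)) (at t)"
      using F0 tA by (auto intro!: derivative_eq_intros dt simp: field_simps)
    have "antimono_on {0<..<A} F" using anti by (rule monotone_on_subset) auto
    hence Dn: "D t \<le> 0" using derivative_nonpos_of_antimono_on[OF _ _ tA(2) dt] by auto
    show "- (b / t) \<le> D t / F t" "D t / F t \<le> - (a / t)"
      using lo[OF tA(1)] up[OF tA(1)] Dn F0 tA by (auto simp: field_simps)
  qed
  have F: "0 < F x" "0 < F y" using pos xy by auto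
  have "ln (F y) + a * ln y \<le> ln (F x) + a * ln x"
    by (rule DERIV_nonpos_imp_decreasing_open[OF xy(2) _ cont]) (use der D in \<open>fastforce\<close>)
  hence "exp (ln (F y)) \<le> exp (a * (ln x - ln y) + ln (F x))" by (simp add: algebra_simps)
  thus "F y \<le> (x / y) powr a * F x" using F xy by (simp add: exp_add powr_def ln_div)
  have "ln (F x) + b * ln x \<le> ln (F y) + b * ln y"
    by (rule DERIV_nonneg_imp_increasing_open[OF xy(2) _ cont]) (use der D in \<open>fastforce\<close>)
  hence "exp (ln (F x)) \<le> exp (b * (ln y - ln x) + ln (F y))" by (simp add: algebra_simps)
  thus "F x \<le> (y / x) powr b * F y" using F xy by (simp add: exp_add powr_def ln_div)
qed

lemma inner_separation:
  fixes g :: "real \<Rightarrow> real"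
  assumes per: "\<And>t. g (t + 2 * pi) = g t"
    and d1: "\<And>t. (g has_real_derivative d t) (at t)" and d2: "\<And>t. (d has_real_derivative d' t) (at t)"
    and simple: "\<And>t. g t = 0 \<Longrightarrow> d t \<noteq> 0" and lip: "\<And>x y. \<bar>g x - g y\<bar> \<le> D * \<bar>x - y\<bar>"
  shows "\<exists>C0. \<forall>C x y. C0 \<le> C \<longrightarrow> \<bar>x - y\<bar> \<le> 1 / C \<longrightarrow> \<bar>x - y\<bar> / C \<le> \<bar>g x\<bar> + \<bar>g y\<bar>"
proof -
  have cg: "continuous_on S g" and cd: "continuous_on S d" for S
    using d1 d2 by (auto intro!: continuous_at_imp_continuous_on DERIV_isCont)
  have perd: "d (t + 2 * pi) = d t" for t
  proof -
    have "((\<lambda>x. g (x + 2 * pi)) has_real_derivative d (t + 2 * pi)) (at t)"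
      using d1 DERIV_shift by blast
    thus ?thesis using d1[of t] DERIV_unique by (simp add: per)
  qed
  have "continuous_on {-pi..pi} (\<lambda>t. \<bar>g t\<bar> + \<bar>d t\<bar>)" by (intro continuous_intros cg cd)
  from continuous_attains_inf[OF _ _ this] obtain t0
    where t0: "\<forall>t\<in>{-pi..pi}. \<bar>g t0\<bar> + \<bar>d t0\<bar> \<le> \<bar>g t\<bar> + \<bar>d t\<bar>" by auto
  define \<kappa> where "\<kappa> = (\<bar>g t0\<bar> + \<bar>d t0\<bar>) / 2"
  have \<kappa>: "\<kappa> > 0" using simple[of t0] by (cases "g t0 = 0") (auto simp: \<kappa>_def)
  have t02: "2 * \<kappa> \<le> \<bar>g t\<bar> + \<bar>d t\<bar>" if "t \<in> {-pi..pi}" for t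
    using t0 that unfolding \<kappa>_def by (simp only: mult_2 field_sum_of_halves)
  have \<kappa>le: "2 * \<kappa> \<le> \<bar>g t\<bar> + \<bar>d t\<bar>" for t
    by (rule periodic_bound_centred[where f = "\<lambda>t. \<bar>g t\<bar> + \<bar>d t\<bar>" and P = "\<lambda>s. 2 * \<kappa> \<le> s"])
       (use per perd t02 in simp_all)
  have D0: "0 \<le> D" using lip[of 0 1] by auto
  have key: "\<bar>x - y\<bar> / C \<le> \<bar>g x\<bar> + \<bar>g y\<bar>"
    if C: "max 1 ((1 + D) / \<kappa>) \<le> C" and xy: "\<bar>x - y\<bar> \<le> 1 / C" "x < y" for C x y
  proof -
    have C1: "1 \<le> C" "(1 + D) / \<kappa> \<le> C" using C by auto
    have CK: "(1 + D) / C \<le> \<kappa>" using C1 \<kappa> by (simp add: field_simps)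
    have CK1: "1 / C \<le> \<kappa>"
    proof -
      have "1 / C \<le> (1 + D) / C" using D0 C1 by (intro divide_right_mono) auto
      thus ?thesis using CK by linarith
    qed
    obtain \<xi> where \<xi>: "x < \<xi>" "\<xi> < y" "g y - g x = (y - x) * d \<xi>"
      using MVT2[OF xy(2), of g d] d1 by blast
    show ?thesis
    proof (cases "\<bar>d \<xi>\<bar> \<ge> \<kappa>")
      case True
      have "\<bar>x - y\<bar> / C = \<bar>x - y\<bar> * (1 / C)" by simp
      also have "\<dots> \<le> \<bar>x - y\<bar> * \<bar>d \<xi>\<bar>" using True CK1 by (intro mult_left_mono) auto
      also have "\<dots> = \<bar>g y - g x\<bar>" using \<xi> by (simp add: abs_mult abs_minus_commute)
      finally show ?thesis by linarith
    next
      case False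
      hence "\<kappa> \<le> \<bar>g \<xi>\<bar>" using \<kappa>le[of \<xi>] by linarith
      moreover have "\<bar>g \<xi> - g x\<bar> \<le> D * \<bar>\<xi> - x\<bar>" by (rule lip)
      moreover have "D * \<bar>\<xi> - x\<bar> \<le> D * (1 / C)" using \<xi> xy D0 by (intro mult_left_mono) auto
      ultimately have "\<kappa> - D / C \<le> \<bar>g x\<bar>" by simp
      moreover have "1 / C \<le> \<kappa> - D / C" using CK by (simp add: add_divide_distrib)
      moreover have "\<bar>x - y\<bar> / C \<le> 1 / C"
      proof -
        have "1 / C \<le> 1" using C1 by simp
        hence "\<bar>x - y\<bar> \<le> 1" using xy by linarith
        thus ?thesis using C1 by (intro divide_right_mono) auto
      qed
      ultimately show ?thesis by linarith
    qed
  qed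
  show ?thesis
  proof (intro exI[of _ "max 1 ((1 + D) / \<kappa>)"] allI impI)
    fix C x y assume C: "max 1 ((1 + D) / \<kappa>) \<le> C" and xy: "\<bar>x - y\<bar> \<le> 1 / C"
    consider "x < y" | "y < x" | "x = y" by linarith
    thus "\<bar>x - y\<bar> / C \<le> \<bar>g x\<bar> + \<bar>g y\<bar>"
    proof cases
      case 2
      thus ?thesis using key[OF C, of y x] xy by (simp add: abs_minus_commute add.commute)
    qed (use key[OF C] xy in auto)
  qed
qed

text \<open>By compactness, counterexamples for ever larger constants accumulate at a point
  \<open>l\<close> at which both functions vanish. There the Lipschitz bound for \<open>f\<close>
  and the separation of \<open>g\<close> from its zero \<open>l\<close> give \<open>\<bar>f y\<bar>
  \<le> L * \<bar>y - l\<bar> \<le> L\<^sup>2 * \<bar>g y\<bar>\<close>, so the third alternative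
  cannot fail.\<close>

lemma inner_pair:
  fixes f g :: "real \<Rightarrow> real"
  assumes perf: "\<And>t. f (t + 2 * pi) = f t" and perg: "\<And>t. g (t + 2 * pi) = g t"
    and lipf: "\<And>x y. \<bar>f x - f y\<bar> \<le> L * \<bar>x - y\<bar>" and lipg: "\<And>x y. \<bar>g x - g y\<bar> \<le> L * \<bar>x - y\<bar>"
    and sep: "\<And>x y. \<bar>x - y\<bar> \<le> 1 / L \<Longrightarrow> \<bar>x - y\<bar> / L \<le> \<bar>g x\<bar> + \<bar>g y\<bar>" and L: "1 \<le> L"
  shows "eventually (\<lambda>C. \<forall>x. 1 / C \<le> \<bar>f x\<bar> \<or> 1 / C \<le> \<bar>g x\<bar> \<or> \<bar>f x\<bar> \<le> C * \<bar>g x\<bar>) at_top"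
proof -
  have cont: "continuous_on UNIV f" "continuous_on UNIV g"
    using lipf lipg L by (auto intro!: lipschitz_on_continuous_on[of L] lipschitz_onI simp: dist_real_def)
  have "\<exists>N::nat. \<forall>x\<in>{-pi..pi}. 1 / real (Suc N) \<le> \<bar>f x\<bar> \<or> 1 / real (Suc N) \<le> \<bar>g x\<bar> \<or> \<bar>f x\<bar> \<le> real (Suc N) * \<bar>g x\<bar>"
  proof (rule ccontr)
    assume "\<nexists>N::nat. \<forall>x\<in>{-pi..pi}. 1 / real (Suc N) \<le> \<bar>f x\<bar> \<or> 1 / real (Suc N) \<le> \<bar>g x\<bar> \<or> \<bar>f x\<bar> \<le> real (Suc N) * \<bar>g x\<bar>"
    hence "\<forall>N. \<exists>x. x \<in> {-pi..pi} \<and> \<bar>f x\<bar> < 1 / real (Suc N) \<and> \<bar>g x\<bar> < 1 / real (Suc N) \<and> real (Suc N) * \<bar>g x\<bar> < \<bar>f x\<bar>"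
      by (metis not_le)
    then obtain x where x: "\<And>N. x N \<in> {-pi..pi}" "\<And>N. \<bar>f (x N)\<bar> < 1 / real (Suc N)"
        "\<And>N. \<bar>g (x N)\<bar> < 1 / real (Suc N)" "\<And>N. real (Suc N) * \<bar>g (x N)\<bar> < \<bar>f (x N)\<bar>"
      by metis
    have "seq_compact {-pi..pi}" by (simp add: compact_imp_seq_compact)
    then obtain l r where l: "strict_mono r" "(x \<circ> r) \<longlonglongrightarrow> l"
      using x(1) unfolding seq_compact_def by metis
    have zero: "F l = 0" if F: "continuous_on UNIV F" "\<And>N. \<bar>F (x N)\<bar> < 1 / real (Suc N)" for F :: "real \<Rightarrow> real"
    proof -
      have "(\<lambda>N. F ((x \<circ> r) N)) \<longlonglongrightarrow> F l"
        using l(2) F(1) continuous_on_tendsto_compose[of UNIV F "x \<circ> r" l] by simp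
      moreover have "(\<lambda>N. F ((x \<circ> r) N)) \<longlonglongrightarrow> 0"
      proof (rule Lim_null_comparison[OF always_eventually])
        show "\<forall>N. norm (F ((x \<circ> r) N)) \<le> 1 / real (Suc N)"
        proof
          fix N
          have "\<bar>F (x (r N))\<bar> < 1 / real (Suc (r N))" by (rule F)
          also have "\<dots> \<le> 1 / real (Suc N)" using seq_suble[OF l(1), of N] by (intro divide_left_mono) auto
          finally show "norm (F ((x \<circ> r) N)) \<le> 1 / real (Suc N)" by simp
        qed
        show "(\<lambda>N. 1 / real (Suc N)) \<longlonglongrightarrow> 0" by (rule lim_1_over_n[THEN LIMSEQ_Suc])
      qed
      ultimately show ?thesis by (rule LIMSEQ_unique)
    qed
    have fl: "f l = 0" and gl: "g l = 0" using zero cont x by blast+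
    have "eventually (\<lambda>N. dist ((x \<circ> r) N) l < 1 / L) sequentially"
      using tendstoD[OF l(2), of "1 / L"] L by simp
    moreover have "eventually (\<lambda>N. L * L \<le> real (Suc N)) sequentially"
      by real_asymp
    ultimately have "eventually (\<lambda>N. dist ((x \<circ> r) N) l < 1 / L \<and> L * L \<le> real (Suc N)) sequentially"
      by (rule eventually_conj)
    then obtain N where N: "\<bar>x (r N) - l\<bar> < 1 / L" "L * L \<le> real (Suc N)"
      using eventually_happens'[OF sequentially_bot] by (fastforce simp: dist_real_def)
    define y where "y = x (r N)"
    have "\<bar>f y\<bar> \<le> L * \<bar>y - l\<bar>" using lipf[of y l] fl by simp
    also have "\<dots> = (L * L) * (\<bar>y - l\<bar> / L)" using L by simp
    also have "\<dots> \<le> (L * L) * \<bar>g y\<bar>"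
      using sep[of y l] N L gl by (intro mult_left_mono) (auto simp: y_def)
    also have "\<dots> \<le> real (Suc (r N)) * \<bar>g y\<bar>"
    proof (rule mult_right_mono)
      have "real (Suc N) \<le> real (Suc (r N))" using seq_suble[OF l(1), of N] by simp
      thus "L * L \<le> real (Suc (r N))" using N by linarith
    qed simp
    finally show False using x(4)[of "r N"] by (simp add: y_def)
  qed
  then obtain N where N: "\<And>x. x \<in> {-pi..pi} \<Longrightarrow>
      1 / real (Suc N) \<le> \<bar>f x\<bar> \<or> 1 / real (Suc N) \<le> \<bar>g x\<bar> \<or> \<bar>f x\<bar> \<le> real (Suc N) * \<bar>g x\<bar>" by blast
  have "1 / C \<le> \<bar>f x\<bar> \<or> 1 / C \<le> \<bar>g x\<bar> \<or> \<bar>f x\<bar> \<le> C * \<bar>g x\<bar>" if C: "real (Suc N) \<le> C" for C x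
  proof -
    have "1 / C \<le> 1 / real (Suc N)" using C by (intro divide_left_mono mult_pos_pos) auto
    moreover have "1 / real (Suc N) \<le> \<bar>f x\<bar> \<or> 1 / real (Suc N) \<le> \<bar>g x\<bar> \<or> \<bar>f x\<bar> \<le> real (Suc N) * \<bar>g x\<bar>"
      by (rule periodic_bound_centred[where f = "\<lambda>x. (f x, g x)" and
            P = "\<lambda>(a, b). 1 / real (Suc N) \<le> \<bar>a\<bar> \<or> 1 / real (Suc N) \<le> \<bar>b\<bar> \<or> \<bar>a\<bar> \<le> real (Suc N) * \<bar>b\<bar>", simplified split_conv])
         (use perf perg N in auto)
    moreover have "real (Suc N) * \<bar>g x\<bar> \<le> C * \<bar>g x\<bar>" using C by (intro mult_right_mono) auto
    ultimately show ?thesis by linarith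
  qed
  thus ?thesis unfolding eventually_at_top_linorder by blast
qed

text \<open>The bounds that share the constant \<open>C\<close>. In \<open>factor_of\<close> they
  are required for all large \<open>C\<close>, so that finitely many factors, together with the
  pairwise comparison of their inner functions, obtain a common constant by intersecting
  eventualities.\<close>

definition factor_bounds :: "real \<Rightarrow> (real \<Rightarrow> real) \<Rightarrow> (real \<Rightarrow> real) \<Rightarrow> (real \<Rightarrow> real) \<Rightarrow> (real \<Rightarrow> real) \<Rightarrow> bool" where
  "factor_bounds C g H H1 H2 \<longleftrightarrow> 1 \<le> C \<and>
     (\<forall>x y. \<bar>g x - g y\<bar> \<le> C * \<bar>x - y\<bar>) \<and>
     (\<forall>x y. \<bar>x - y\<bar> \<le> 1 / C \<longrightarrow> \<bar>x - y\<bar> / C \<le> \<bar>g x\<bar> + \<bar>g y\<bar>) \<and>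
     (\<forall>x. g x \<noteq> 0 \<longrightarrow> 1 / C \<le> H x) \<and>
     (\<forall>x y. g x \<noteq> 0 \<longrightarrow> \<bar>g x\<bar> \<le> \<bar>g y\<bar> \<longrightarrow> H y \<le> (\<bar>g x\<bar> / \<bar>g y\<bar>) powr (1 / C) * H x) \<and>
     (\<forall>x y. g x \<noteq> 0 \<longrightarrow> \<bar>g x\<bar> \<le> \<bar>g y\<bar> \<longrightarrow> H x \<le> (\<bar>g y\<bar> / \<bar>g x\<bar>) powr C * H y) \<and>
     (\<forall>x. g x \<noteq> 0 \<longrightarrow> \<bar>H1 x\<bar> \<le> C * H x / \<bar>g x\<bar>) \<and>
     (\<forall>x. g x \<noteq> 0 \<longrightarrow> \<bar>H2 x\<bar> \<le> C * H x / (g x)\<^sup>2)"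

lemma factor_boundsD:
  assumes "factor_bounds C g H H1 H2"
  shows "1 \<le> C" "\<bar>g x - g y\<bar> \<le> C * \<bar>x - y\<bar>"
    and "\<bar>x - y\<bar> \<le> 1 / C \<Longrightarrow> \<bar>x - y\<bar> / C \<le> \<bar>g x\<bar> + \<bar>g y\<bar>"
    and "g x \<noteq> 0 \<Longrightarrow> 1 / C \<le> H x"
    and "g x \<noteq> 0 \<Longrightarrow> \<bar>g x\<bar> \<le> \<bar>g y\<bar> \<Longrightarrow> H y \<le> (\<bar>g x\<bar> / \<bar>g y\<bar>) powr (1 / C) * H x"
    and "g x \<noteq> 0 \<Longrightarrow> \<bar>g x\<bar> \<le> \<bar>g y\<bar> \<Longrightarrow> H x \<le> (\<bar>g y\<bar> / \<bar>g x\<bar>) powr C * H y"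
    and "g x \<noteq> 0 \<Longrightarrow> \<bar>H1 x\<bar> \<le> C * H x / \<bar>g x\<bar>"
    and "g x \<noteq> 0 \<Longrightarrow> \<bar>H2 x\<bar> \<le> C * H x / (g x)\<^sup>2"
  using assms unfolding factor_bounds_def by simp_all

definition factor_of :: "(real \<Rightarrow> real) \<Rightarrow> (real \<Rightarrow> real) \<Rightarrow> (real \<Rightarrow> real) \<Rightarrow> (real \<Rightarrow> real) \<Rightarrow> (real \<Rightarrow> real) \<Rightarrow> bool" where
  "factor_of w g H H1 H2 \<longleftrightarrow>
     (\<forall>x. g (x + 2 * pi) = g x) \<and>
     (\<forall>x. w x = (if g x = 0 then 0 else exp (- H x))) \<and> (\<forall>x. w (x + 2 * pi) = w x) \<and>
     continuous_on UNIV w \<and>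
     (\<forall>x. g x \<noteq> 0 \<longrightarrow> (H has_real_derivative H1 x) (at x) \<and> (H1 has_real_derivative H2 x) (at x)) \<and>
     (\<forall>\<gamma>>0. \<exists>V. \<forall>x. \<gamma> \<le> \<bar>g x\<bar> \<longrightarrow> H x \<le> V) \<and>
     (\<forall>V. \<exists>\<gamma>>0. \<forall>x. g x \<noteq> 0 \<longrightarrow> \<bar>g x\<bar> < \<gamma> \<longrightarrow> V \<le> H x) \<and>
     eventually (\<lambda>C. factor_bounds C g H H1 H2) at_top"

text \<open>Evenness gives \<open>H = F \<bar>g\<bar>\<close> off the zeros, so only
  \<open>F\<close> on the positive side enters. (F1) yields the blow-up and the continuity of the
  weight at its zeros, (F2) boundedness away from them, (F3) the bounds for \<open>H1\<close> and
  \<open>H2\<close>, and (F4) the comparisons with powers.\<close>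

lemma Omega_class_factor:
  assumes "w \<in> Omega_class"
  shows "\<exists>g H H1 H2. factor_of w g H H1 H2"
proof -
  obtain A g F where A: "A > 0" and inner: "Omega_inner A g" and outer: "Omega_outer A F"
    and w: "w = (\<lambda>t. if g t = 0 then 0 else exp (- F (g t)))"
    using assms unfolding Omega_class_def by blast
  obtain d D where per: "\<And>t. g (t + 2 * pi) = g t" and gA: "\<And>t. g t \<in> {-A..A}"
    and dg: "derivs_on UNIV g d" and D: "D > 0" "\<And>n t. n \<ge> 1 \<Longrightarrow> \<bar>d n t\<bar> \<le> D ^ n * fact n"
    and simple: "\<And>t. g t = 0 \<Longrightarrow> d 1 t \<noteq> 0"
    using inner unfolding Omega_inner_def periodic_2pi_def by metis
  have F_even: "\<And>x. x \<in> {-A..A} - {0} \<Longrightarrow> 0 < F x \<and> F (- x) = F x"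
    and F_lim: "filterlim F at_top (at_right 0)" and F_anti: "antimono_on {0<..A} F"
    using outer unfolding Omega_outer_def by blast+
  obtain e B a b where de: "derivs_on {0<..A} F e"
    and B: "B > 0" "\<And>x n. x \<in> {0<..A} \<Longrightarrow> n \<ge> 1 \<Longrightarrow> \<bar>e n x\<bar> \<le> B ^ n * real n ^ n * F x / x ^ n"
    and ab: "a > 0" "b > 0" "\<And>x. x \<in> {0<..A} \<Longrightarrow> a \<le> \<bar>e 1 x\<bar> * x / F x"
      "\<And>x. x \<in> {0<..A} \<Longrightarrow> \<bar>e 1 x\<bar> * x / F x \<le> b"
    using outer unfolding Omega_outer_def by blast
  have g1: "(g has_real_derivative d 1 t) (at t)" and g2: "(d 1 has_real_derivative d 2 t) (at t)" for t
    using derivs_onE[OF dg, of t] by auto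
  have dD: "\<bar>d 1 t\<bar> \<le> D" "\<bar>d 2 t\<bar> \<le> 2 * D\<^sup>2" for t
    using D(2)[of 1 t] D(2)[of 2 t] by (auto simp: numeral_2_eq_2 power2_eq_square)
  have lip: "\<bar>g x - g y\<bar> \<le> D * \<bar>x - y\<bar>" for x y
    using field_differentiable_bound[of UNIV g "d 1" D x y] g1 dD by auto
  have cg: "continuous_on UNIV g"
    using g1 by (auto intro!: continuous_at_imp_continuous_on DERIV_isCont)
  have Fpos: "0 < F x" if "x \<in> {0<..A}" for x using F_even[of x] that by auto
  have absg: "\<bar>g x\<bar> \<in> {0<..A}" if "g x \<noteq> 0" for x using gA[of x] that by auto
  have Fabs: "F (g x) = F \<bar>g x\<bar>" if "g x \<noteq> 0" for x
    using F_even[of "g x"] gA[of x] that by (cases "g x \<ge> 0") auto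
  define H where "H x = F (g x)" for x
  define H1 where "H1 x = e 1 \<bar>g x\<bar> * (sgn (g x) * d 1 x)" for x
  define H2 where "H2 x = e 2 \<bar>g x\<bar> * (d 1 x)\<^sup>2 + e 1 \<bar>g x\<bar> * (sgn (g x) * d 2 x)" for x
  have HF: "H x = F \<bar>g x\<bar>" if "g x \<noteq> 0" for x using Fabs[OF that] by (simp add: H_def)
  have Hder: "(H has_real_derivative H1 x) (at x)" "(H1 has_real_derivative H2 x) (at x)" if gx: "g x \<noteq> 0" for x
  proof -
    define \<sigma> where "\<sigma> = sgn (g x)"
    have \<sigma>: "\<sigma> * \<sigma> = 1" "\<sigma> * g x = \<bar>g x\<bar>" using gx by (auto simp: \<sigma>_def sgn_if)
    define U where "U = {y. 0 < \<sigma> * g y}"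
    have U: "open U" unfolding U_def
      by (intro open_Collect_less continuous_intros continuous_on_subset[OF cg]) auto
    have xU: "x \<in> U" using gx \<sigma> by (simp add: U_def)
    have Ug: "g y \<noteq> 0" "sgn (g y) = \<sigma>" "\<bar>g y\<bar> = \<sigma> * g y" if "y \<in> U" for y
      using that by (auto simp: U_def \<sigma>_def sgn_if zero_less_mult_iff split: if_splits)
    have img: "(\<lambda>y. \<sigma> * g y) ` U \<subseteq> {0<..A}" using absg Ug by fastforce
    have \<sigma>g: "((\<lambda>y. \<sigma> * g y) has_real_derivative \<sigma> * d 1 x) (at x)"
      by (intro DERIV_cmult g1)
    \<comment> \<open>At points where \<bar>g\<bar> equals \<open>A\<close>, only a one-sided
      derivative of the outer function is available. As \<open>\<sigma> * g\<close> maps the open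
      set \<open>U\<close> into \<open>{0<..A}\<close>, the chain rule within the image still yields
      a two-sided derivative at \<open>x\<close>.\<close>
    have chain: "((\<lambda>y. f (\<sigma> * g y)) has_real_derivative f' * (\<sigma> * d 1 x)) (at x)"
      if f: "(f has_real_derivative f') (at (\<sigma> * g x) within {0<..A})" for f :: "real \<Rightarrow> real" and f'
    proof -
      have "(f has_real_derivative f') (at (\<sigma> * g x) within (\<lambda>y. \<sigma> * g y) ` U)"
        using f img by (rule has_field_derivative_subset)
      from DERIV_image_chain[OF this has_field_derivative_at_within[OF \<sigma>g]]
      have "(f \<circ> (\<lambda>y. \<sigma> * g y) has_real_derivative f' * (\<sigma> * d 1 x)) (at x within U)" .
      thus ?thesis using at_within_open[OF xU U] by (simp add: o_def)
    qed
    have in0: "\<sigma> * g x \<in> {0<..A}" using img xU by blast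
    have "((\<lambda>y. F (\<sigma> * g y)) has_real_derivative e 1 (\<sigma> * g x) * (\<sigma> * d 1 x)) (at x)"
      by (rule chain[OF derivs_onE(1)[OF de in0]])
    hence "((\<lambda>y. F (\<sigma> * g y)) has_real_derivative H1 x) (at x)"
      using gx \<sigma> by (simp add: H1_def \<sigma>_def)
    thus "(H has_real_derivative H1 x) (at x)"
      by (rule has_field_derivative_transform_within_open[OF _ U xU]) (use HF Ug in auto)
    have "((\<lambda>y. e 1 (\<sigma> * g y)) has_real_derivative e 2 (\<sigma> * g x) * (\<sigma> * d 1 x)) (at x)"
      by (rule chain[OF derivs_onE(2)[OF de in0]])
    hence "((\<lambda>y. e 1 (\<sigma> * g y) * (\<sigma> * d 1 y)) has_real_derivative
        e 2 (\<sigma> * g x) * (\<sigma> * d 1 x) * (\<sigma> * d 1 x) + (\<sigma> * d 2 x) * e 1 (\<sigma> * g x)) (at x)"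
      by (rule DERIV_mult[OF _ DERIV_cmult[OF g2]])
    also have "e 2 (\<sigma> * g x) * (\<sigma> * d 1 x) * (\<sigma> * d 1 x) + (\<sigma> * d 2 x) * e 1 (\<sigma> * g x) = H2 x"
    proof -
      have "e 2 (\<sigma> * g x) * (\<sigma> * d 1 x) * (\<sigma> * d 1 x) = e 2 (\<sigma> * g x) * (d 1 x * d 1 x) * (\<sigma> * \<sigma>)"
        by (simp only: mult_ac)
      thus ?thesis using \<sigma> by (simp add: H2_def \<sigma>_def[symmetric] power2_eq_square mult_ac)
    qed
    finally show "(H1 has_real_derivative H2 x) (at x)"
      by (rule has_field_derivative_transform_within_open[OF _ U xU]) (use Ug in \<open>auto simp: H1_def\<close>)
  qed
  have Hpos: "0 < H x" if "g x \<noteq> 0" for x using HF[OF that] Fpos absg[OF that] by simp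
  have HA: "F A \<le> H x" if "g x \<noteq> 0" for x
    unfolding HF[OF that] using monotone_onD[OF F_anti absg[OF that], of A] absg[OF that] A by auto
  have FA: "0 < F A" using Fpos A by simp
  have bounded: "\<exists>V. \<forall>x. \<gamma> \<le> \<bar>g x\<bar> \<longrightarrow> H x \<le> V" if "\<gamma> > 0" for \<gamma>
  proof (intro exI allI impI)
    fix x assume x: "\<gamma> \<le> \<bar>g x\<bar>"
    hence gx: "g x \<noteq> 0" using that by auto
    show "H x \<le> F \<gamma>" unfolding HF[OF gx]
      using monotone_onD[OF F_anti, of \<gamma> "\<bar>g x\<bar>"] x that absg[OF gx] by auto
  qed
  have blowup: "\<exists>\<gamma>>0. \<forall>x. g x \<noteq> 0 \<longrightarrow> \<bar>g x\<bar> < \<gamma> \<longrightarrow> V \<le> H x" for V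
  proof -
    have "eventually (\<lambda>x. V \<le> F x) (at_right 0)" using F_lim by (simp add: filterlim_at_top)
    then obtain \<gamma> where "\<gamma> > 0" "\<And>y. 0 < y \<Longrightarrow> y < \<gamma> \<Longrightarrow> V \<le> F y"
      unfolding eventually_at_right_field by blast
    thus ?thesis using HF by (intro exI[of _ \<gamma>]) auto
  qed
  have wH: "w x = (if g x = 0 then 0 else exp (- H x))" for x by (simp add: w H_def)
  have cont: "isCont w x" for x
  proof (cases "g x = 0")
    case False
    define U where "U = {y. g y \<noteq> 0}"
    have U: "open U" unfolding U_def
      by (intro open_Collect_neq continuous_intros continuous_on_subset[OF cg]) auto
    have "isCont (\<lambda>y. exp (- H y)) x" using Hder(1)[OF False] DERIV_isCont by (intro continuous_intros) blast
    moreover have "eventually (\<lambda>y. exp (- H y) = w y) (nhds x)"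
      using eventually_nhds_in_open[OF U, of x] False by (auto simp: U_def wH elim: eventually_mono)
    ultimately show ?thesis using isCont_cong by metis
  next
    case True
    have "(w \<longlongrightarrow> 0) (at x)"
    proof (rule tendstoI)
      fix \<epsilon> :: real assume \<epsilon>: "\<epsilon> > 0"
      obtain \<gamma> where \<gamma>: "\<gamma> > 0" "\<And>y. g y \<noteq> 0 \<Longrightarrow> \<bar>g y\<bar> < \<gamma> \<Longrightarrow> 1 - ln \<epsilon> \<le> H y"
        using blowup[of "1 - ln \<epsilon>"] by blast
      have "(g \<longlongrightarrow> 0) (at x)" using cg True by (metis continuous_on_eq_continuous_at isCont_def open_UNIV UNIV_I)
      from tendstoD[OF this \<gamma>(1)] show "eventually (\<lambda>y. dist (w y) 0 < \<epsilon>) (at x)"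
      proof (rule eventually_mono)
        fix y assume y: "dist (g y) 0 < \<gamma>"
        show "dist (w y) 0 < \<epsilon>"
        proof (cases "g y = 0")
          case False
          have "- H y < ln \<epsilon>" using \<gamma>(2)[OF False] y by simp
          hence "exp (- H y) < exp (ln \<epsilon>)" by (simp only: exp_less_cancel_iff)
          thus ?thesis using False \<epsilon> by (simp add: wH)
        qed (use \<epsilon> in \<open>simp add: wH\<close>)
      qed
    qed
    thus ?thesis using True by (simp add: isCont_def wH)
  qed
  obtain C0 where C0: "\<And>C x y. C0 \<le> C \<Longrightarrow> \<bar>x - y\<bar> \<le> 1 / C \<Longrightarrow> \<bar>x - y\<bar> / C \<le> \<bar>g x\<bar> + \<bar>g y\<bar>"
    using inner_separation[OF per g1 g2 simple lip] by blast
  \<comment> \<open>\<open>B * D\<close> serves \<open>H1\<close>. In \<open>H2\<close> the square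
    of the first derivative of \<open>g\<close> contributes
    \<open>4 * B\<^sup>2 * D\<^sup>2\<close>; the term with its second derivative has only
    \<open>1 / \<bar>g x\<bar>\<close>, and \<open>\<bar>g x\<bar> \<le> A\<close> turns it into the
    last summand over \<open>(g x)\<^sup>2\<close>.\<close>
  define K where "K = B * D + 4 * B\<^sup>2 * D\<^sup>2 + 2 * B * D\<^sup>2 * A"
  have Kpos: "0 \<le> B * D" "0 \<le> 4 * B\<^sup>2 * D\<^sup>2" "0 \<le> 2 * B * D\<^sup>2 * A" using B D A by simp_all
  have e_bounds: "\<bar>e 1 x\<bar> \<le> B * F x / x" "\<bar>e 2 x\<bar> \<le> 4 * B\<^sup>2 * F x / x\<^sup>2" if "x \<in> {0<..A}" for x
    using B(2)[OF that, of 1] B(2)[OF that, of 2] by (auto simp: mult_ac)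
  have H1b: "\<bar>H1 x\<bar> \<le> K * H x / \<bar>g x\<bar>" if gx: "g x \<noteq> 0" for x
  proof -
    have "\<bar>H1 x\<bar> = \<bar>e 1 \<bar>g x\<bar>\<bar> * \<bar>d 1 x\<bar>" using gx by (simp add: H1_def abs_mult abs_sgn_eq)
    also have "\<dots> \<le> (B * F \<bar>g x\<bar> / \<bar>g x\<bar>) * D"
      using e_bounds(1)[OF absg[OF gx]] dD Fpos[OF absg[OF gx]] B by (intro mult_mono) auto
    also have "\<dots> = (B * D) * H x / \<bar>g x\<bar>" by (simp add: HF[OF gx])
    also have "\<dots> \<le> K * H x / \<bar>g x\<bar>"
      using Kpos Hpos[OF gx] by (intro divide_right_mono mult_right_mono) (auto simp: K_def)
    finally show ?thesis .
  qed
  have H2b: "\<bar>H2 x\<bar> \<le> K * H x / (g x)\<^sup>2" if gx: "g x \<noteq> 0" for x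
  proof -
    have "\<bar>H2 x\<bar> \<le> \<bar>e 2 \<bar>g x\<bar>\<bar> * \<bar>d 1 x\<bar>\<^sup>2 + \<bar>e 1 \<bar>g x\<bar>\<bar> * \<bar>d 2 x\<bar>"
      unfolding H2_def using gx abs_triangle_ineq[of "e 2 \<bar>g x\<bar> * (d 1 x)\<^sup>2" "e 1 \<bar>g x\<bar> * (sgn (g x) * d 2 x)"]
      by (simp add: abs_mult abs_sgn_eq)
    also have "\<dots> \<le> (4 * B\<^sup>2 * F \<bar>g x\<bar> / \<bar>g x\<bar>\<^sup>2) * D\<^sup>2 + (B * F \<bar>g x\<bar> / \<bar>g x\<bar>) * (2 * D\<^sup>2)"
      using e_bounds[OF absg[OF gx]] dD Fpos[OF absg[OF gx]] B
      by (intro add_mono mult_mono power_mono) auto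
    also have "(B * F \<bar>g x\<bar> / \<bar>g x\<bar>) * (2 * D\<^sup>2) \<le> (2 * B * D\<^sup>2 * A) * F \<bar>g x\<bar> / \<bar>g x\<bar>\<^sup>2"
    proof -
      have "(B * F \<bar>g x\<bar> / \<bar>g x\<bar>) * (2 * D\<^sup>2) = (2 * B * D\<^sup>2 * \<bar>g x\<bar>) * F \<bar>g x\<bar> / \<bar>g x\<bar>\<^sup>2"
        using gx by (simp add: power2_eq_square field_simps)
      also have "\<dots> \<le> (2 * B * D\<^sup>2 * A) * F \<bar>g x\<bar> / \<bar>g x\<bar>\<^sup>2"
        using absg[OF gx] Fpos[OF absg[OF gx]] B by (intro divide_right_mono mult_right_mono mult_left_mono) auto
      finally show ?thesis .
    qed
    also have "(4 * B\<^sup>2 * F \<bar>g x\<bar> / \<bar>g x\<bar>\<^sup>2) * D\<^sup>2 + (2 * B * D\<^sup>2 * A) * F \<bar>g x\<bar> / \<bar>g x\<bar>\<^sup>2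
        = (4 * B\<^sup>2 * D\<^sup>2 + 2 * B * D\<^sup>2 * A) * H x / (g x)\<^sup>2"
      by (simp add: HF[OF gx] add_divide_distrib algebra_simps)
    also have "\<dots> \<le> K * H x / (g x)\<^sup>2"
      using Kpos Hpos[OF gx] by (intro divide_right_mono mult_right_mono) (auto simp: K_def)
    finally show ?thesis by simp
  qed
  have pb: "H y \<le> (\<bar>g x\<bar> / \<bar>g y\<bar>) powr a * H x" "H x \<le> (\<bar>g y\<bar> / \<bar>g x\<bar>) powr b * H y"
    if "g x \<noteq> 0" "\<bar>g x\<bar> \<le> \<bar>g y\<bar>" for x y
  proof -
    have gy: "g y \<noteq> 0" using that by auto
    show "H y \<le> (\<bar>g x\<bar> / \<bar>g y\<bar>) powr a * H x" "H x \<le> (\<bar>g y\<bar> / \<bar>g x\<bar>) powr b * H y"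
      unfolding HF[OF that(1)] HF[OF gy]
      using outer_power_bounds[OF Fpos F_anti derivs_onE(1)[OF de] ab(3,4), of "\<bar>g x\<bar>" "\<bar>g y\<bar>"]
        that absg[OF that(1)] absg[OF gy] by auto
  qed
  have fb: "factor_bounds C g H H1 H2" if C: "1 + \<bar>C0\<bar> + D + \<bar>K\<bar> + 1 / F A + 1 / a + b \<le> C" for C
  proof -
    have "0 < 1 / F A" "0 < 1 / a" using FA ab by simp_all
    hence C: "1 \<le> C" "C0 \<le> C" "D \<le> C" "K \<le> C" "1 / F A \<le> C" "1 / a \<le> C" "b \<le> C"
      using C D(1) ab(2) by linarith+
    show ?thesis unfolding factor_bounds_def
    proof (intro conjI allI impI)
      show "1 \<le> C" by (rule C)
      fix x y
      have "D * \<bar>x - y\<bar> \<le> C * \<bar>x - y\<bar>" using C by (intro mult_right_mono) auto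
      thus "\<bar>g x - g y\<bar> \<le> C * \<bar>x - y\<bar>" using lip[of x y] by linarith
      show "\<bar>x - y\<bar> / C \<le> \<bar>g x\<bar> + \<bar>g y\<bar>" if "\<bar>x - y\<bar> \<le> 1 / C" using C0[OF C(2) that] .
      assume gx: "g x \<noteq> 0"
      have H0: "0 < H x" by (rule Hpos[OF gx])
      have "1 / C \<le> F A" using C FA by (simp add: field_simps)
      thus "1 / C \<le> H x" using HA[OF gx] by linarith
      have "K * H x / \<bar>g x\<bar> \<le> C * H x / \<bar>g x\<bar>" using C H0 by (intro divide_right_mono mult_right_mono) auto
      thus "\<bar>H1 x\<bar> \<le> C * H x / \<bar>g x\<bar>" using H1b[OF gx] by linarith
      have "K * H x / (g x)\<^sup>2 \<le> C * H x / (g x)\<^sup>2" using C H0 by (intro divide_right_mono mult_right_mono) auto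
      thus "\<bar>H2 x\<bar> \<le> C * H x / (g x)\<^sup>2" using H2b[OF gx] by linarith
      assume gxy: "\<bar>g x\<bar> \<le> \<bar>g y\<bar>"
      hence gy: "g y \<noteq> 0" using gx by auto
      have "1 / C \<le> a" using C ab by (simp add: field_simps)
      hence "(\<bar>g x\<bar> / \<bar>g y\<bar>) powr a \<le> (\<bar>g x\<bar> / \<bar>g y\<bar>) powr (1 / C)"
        using gx gy gxy by (intro powr_mono') (auto simp: divide_le_eq_1)
      hence "(\<bar>g x\<bar> / \<bar>g y\<bar>) powr a * H x \<le> (\<bar>g x\<bar> / \<bar>g y\<bar>) powr (1 / C) * H x"
        using H0 by (intro mult_right_mono) auto
      thus "H y \<le> (\<bar>g x\<bar> / \<bar>g y\<bar>) powr (1 / C) * H x" using pb(1)[OF gx gxy] by linarith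
      have "(\<bar>g y\<bar> / \<bar>g x\<bar>) powr b \<le> (\<bar>g y\<bar> / \<bar>g x\<bar>) powr C"
        using gx gy gxy C by (intro powr_mono) (auto simp: le_divide_eq_1)
      hence "(\<bar>g y\<bar> / \<bar>g x\<bar>) powr b * H y \<le> (\<bar>g y\<bar> / \<bar>g x\<bar>) powr C * H y"
        using Hpos[OF gy] by (intro mult_right_mono) auto
      thus "H x \<le> (\<bar>g y\<bar> / \<bar>g x\<bar>) powr C * H y" using pb(2)[OF gx gxy] by linarith
    qed
  qed
  hence ev: "eventually (\<lambda>C. factor_bounds C g H H1 H2) at_top"
    unfolding eventually_at_top_linorder by blast
  have perw: "w (x + 2 * pi) = w x" for x by (simp add: w per)
  have "continuous_on UNIV w" using cont by (intro continuous_at_imp_continuous_on ballI)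
  hence "factor_of w g H H1 H2" unfolding factor_of_def
    using per wH perw Hder bounded blowup ev by blast
  thus ?thesis by blast
qed


lemma ex_tame_family:
  assumes fin: "finite I" "I \<noteq> {}" and w: "\<And>i. i \<in> I \<Longrightarrow> ws i \<in> Omega_class"
  shows "\<exists>g H H1 H2 C. tame_family I g H H1 H2 C (\<lambda>t. \<Prod>i\<in>I. ws i t)"
proof -
  obtain g where g: "\<forall>i\<in>I. \<exists>H H1 H2. factor_of (ws i) (g i) H H1 H2"
    using bchoice[of I "\<lambda>i g. \<exists>H H1 H2. factor_of (ws i) g H H1 H2"] Omega_class_factor w by auto
  obtain H where H: "\<forall>i\<in>I. \<exists>H1 H2. factor_of (ws i) (g i) (H i) H1 H2"
    using bchoice[OF g] by auto
  obtain H1 where H1: "\<forall>i\<in>I. \<exists>H2. factor_of (ws i) (g i) (H i) (H1 i) H2"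
    using bchoice[OF H] by auto
  obtain H2 where fac: "\<forall>i\<in>I. factor_of (ws i) (g i) (H i) (H1 i) (H2 i)"
    using bchoice[OF H1] by auto
  have per: "g i (x + 2 * pi) = g i x"
    and wH: "ws i x = (if g i x = 0 then 0 else exp (- H i x))" and perw: "ws i (x + 2 * pi) = ws i x"
    and cont: "continuous_on UNIV (ws i)"
    and der: "g i x \<noteq> 0 \<Longrightarrow> (H i has_real_derivative H1 i x) (at x)"
      "g i x \<noteq> 0 \<Longrightarrow> (H1 i has_real_derivative H2 i x) (at x)"
    and bounded: "\<gamma> > 0 \<Longrightarrow> \<exists>V. \<forall>x. \<gamma> \<le> \<bar>g i x\<bar> \<longrightarrow> H i x \<le> V"
    and blowup: "\<exists>\<gamma>>0. \<forall>x. g i x \<noteq> 0 \<longrightarrow> \<bar>g i x\<bar> < \<gamma> \<longrightarrow> V \<le> H i x"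
    and ev: "eventually (\<lambda>C. factor_bounds C (g i) (H i) (H1 i) (H2 i)) at_top"
    if "i \<in> I" for i x \<gamma> V
    using fac[rule_format, OF that] unfolding factor_of_def by blast+
  have ev1: "eventually (\<lambda>C. \<forall>i\<in>I. factor_bounds C (g i) (H i) (H1 i) (H2 i)) at_top"
    using ev fin by (intro eventually_ball_finite) auto
  \<comment> \<open>A provisional constant: \<open>inner_pair\<close> takes Lipschitz and separation
    bounds as input, before the common \<open>C\<close> can be chosen.\<close>
  then obtain L where L: "\<forall>i\<in>I. factor_bounds L (g i) (H i) (H1 i) (H2 i)"
    using eventually_happens'[OF trivial_limit_at_top_linorder] by blast
  have ev2: "eventually (\<lambda>C. \<forall>i\<in>I. \<forall>k\<in>I. \<forall>x. 1 / C \<le> \<bar>g i x\<bar> \<or> 1 / C \<le> \<bar>g k x\<bar> \<or> \<bar>g i x\<bar> \<le> C * \<bar>g k x\<bar>) at_top"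
  proof (intro eventually_ball_finite fin ballI)
    fix i k assume ik: "i \<in> I" "k \<in> I"
    from L ik have Lb: "factor_bounds L (g i) (H i) (H1 i) (H2 i)" "factor_bounds L (g k) (H k) (H1 k) (H2 k)"
      by auto
    show "eventually (\<lambda>C. \<forall>x. 1 / C \<le> \<bar>g i x\<bar> \<or> 1 / C \<le> \<bar>g k x\<bar> \<or> \<bar>g i x\<bar> \<le> C * \<bar>g k x\<bar>) at_top"
      by (rule inner_pair[of "g i" "g k" L])
         (rule per[OF ik(1)] per[OF ik(2)] factor_boundsD(2)[OF Lb(1)] factor_boundsD(2)[OF Lb(2)]
           factor_boundsD(1)[OF Lb(1)] factor_boundsD(3)[OF Lb(2)], assumption?)+
  qed
  obtain C where C: "\<forall>i\<in>I. factor_bounds C (g i) (H i) (H1 i) (H2 i)"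
      "\<forall>i\<in>I. \<forall>k\<in>I. \<forall>x. 1 / C \<le> \<bar>g i x\<bar> \<or> 1 / C \<le> \<bar>g k x\<bar> \<or> \<bar>g i x\<bar> \<le> C * \<bar>g k x\<bar>"
    using eventually_happens'[OF trivial_limit_at_top_linorder eventually_conj[OF ev1 ev2]] by blast
  have Cf: "1 \<le> C" "\<bar>g i x - g i y\<bar> \<le> C * \<bar>x - y\<bar>"
     "\<bar>x - y\<bar> \<le> 1 / C \<Longrightarrow> \<bar>x - y\<bar> / C \<le> \<bar>g i x\<bar> + \<bar>g i y\<bar>"
     "g i x \<noteq> 0 \<Longrightarrow> 1 / C \<le> H i x"
     "g i x \<noteq> 0 \<Longrightarrow> \<bar>g i x\<bar> \<le> \<bar>g i y\<bar> \<Longrightarrow> H i y \<le> (\<bar>g i x\<bar> / \<bar>g i y\<bar>) powr (1 / C) * H i x"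
     "g i x \<noteq> 0 \<Longrightarrow> \<bar>g i x\<bar> \<le> \<bar>g i y\<bar> \<Longrightarrow> H i x \<le> (\<bar>g i y\<bar> / \<bar>g i x\<bar>) powr C * H i y"
     "g i x \<noteq> 0 \<Longrightarrow> \<bar>H1 i x\<bar> \<le> C * H i x / \<bar>g i x\<bar>"
     "g i x \<noteq> 0 \<Longrightarrow> \<bar>H2 i x\<bar> \<le> C * H i x / (g i x)\<^sup>2"
    if "i \<in> I" for i x y
    by (use factor_boundsD[OF C(1)[rule_format, OF that]] in blast)+
  have "tame_family I g H H1 H2 C (\<lambda>t. \<Prod>i\<in>I. ws i t)"
  proof
    show "finite I" "I \<noteq> {}" by fact+
    show "1 \<le> C" using Cf(1) fin by blast
    show "1 / C \<le> \<bar>g i x\<bar> \<or> 1 / C \<le> \<bar>g k x\<bar> \<or> \<bar>g i x\<bar> \<le> C * \<bar>g k x\<bar>" if "i \<in> I" "k \<in> I" for i k x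
      using C(2) that by blast
    show "\<exists>V. \<forall>i\<in>I. \<forall>x. \<gamma> \<le> \<bar>g i x\<bar> \<longrightarrow> H i x \<le> V" if \<gamma>: "0 < \<gamma>" for \<gamma>
    proof -
      obtain V where V: "\<forall>i\<in>I. \<forall>x. \<gamma> \<le> \<bar>g i x\<bar> \<longrightarrow> H i x \<le> V i"
        using bchoice[of I "\<lambda>i V. \<forall>x. \<gamma> \<le> \<bar>g i x\<bar> \<longrightarrow> H i x \<le> V"] bounded \<gamma> by auto
      have "H i x \<le> Max (V ` I)" if "i \<in> I" "\<gamma> \<le> \<bar>g i x\<bar>" for i x
      proof -
        have "H i x \<le> V i" using V that by blast
        also have "V i \<le> Max (V ` I)" using fin that by (intro Max_ge) auto
        finally show ?thesis .
      qed
      thus ?thesis by blast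
    qed
    show "\<exists>\<gamma>>0. \<forall>i\<in>I. \<forall>x. g i x \<noteq> 0 \<longrightarrow> \<bar>g i x\<bar> < \<gamma> \<longrightarrow> V \<le> H i x" for V
    proof -
      obtain \<gamma> where \<gamma>: "\<forall>i\<in>I. \<gamma> i > 0 \<and> (\<forall>x. g i x \<noteq> 0 \<longrightarrow> \<bar>g i x\<bar> < \<gamma> i \<longrightarrow> V \<le> H i x)"
        using bchoice[of I "\<lambda>i \<gamma>. \<gamma> > 0 \<and> (\<forall>x. g i x \<noteq> 0 \<longrightarrow> \<bar>g i x\<bar> < \<gamma> \<longrightarrow> V \<le> H i x)"] blowup by auto
      have "Min (\<gamma> ` I) > 0" using \<gamma> fin by (subst Min_gr_iff) auto
      moreover have "V \<le> H i x" if "i \<in> I" "g i x \<noteq> 0" "\<bar>g i x\<bar> < Min (\<gamma> ` I)" for i x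
      proof -
        have "Min (\<gamma> ` I) \<le> \<gamma> i" using fin that by (intro Min_le) auto
        thus ?thesis using \<gamma> that by force
      qed
      ultimately show ?thesis by blast
    qed
    show "(\<Prod>i\<in>I. ws i x) = (if \<exists>i\<in>I. g i x = 0 then 0 else exp (- (\<Sum>i\<in>I. H i x)))" for x
    proof (cases "\<exists>i\<in>I. g i x = 0")
      case True
      thus ?thesis using wH fin by (auto intro!: prod_zero)
    next
      case False
      have "(\<Prod>i\<in>I. ws i x) = (\<Prod>i\<in>I. exp (- H i x))" using False wH by (intro prod.cong) auto
      also have "\<dots> = exp (\<Sum>i\<in>I. - H i x)" using fin by (simp add: exp_sum)
      finally show ?thesis using False by (simp add: sum_negf)
    qed
    show "continuous_on UNIV (\<lambda>t. \<Prod>i\<in>I. ws i t)" using cont by (intro continuous_intros) auto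
    show "(\<Prod>i\<in>I. ws i (x + 2 * pi)) = (\<Prod>i\<in>I. ws i x)" for x
      using perw by (intro prod.cong) auto
  qed (rule per Cf der; assumption)+
  thus ?thesis by blast
qed

section \<open>Powers of weights and transfer to products\<close>

lemma Omega_outer_scale:
  assumes F: "Omega_outer A F" and r: "r > 0"
  shows "Omega_outer A (\<lambda>x. r * F x)"
proof -
  obtain d B a b where d: "derivs_on {0<..A} F d"
    and B: "B > 0" "\<forall>x\<in>{0<..A}. \<forall>n\<ge>1. \<bar>d n x\<bar> \<le> B ^ n * real n ^ n * F x / x ^ n"
    and ab: "a > 0" "b > 0" "\<forall>x\<in>{0<..A}. b \<le> \<bar>d 1 x\<bar> * x / F x \<and> \<bar>d 1 x\<bar> * x / F x \<le> a"
    using F unfolding Omega_outer_def by blast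
  have 1: "derivs_on {0<..A} (\<lambda>x. r * F x) (\<lambda>n x. r * d n x)"
    using d unfolding derivs_on_def by (auto intro: DERIV_cmult)
  have 2: "\<exists>B>0. \<forall>x\<in>{0<..A}. \<forall>n\<ge>1. \<bar>r * d n x\<bar> \<le> B ^ n * real n ^ n * (r * F x) / x ^ n"
  proof (intro exI[of _ B] conjI ballI allI impI B(1))
    fix x n assume "x \<in> {0<..A}" "1 \<le> (n::nat)"
    from mult_left_mono[OF B(2)[rule_format, OF this], of r] r
    show "\<bar>r * d n x\<bar> \<le> B ^ n * real n ^ n * (r * F x) / x ^ n" by (simp add: abs_mult mult_ac)
  qed
  have "\<bar>r * d 1 x\<bar> * x / (r * F x) = \<bar>d 1 x\<bar> * x / F x" for x
    using r by (simp add: abs_mult)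
  hence 3: "\<exists>a>0. \<exists>b>0. \<forall>x\<in>{0<..A}. b \<le> \<bar>r * d 1 x\<bar> * x / (r * F x) \<and> \<bar>r * d 1 x\<bar> * x / (r * F x) \<le> a"
    using ab by metis
  have 4: "filterlim (\<lambda>x. r * F x) at_top (at_right 0)"
    using F r unfolding Omega_outer_def
    by (intro filterlim_tendsto_pos_mult_at_top[OF tendsto_const]) simp_all
  have 5: "antimono_on {0<..A} (\<lambda>x. r * F x)"
    using F r unfolding Omega_outer_def monotone_on_def by simp
  have 6: "\<forall>x\<in>{-A..A} - {0}. 0 < r * F x \<and> r * F (- x) = r * F x"
    using F r unfolding Omega_outer_def by simp
  show ?thesis unfolding Omega_outer_def
    by (intro conjI 4 5 6 exI[of _ "\<lambda>n x. r * d n x"] 1 2 3)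
qed

text \<open>Replacing \<open>F\<close> by \<open>r * F\<close> keeps the ratios in (F3) and (F4),
  and a zero stays a zero since \<open>0 powr r = 0\<close>. Powers enter because
  \<open>norm T powr q * \<omega>\<close> is the \<open>q\<close>-th power of
  \<open>norm T * \<omega> powr (1 / q)\<close>.\<close>

lemma Omega_class_powr:
  assumes "w \<in> Omega_class" "r > 0"
  shows "(\<lambda>t. w t powr r) \<in> Omega_class"
proof -
  obtain A g F where "A > 0" "Omega_inner A g" "Omega_outer A F"
    and w: "w = (\<lambda>t. if g t = 0 then 0 else exp (- F (g t)))"
    using assms unfolding Omega_class_def by blast
  moreover have "(\<lambda>t. w t powr r) = (\<lambda>t. if g t = 0 then 0 else exp (- (r * F (g t))))"
    by (auto simp: w fun_eq_iff powr_def)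
  ultimately show ?thesis using Omega_outer_scale[OF _ assms(2), of A F] unfolding Omega_class_def by blast
qed

lemma Omega_class_nonneg: "w \<in> Omega_class \<Longrightarrow> 0 \<le> w t"
  by (auto simp: Omega_class_def)

lemma Omega_product_half_maximum:
  assumes fin: "finite I" "I \<noteq> {}" and w: "\<And>i. i \<in> I \<Longrightarrow> ws i \<in> Omega_class" and r: "r > 0"
  shows "\<exists>\<epsilon>>0. \<epsilon> \<le> 1 \<and> (\<forall>n\<ge>1. \<forall>f. trig_entire n f \<longrightarrow> (\<exists>x0. \<forall>t y. \<bar>y - x0\<bar> \<le> \<epsilon> / real n \<longrightarrow>
     norm (f (of_real t)) * (\<Prod>i\<in>I. ws i t) powr r \<le> 2 * (norm (f (of_real y)) * (\<Prod>i\<in>I. ws i y) powr r)))"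
proof -
  have eq: "(\<Prod>i\<in>I. ws i t) powr r = (\<Prod>i\<in>I. ws i t powr r)" for t
    by (intro prod_powr_distrib Omega_class_nonneg[OF w])
  obtain g H H1 H2 C where tf: "tame_family I g H H1 H2 C (\<lambda>t. \<Prod>i\<in>I. ws i t powr r)"
    using ex_tame_family[OF fin, of "\<lambda>i t. ws i t powr r"] Omega_class_powr[OF w r] by blast
  show ?thesis unfolding eq
    by (rule tame_family.half_maximum_interval[OF tf]) blast
qed

lemma Omega_product_props:
  assumes fin: "finite I" "I \<noteq> {}" and w: "\<And>i. i \<in> I \<Longrightarrow> ws i \<in> Omega_class"
  shows "continuous_on UNIV (\<lambda>t. \<Prod>i\<in>I. ws i t)" "0 \<le> (\<Prod>i\<in>I. ws i t)" "(\<Prod>i\<in>I. ws i t) \<le> 1"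
    "(\<Prod>i\<in>I. ws i (t + 2 * pi)) = (\<Prod>i\<in>I. ws i t)"
proof -
  obtain g H H1 H2 C where tf: "tame_family I g H H1 H2 C (\<lambda>t. \<Prod>i\<in>I. ws i t)"
    using ex_tame_family[OF fin, of ws] w by blast
  show "continuous_on UNIV (\<lambda>t. \<Prod>i\<in>I. ws i t)" "0 \<le> (\<Prod>i\<in>I. ws i t)" "(\<Prod>i\<in>I. ws i t) \<le> 1"
    "(\<Prod>i\<in>I. ws i (t + 2 * pi)) = (\<Prod>i\<in>I. ws i t)"
    using tame_family.weight_continuous[OF tf] tame_family.weight_nonneg[OF tf]
      tame_family.weight_le_one[OF tf] tame_family.weight_periodic[OF tf] by auto
qed

section \<open>Localisation\<close>

text \<open>The sine handles \<bar>\<theta>\<bar> up to 1 through the imaginary part, the cosine the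
  rest through the real part. The range 5 stays below \<open>2 * pi\<close>, where
  \<open>1 - cis \<theta>\<close> vanishes again, and exceeds \<open>pi + 1\<close>, the largest
  distance at which the kernel below is evaluated.\<close>

lemma norm_one_minus_cis_ge:
  "\<exists>c>0. \<forall>\<theta>. \<bar>\<theta>\<bar> \<le> 5 \<longrightarrow> c * \<bar>\<theta>\<bar> \<le> norm (1 - cis \<theta>)"
proof -
  have cos1: "1/2 \<le> cos (1::real)" "cos (1::real) < 1"
  proof -
    have "cos (pi / 3) \<le> cos 1" using pi_gt3 by (intro cos_monotone_0_pi_le) auto
    thus "1/2 \<le> cos (1::real)" by (simp add: cos_60)
    have "cos 1 < cos (0::real)" using pi_gt3 by (intro cos_monotone_0_pi) auto
    thus "cos (1::real) < 1" by simp
  qed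
  define c where "c = min (1/2) ((1 - cos 1) / (5::real))"
  have c: "0 < c" "c \<le> 1/2" "5 * c \<le> 1 - cos 1" using cos1 by (auto simp: c_def)
  have pos: "c * \<theta> \<le> norm (1 - cis \<theta>)" if \<theta>: "0 < \<theta>" "\<theta> \<le> 5" for \<theta>
  proof (cases "\<theta> \<le> 1")
    case True
    obtain z where z: "0 < z" "z < \<theta>" "sin \<theta> - sin 0 = (\<theta> - 0) * cos z"
      using MVT2[OF \<theta>(1), of sin cos] DERIV_sin by blast
    have "cos 1 \<le> cos z" using z True pi_gt3 by (intro cos_monotone_0_pi_le) auto
    hence "c \<le> cos z" using cos1 c by linarith
    hence "c * \<theta> \<le> sin \<theta>" using z \<theta> by (simp add: mult.commute mult_left_mono)
    also have "\<dots> \<le> \<bar>Im (1 - cis \<theta>)\<bar>" by simp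
    also have "\<dots> \<le> norm (1 - cis \<theta>)" by (rule abs_Im_le_cmod)
    finally show ?thesis .
  next
    case False
    have "cos \<theta> \<le> cos 1"
    proof (cases "\<theta> \<le> pi")
      case True
      thus ?thesis using False by (intro cos_monotone_0_pi_le) auto
    next
      case F: False
      have "cos (2 * pi - \<theta>) \<le> cos 1" using F \<theta> pi_gt3 by (intro cos_monotone_0_pi_le) auto
      thus ?thesis by (simp add: cos_diff)
    qed
    have "c * \<theta> \<le> c * 5" using \<theta> c by (intro mult_left_mono) auto
    also have "\<dots> \<le> Re (1 - cis \<theta>)" using c \<open>cos \<theta> \<le> cos 1\<close> by simp
    also have "\<dots> \<le> norm (1 - cis \<theta>)" by (rule complex_Re_le_cmod)
    finally show ?thesis .
  qed
  show ?thesis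
  proof (intro exI[of _ c] conjI allI impI c(1))
    fix \<theta> :: real assume \<theta>: "\<bar>\<theta>\<bar> \<le> 5"
    have sym: "norm (1 - cis (- \<theta>)) = norm (1 - cis \<theta>)"
      by (metis cis_cnj complex_cnj_diff complex_cnj_one complex_mod_cnj)
    consider "\<theta> = 0" | "\<theta> > 0" | "\<theta> < 0" by linarith
    thus "c * \<bar>\<theta>\<bar> \<le> norm (1 - cis \<theta>)"
      using pos[of \<theta>] pos[of "- \<theta>"] \<theta> sym by cases auto
  qed
qed

text \<open>A normalised one-sided Dirichlet kernel: the mean of \<open>cis (y - t) ^ k\<close> over
  \<open>k < n\<close>. It is at most 1 in modulus, and the formula for geometric sums bounds it by
  a multiple of \<open>1 / (n * \<bar>y - t\<bar>)\<close>. Powers of it decay to any prescribed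
  order.\<close>

lemma localizing_kernel:
  "\<exists>c>0. \<forall>n\<ge>1. \<forall>t. \<exists>D. trig_entire n D \<and> D (of_real t) = 1 \<and>
     (\<forall>y::real. \<bar>y - t\<bar> \<le> 5 \<longrightarrow> (1 + real n * \<bar>y - t\<bar>) * norm (D (of_real y)) \<le> c)"
proof -
  obtain c0 where c0: "c0 > 0" "\<And>\<theta>. \<bar>\<theta>\<bar> \<le> 5 \<Longrightarrow> c0 * \<bar>\<theta>\<bar> \<le> norm (1 - cis \<theta>)"
    using norm_one_minus_cis_ge by blast
  show ?thesis
  proof (intro exI[of _ "1 + 2 / c0"] conjI allI impI)
    show "0 < 1 + 2 / c0" using c0 by (simp add: add_pos_pos)
    fix n :: nat and t :: real assume n: "1 \<le> n"
    define D where "D z = (\<Sum>k<n. cis (- (real k * t)) / of_nat n * exp (\<i> * of_int (int k) * z))" for z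
    have D: "trig_entire n D" unfolding D_def by (intro trig_entire_sum trig_entire_exp) auto
    have Dreal: "D (of_real y) = (\<Sum>k<n. cis (y - t) ^ k) / of_nat n" for y
    proof -
      have "cis (- (real k * t)) / of_nat n * exp (\<i> * of_int (int k) * of_real y) = cis (y - t) ^ k / of_nat n" for k
      proof -
        have "exp (\<i> * of_int (int k) * of_real y) = cis (real k * y)" by (simp add: cis_conv_exp mult_ac)
        moreover have "cis (- (real k * t)) * cis (real k * y) = cis (y - t) ^ k"
          unfolding Complex.DeMoivre cis_mult by (rule arg_cong[of _ _ cis]) (simp add: algebra_simps)
        ultimately show ?thesis by simp
      qed
      thus ?thesis unfolding D_def sum_divide_distrib by (intro sum.cong refl)
    qed
    have bound: "(1 + real n * \<bar>y - t\<bar>) * norm (D (of_real y)) \<le> 1 + 2 / c0" if y: "\<bar>y - t\<bar> \<le> 5" for y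
    proof -
      define w where "w = cis (y - t)"
      have w: "norm w = 1" by (simp add: w_def)
      have "norm (\<Sum>k<n. w ^ k) \<le> (\<Sum>k<n. norm (w ^ k))" by (rule norm_sum)
      also have "\<dots> = real n" by (simp add: norm_power w)
      finally have 1: "norm (D (of_real y)) \<le> 1" using n by (simp add: Dreal w_def norm_divide)
      have "(1 - w) * (\<Sum>k<n. w ^ k) = 1 - w ^ n" by (rule one_diff_power_eq[symmetric])
      hence "norm (1 - w) * norm (\<Sum>k<n. w ^ k) = norm (1 - w ^ n)" by (metis norm_mult)
      also have "\<dots> \<le> 2" using norm_triangle_ineq4[of 1 "w ^ n"] by (simp add: norm_power w)
      finally have "norm (1 - w) * norm (\<Sum>k<n. w ^ k) \<le> 2" .
      moreover have "c0 * \<bar>y - t\<bar> * norm (\<Sum>k<n. w ^ k) \<le> norm (1 - w) * norm (\<Sum>k<n. w ^ k)"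
        using c0(2)[OF y] by (intro mult_right_mono) (auto simp: w_def)
      ultimately have "\<bar>y - t\<bar> * norm (\<Sum>k<n. w ^ k) \<le> 2 / c0"
        using c0(1) by (simp add: field_simps)
      moreover have "real n * norm (D (of_real y)) = norm (\<Sum>k<n. w ^ k)"
        using n by (simp add: Dreal w_def norm_divide)
      moreover have "real n * \<bar>y - t\<bar> * norm (D (of_real y)) = \<bar>y - t\<bar> * (real n * norm (D (of_real y)))"
        by simp
      ultimately have 2: "real n * \<bar>y - t\<bar> * norm (D (of_real y)) \<le> 2 / c0" by (simp only:)
      show ?thesis using 1 2 by (simp add: algebra_simps)
    qed
    show "\<exists>D. trig_entire n D \<and> D (of_real t) = 1 \<and>
     (\<forall>y::real. \<bar>y - t\<bar> \<le> 5 \<longrightarrow> (1 + real n * \<bar>y - t\<bar>) * norm (D (of_real y)) \<le> 1 + 2 / c0)"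
      using D bound n by (intro exI[of _ D]) (simp add: Dreal)
  qed
qed

text \<open>The half-maximum property is applied to \<open>f * D ^ m\<close>, of degree
  \<open>(m + 1) * n\<close>, whence \<open>\<delta> = \<epsilon> / (m + 1)\<close>. It bounds the
  value at \<open>t\<close>, where \<open>D = 1\<close>, and the decay of \<open>D\<close> at
  \<open>y\<close> becomes the factor on the left. The point found is moved by a multiple of
  \<open>2 * pi\<close> to lie within \<open>pi\<close> of \<open>t\<close>.\<close>

lemma localized_half_maximum:
  fixes W :: "real \<Rightarrow> real" and m :: nat
  assumes per: "\<And>t. W (t + 2 * pi) = W t" and W0: "\<And>t. 0 \<le> W t" and \<epsilon>: "\<epsilon> > 0" "\<epsilon> \<le> 1"
    and hm: "\<And>n f. n \<ge> 1 \<Longrightarrow> trig_entire n f \<Longrightarrow> \<exists>x0. \<forall>t y. \<bar>y - x0\<bar> \<le> \<epsilon> / real n \<longrightarrow>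
        norm (f (of_real t)) * W t \<le> 2 * (norm (f (of_real y)) * W y)"
  shows "\<exists>\<delta>>0. \<delta> \<le> 1 \<and> (\<exists>c>0. \<forall>n\<ge>1. \<forall>f t. trig_entire n f \<longrightarrow> (\<exists>x. \<bar>x - t\<bar> \<le> pi \<and>
     (\<forall>y. \<bar>y - x\<bar> \<le> \<delta> / real n \<longrightarrow>
       norm (f (of_real t)) * W t * (1 + real n * \<bar>y - t\<bar>) ^ m \<le> c * (norm (f (of_real y)) * W y))))"
proof -
  obtain c where c: "c > 0" "\<And>n t. n \<ge> 1 \<Longrightarrow> \<exists>D. trig_entire n D \<and> D (of_real t) = 1 \<and>
     (\<forall>y::real. \<bar>y - t\<bar> \<le> 5 \<longrightarrow> (1 + real n * \<bar>y - t\<bar>) * norm (D (of_real y)) \<le> c)"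
    using localizing_kernel by blast
  define \<delta> where "\<delta> = \<epsilon> / real (m + 1)"
  have \<delta>: "0 < \<delta>" "\<delta> \<le> 1" using \<epsilon> by (auto simp: \<delta>_def divide_le_eq)
  have main: "\<exists>x. \<bar>x - t\<bar> \<le> pi \<and> (\<forall>y. \<bar>y - x\<bar> \<le> \<delta> / real n \<longrightarrow>
       norm (f (of_real t)) * W t * (1 + real n * \<bar>y - t\<bar>) ^ m \<le> 2 * c ^ m * (norm (f (of_real y)) * W y))"
    if n: "n \<ge> 1" and f: "trig_entire n f" for n f t
  proof -
    obtain D where D: "trig_entire n D" "D (of_real t) = 1"
      "\<And>y::real. \<bar>y - t\<bar> \<le> 5 \<Longrightarrow> (1 + real n * \<bar>y - t\<bar>) * norm (D (of_real y)) \<le> c"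
      using c(2)[OF n] by blast
    define F where "F z = f z * D z ^ m" for z
    have F: "trig_entire (n + m * n) F" unfolding F_def
      by (intro trig_entire_mult f trig_entire_power D)
    obtain x0 where x0: "\<And>s y. \<bar>y - x0\<bar> \<le> \<epsilon> / real (n + m * n) \<Longrightarrow>
        norm (F (of_real s)) * W s \<le> 2 * (norm (F (of_real y)) * W y)"
      using hm[OF _ F] n by auto
    obtain k :: int where k: "\<bar>x0 + 2 * pi * of_int k - t\<bar> \<le> pi" by (rule reduce_2pi)
    define x where "x = x0 + 2 * pi * of_int k"
    have "\<epsilon> / real (n + m * n) = \<delta> / real n" using n by (simp add: \<delta>_def field_simps)
    note x0 = x0[unfolded this]
    show ?thesis
    proof (intro exI[of _ x] conjI allI impI)
      show "\<bar>x - t\<bar> \<le> pi" using k by (simp add: x_def)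
      fix y assume y: "\<bar>y - x\<bar> \<le> \<delta> / real n"
      define y' where "y' = y + 2 * pi * of_int (- k)"
      have y': "\<bar>y' - x0\<bar> \<le> \<delta> / real n" using y by (simp add: y'_def x_def algebra_simps)
      have "norm (F (of_real t)) * W t \<le> 2 * (norm (F (of_real y')) * W y')" by (rule x0[OF y'])
      also have "norm (F (of_real y')) * W y' = norm (F (of_real y)) * W y"
        unfolding y'_def by (rule periodic_int) (simp only: per trig_entire_periodic[OF F])
      finally have 1: "norm (f (of_real t)) * W t \<le> 2 * (norm (f (of_real y)) * norm (D (of_real y)) ^ m * W y)"
        by (simp add: F_def D norm_mult norm_power)
      have "\<delta> / real n \<le> 1" using \<delta> n by (simp add: divide_le_eq)
      hence y5: "\<bar>y - t\<bar> \<le> 5" using y k pi_less_4 unfolding x_def by linarith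
      have q0: "0 \<le> 1 + real n * \<bar>y - t\<bar>" by simp
      have "norm (f (of_real t)) * W t * (1 + real n * \<bar>y - t\<bar>) ^ m
        \<le> 2 * (norm (f (of_real y)) * norm (D (of_real y)) ^ m * W y) * (1 + real n * \<bar>y - t\<bar>) ^ m"
        using 1 by (intro mult_right_mono) auto
      also have "\<dots> = 2 * ((1 + real n * \<bar>y - t\<bar>) * norm (D (of_real y))) ^ m * (norm (f (of_real y)) * W y)"
        by (simp add: power_mult_distrib)
      also have "\<dots> \<le> 2 * c ^ m * (norm (f (of_real y)) * W y)"
        using D(3)[OF y5] W0[of y] by (intro mult_right_mono mult_left_mono power_mono) auto
      finally show "norm (f (of_real t)) * W t * (1 + real n * \<bar>y - t\<bar>) ^ m \<le> 2 * c ^ m * (norm (f (of_real y)) * W y)" .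
    qed
  qed
  show ?thesis
    by (intro exI[of _ \<delta>] conjI \<delta> exI[of _ "2 * c ^ m"] allI impI main) (use c in auto)
qed

lemma Omega_product_localized:
  assumes "finite I" "I \<noteq> {}" and "\<And>i. i \<in> I \<Longrightarrow> ws i \<in> Omega_class" and "r > 0"
  shows "\<exists>\<delta>>0. \<delta> \<le> 1 \<and> (\<exists>c>0. \<forall>n\<ge>1. \<forall>f t. trig_entire n f \<longrightarrow> (\<exists>x. \<bar>x - t\<bar> \<le> pi \<and>
     (\<forall>y. \<bar>y - x\<bar> \<le> \<delta> / real n \<longrightarrow>
       norm (f (of_real t)) * (\<Prod>i\<in>I. ws i t) powr r * (1 + real n * \<bar>y - t\<bar>) ^ m
         \<le> c * (norm (f (of_real y)) * (\<Prod>i\<in>I. ws i y) powr r))))"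
proof -
  obtain \<epsilon> where \<epsilon>: "\<epsilon> > 0" "\<epsilon> \<le> 1" "\<forall>n\<ge>1. \<forall>f. trig_entire n f \<longrightarrow> (\<exists>x0. \<forall>t y. \<bar>y - x0\<bar> \<le> \<epsilon> / real n \<longrightarrow>
     norm (f (of_real t)) * (\<Prod>i\<in>I. ws i t) powr r \<le> 2 * (norm (f (of_real y)) * (\<Prod>i\<in>I. ws i y) powr r))"
    using Omega_product_half_maximum[of I ws r] assms by auto
  have per: "(\<Prod>i\<in>I. ws i (t + 2 * pi)) powr r = (\<Prod>i\<in>I. ws i t) powr r" for t
    using Omega_product_props(4)[of I ws] assms by simp
  show ?thesis
    by (rule localized_half_maximum[where W = "\<lambda>t. (\<Prod>i\<in>I. ws i t) powr r", OF per _ \<epsilon>(1,2)]) (use \<epsilon>(3) in auto)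
qed

section \<open>Weights of the classes A-infinity and A-star\<close>

definition mass :: "(real \<Rightarrow> real) \<Rightarrow> real \<Rightarrow> real \<Rightarrow> real" where
  "mass u a b = (LINT x:{a..b}|lebesgue. u x)"

lemma integral_lebesgue_on:
  fixes u :: "real \<Rightarrow> real"
  assumes "E \<in> sets lebesgue"
  shows "integral\<^sup>L (lebesgue_on E) u = (LINT x:E|lebesgue. u x)"
  using assms by (simp add: integral_restrict_space set_lebesgue_integral_def)

text \<open>Three periods are taken because the intervals that occur are centred within
  \<open>pi\<close> of some \<open>t\<close> in \<open>{-pi..pi}\<close> and may reach beyond
  \<open>2 * pi\<close> by up to 1. The factor 3 reappears in the final constants.\<close>

lemma periodic_integrable:
  fixes f :: "real \<Rightarrow> real"
  assumes int: "integrable (lebesgue_on {-pi..pi}) f" and per: "\<And>t. f (t + 2 * pi) = f t"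
    and nn: "\<And>t. 0 \<le> f t"
  shows "set_integrable lebesgue {-3*pi..3*pi} f"
    and "(LINT x:{-3*pi..3*pi}|lebesgue. f x) = 3 * integral\<^sup>L (lebesgue_on {-pi..pi}) f"
proof -
  define B where "B = integral\<^sup>L (lebesgue_on {-pi..pi}) f"
  have 0: "(f has_integral B) {-pi..pi}"
    using int unfolding B_def by (intro has_integral_integral_lebesgue_on) auto
  have "((\<lambda>x. f (x + 2 * pi)) has_integral B) {-pi - 2 * pi..pi - 2 * pi}"
    by (rule has_integral_shift_real_ivl[OF 0])
  hence 1: "(f has_integral B) {-3*pi..-pi}" by (simp add: per)
  have "((\<lambda>x. f (x + - (2 * pi))) has_integral B) {-pi - - (2 * pi)..pi - - (2 * pi)}"
    by (rule has_integral_shift_real_ivl[OF 0])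
  moreover have "f (x + - (2 * pi)) = f x" for x using per[of "x - 2 * pi"] by simp
  ultimately have 2: "(f has_integral B) {pi..3*pi}" by simp
  have "(f has_integral B + B) {-3*pi..pi}"
    by (rule has_integral_combine[OF _ _ 1 0]) auto
  hence "(f has_integral (B + B) + B) {-3*pi..3*pi}"
    by (rule has_integral_combine[OF _ _ _ 2, rotated 2]) auto
  hence 3: "f integrable_on {-3*pi..3*pi}" "integral {-3*pi..3*pi} f = 3 * B"
    by (auto simp: integrable_on_def integral_unique)
  show ai: "set_integrable lebesgue {-3*pi..3*pi} f"
    by (rule nonnegative_absolutely_integrable_1[OF 3(1) nn])
  show "(LINT x:{-3*pi..3*pi}|lebesgue. f x) = 3 * integral\<^sup>L (lebesgue_on {-pi..pi}) f"
    using set_lebesgue_integral_eq_integral(2)[OF ai] 3(2) by (simp add: B_def)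
qed

lemma set_integral_mono_sets:
  fixes f g :: "real \<Rightarrow> real"
  assumes "set_integrable M B g" "A \<subseteq> B" "\<And>x. x \<in> A \<Longrightarrow> f x \<le> g x" "\<And>x. x \<in> B \<Longrightarrow> 0 \<le> g x"
  shows "(LINT x:A|M. f x) \<le> (LINT x:B|M. g x)"
  unfolding set_lebesgue_integral_def
  using assms by (intro integral_mono') (auto simp: set_integrable_def indicator_def)

lemma weight_integrable:
  assumes "weight u"
  shows "set_integrable lebesgue {-3*pi..3*pi} u" "\<And>t. u (t + 2 * pi) = u t" "\<And>t. 0 \<le> u t"
  using assms periodic_integrable(1)[of u] unfolding weight_def periodic_2pi_def by auto

lemma weight_integrable_sub:
  assumes "weight u" "E \<in> sets lebesgue" "E \<subseteq> {-3*pi..3*pi}"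
  shows "set_integrable lebesgue E u"
  using set_integrable_subset[OF weight_integrable(1)[OF assms(1)] assms(2,3)] .

lemma weight_superlevel_measurable:
  assumes "weight u" "{a..b} \<subseteq> {-3*pi..3*pi}"
  shows "{y \<in> {a..b}. c \<le> u y * d} \<in> sets lebesgue"
proof -
  have "set_integrable lebesgue {a..b} u" using weight_integrable_sub[OF assms(1) _ assms(2)] by auto
  hence meas: "(\<lambda>x. indicator {a..b} x *\<^sub>R u x) \<in> borel_measurable lebesgue"
    unfolding set_integrable_def by auto
  have "{a..b} \<inter> {y \<in> space lebesgue. c \<le> (indicator {a..b} y *\<^sub>R u y) * d} \<in> sets lebesgue"
    by (intro sets.Int borel_measurable_le borel_measurable_times meas borel_measurable_const) auto
  also have "{a..b} \<inter> {y \<in> space lebesgue. c \<le> (indicator {a..b} y *\<^sub>R u y) * d} = {y \<in> {a..b}. c \<le> u y * d}"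
    by auto
  finally show ?thesis .
qed

lemma mass_nonneg: "weight u \<Longrightarrow> 0 \<le> mass u a b"
  using weight_integrable(3)[of u] unfolding mass_def set_lebesgue_integral_def
  by (intro Bochner_Integration.integral_nonneg) (auto simp: indicator_def)

lemma mass_mono:
  assumes "weight u" "-3*pi \<le> c" "c \<le> a" "b \<le> d" "d \<le> 3*pi"
  shows "mass u a b \<le> mass u c d"
  unfolding mass_def
  by (rule set_integral_mono_sets) (use assms weight_integrable_sub[of u "{c..d}"] weight_integrable(3) in auto)

text \<open>Each step enlarges the inner interval by the factor \<open>1 / \<alpha>\<close> inside
  \<open>{c..d}\<close> at the cost of \<open>M\<close>. For the ratio \<rho> of the lengths about
  ln \<rho> / ln (1 / \<alpha>) steps suffice, and an \<open>m\<close> with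
  \<open>M < (1 / \<alpha>) ^ m\<close> turns their total cost into \<open>M * \<rho> ^ m\<close>.
  The ratio \<alpha> may be close to 1, as can happen for \<open>A_star\<close>.\<close>

lemma doubling_growth:
  fixes U :: "real \<Rightarrow> real \<Rightarrow> real"
  assumes \<alpha>: "0 < \<alpha>" "\<alpha> < 1" and M: "1 \<le> M" and U0: "\<And>a b. 0 \<le> U a b"
    and step: "\<And>a b c d. lo \<le> c \<Longrightarrow> c \<le> a \<Longrightarrow> a < b \<Longrightarrow> b \<le> d \<Longrightarrow> d \<le> hi \<Longrightarrow> d - c \<le> lm \<Longrightarrow>
        \<alpha> * (d - c) \<le> b - a \<Longrightarrow> U c d \<le> M * U a b"
  shows "\<exists>m K. 0 < K \<and> (\<forall>a b c d. lo \<le> c \<longrightarrow> c \<le> a \<longrightarrow> a < b \<longrightarrow> b \<le> d \<longrightarrow> d \<le> hi \<longrightarrow> d - c \<le> lm \<longrightarrow>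
     U c d \<le> K * ((d - c) / (b - a)) ^ m * U a b)"
proof -
  have iter: "U c d \<le> M ^ k * U a b"
    if "lo \<le> c" "c \<le> a" "a < b" "b \<le> d" "d \<le> hi" "d - c \<le> lm" "\<alpha> ^ k * (d - c) \<le> b - a" for a b c d k
    using that
  proof (induction k arbitrary: a b)
    case 0
    hence "a = c" "b = d" by auto
    thus ?case by simp
  next
    case (Suc k)
    show ?case
    proof (cases "\<alpha> * (d - c) \<le> b - a")
      case True
      have "U c d \<le> M * U a b" using Suc.prems True by (intro step) auto
      also have "\<dots> \<le> M ^ Suc k * U a b"
        using M U0 by (intro mult_right_mono) (auto simp: mult_le_cancel_left1 one_le_power)
      finally show ?thesis .
    next
      case False
      define r where "r = (b - a) / \<alpha>"
      have r: "r < d - c" "\<alpha> * r = b - a"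
        using False \<alpha> Suc.prems by (auto simp: r_def field_simps)
      have "0 < r" using \<alpha> Suc.prems by (simp add: r_def)
      hence "\<alpha> * r \<le> 1 * r" using \<alpha> by (intro mult_right_mono) auto
      hence r1: "b - a \<le> r" using r by simp
      \<comment> \<open>The interval of length \<open>r\<close> ending at \<open>b\<close>, pushed
        to the right if it would begin before \<open>c\<close>; it contains \<open>{a..b}\<close>
        and stays inside \<open>{c..d}\<close>.\<close>
      define a' where "a' = max c (b - r)"
      have a': "c \<le> a'" "a' \<le> a" "b \<le> a' + r" "a' + r \<le> d"
        using r r1 Suc.prems by (auto simp: a'_def)
      have "\<alpha> * (\<alpha> ^ k * (d - c)) \<le> \<alpha> * r" using Suc.prems r by (simp add: mult_ac)
      hence "\<alpha> ^ k * (d - c) \<le> r" using \<alpha> by simp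
      hence "U c d \<le> M ^ k * U a' (a' + r)"
        using a' Suc.prems by (intro Suc.IH) auto
      also have "\<dots> \<le> M ^ k * (M * U a b)"
        using a' r Suc.prems M by (intro mult_left_mono step) auto
      finally show ?thesis by (simp add: mult_ac)
    qed
  qed
  obtain m where m: "M < (1 / \<alpha>) ^ m" using real_arch_pow[of "1 / \<alpha>" M] \<alpha> by auto
  have "U c d \<le> M * ((d - c) / (b - a)) ^ m * U a b"
    if ab: "lo \<le> c" "c \<le> a" "a < b" "b \<le> d" "d \<le> hi" "d - c \<le> lm" for a b c d
  proof -
    define \<rho> where "\<rho> = (d - c) / (b - a)"
    have \<rho>: "1 \<le> \<rho>" using ab by (simp add: \<rho>_def)
    have ex: "\<exists>k. \<alpha> ^ k * (d - c) \<le> b - a"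
    proof -
      obtain k where "\<alpha> ^ k < (b - a) / (d - c)" using real_arch_pow_inv[of "(b - a) / (d - c)" \<alpha>] ab \<alpha> by auto
      thus ?thesis using ab by (intro exI[of _ k]) (simp add: field_simps)
    qed
    define k where "k = (LEAST k. \<alpha> ^ k * (d - c) \<le> b - a)"
    have k: "\<alpha> ^ k * (d - c) \<le> b - a" unfolding k_def by (rule LeastI_ex[OF ex])
    have "M ^ k \<le> M * \<rho> ^ m"
    proof (cases k)
      case 0
      have "1 * 1 \<le> M * \<rho> ^ m" using M \<rho> by (intro mult_mono one_le_power) auto
      thus ?thesis using 0 by simp
    next
      case (Suc j)
      have "\<not> \<alpha> ^ j * (d - c) \<le> b - a" using not_less_Least[of j "\<lambda>k. \<alpha> ^ k * (d - c) \<le> b - a"] Suc unfolding k_def by auto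
      hence "(1 / \<alpha>) ^ j \<le> \<rho>" using \<alpha> ab by (simp add: \<rho>_def power_one_over field_simps)
      hence "((1 / \<alpha>) ^ j) ^ m \<le> \<rho> ^ m" using \<alpha> by (intro power_mono) auto
      moreover have "M ^ j \<le> ((1 / \<alpha>) ^ m) ^ j" using m M by (intro power_mono) auto
      ultimately have "M ^ j \<le> \<rho> ^ m" by (simp add: power_mult [symmetric] mult.commute)
      thus ?thesis using M Suc by (simp add: mult_left_mono)
    qed
    hence "M ^ k * U a b \<le> M * \<rho> ^ m * U a b" using U0 by (rule mult_right_mono)
    thus ?thesis using iter[OF ab k] by (simp add: \<rho>_def)
  qed
  thus ?thesis using M by (intro exI[of _ m] exI[of _ M]) auto
qed

text \<open>The common ground of \<open>A_infty\<close> and \<open>A_star\<close>: polynomial growth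
  of masses, and a lower bound by the mean on a fixed proportion of each interval. The length limit
  \<open>lm\<close> is \<open>2 * pi\<close> for \<open>A_star\<close>, whose intervals lie in one
  period, and \<open>6 * pi\<close>, no restriction inside \<open>{-3*pi..3*pi}\<close>, for
  \<open>A_infty\<close>.\<close>

definition regular_weight :: "real \<Rightarrow> (real \<Rightarrow> real) \<Rightarrow> nat \<Rightarrow> real \<Rightarrow> real \<Rightarrow> real \<Rightarrow> bool" where
  "regular_weight lm u m K \<delta> \<kappa> \<longleftrightarrow> weight u \<and> 0 < K \<and> 0 < \<delta> \<and> 0 < \<kappa> \<and>
     (\<forall>a b c d. -3*pi \<le> c \<longrightarrow> c \<le> a \<longrightarrow> a < b \<longrightarrow> b \<le> d \<longrightarrow> d \<le> 3*pi \<longrightarrow> d - c \<le> lm \<longrightarrow>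
        mass u c d \<le> K * ((d - c) / (b - a)) ^ m * mass u a b) \<and>
     (\<forall>a b. -3*pi \<le> a \<longrightarrow> a < b \<longrightarrow> b \<le> 3*pi \<longrightarrow> b - a \<le> lm \<longrightarrow>
        \<kappa> * (b - a) \<le> measure lebesgue {y \<in> {a..b}. \<delta> * mass u a b \<le> u y * (b - a)})"

lemma measure_sub_interval:
  assumes "E \<subseteq> {a..b::real}" "E \<in> sets lebesgue"
  shows "E \<in> lmeasurable" "measure lebesgue E \<le> max 0 (b - a)"
proof -
  show E: "E \<in> lmeasurable"
    by (rule bounded_set_imp_lmeasurable[OF bounded_subset[of "{a..b}"]]) (use assms in auto)
  have "measure lebesgue E \<le> measure lebesgue {a..b}" using assms by (intro measure_mono_fmeasurable) auto
  thus "measure lebesgue E \<le> max 0 (b - a)" by (auto simp: measure_lborel_Icc split: if_splits)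
qed

lemma divide_mult_cancel_real: "y \<noteq> 0 \<Longrightarrow> x / y * y = (x::real)"
  by simp

lemma measure_interval_diff:
  assumes "E \<in> sets lebesgue" "E \<subseteq> {a..b::real}" "a < b"
  shows "measure lebesgue ({a..b} - E) = (b - a) - measure lebesgue E"
proof -
  have "measure lebesgue ({a..b} - E) = measure lebesgue {a..b} - measure lebesgue E"
    using assms by (intro measurable_measure_Diff) (simp_all add: lmeasurable_interval)
  thus ?thesis using assms by simp
qed

lemma set_integral_le_const:
  fixes u :: "real \<Rightarrow> real"
  assumes "E \<in> lmeasurable" "\<And>y. y \<in> E \<Longrightarrow> u y \<le> c" "0 \<le> c"
  shows "(LINT x:E|lebesgue. u x) \<le> c * measure lebesgue E"
proof -
  have "(LINT x:E|lebesgue. u x) \<le> (LINT x:E|lebesgue. c)"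
    by (rule set_integral_mono_sets)
      (use assms in \<open>auto simp: set_integrable_def fmeasurable_def intro!: integrable_mult_left\<close>)
  also have "\<dots> = c * measure lebesgue E" using assms by (subst set_integral_const) (auto simp: fmeasurable_def)
  finally show ?thesis .
qed

text \<open>Both properties come from the proportion 1/2. If the set where \<open>u\<close> is at
  least \<open>\<beta> / 2\<close> times its mean had less than half of the length, its complement
  would carry at least \<beta> times the mass by hypothesis, but at most half of that by
  construction; so the mass is 0 and the set is the whole interval, a contradiction.\<close>

lemma A_infty_regular:
  assumes u: "u \<in> A_infty"
  shows "\<exists>m K \<delta> \<kappa>. regular_weight (6*pi) u m K \<delta> \<kappa>"
proof -
  have w: "weight u" using u unfolding A_infty_def by blast
  obtain \<beta> where \<beta>: "\<beta> > 0" "\<forall>I E. is_interval I \<longrightarrow> bounded I \<longrightarrow> E \<in> sets lebesgue \<longrightarrow> E \<subseteq> I \<longrightarrow>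
        1 / 2 * measure lebesgue I \<le> measure lebesgue E \<longrightarrow>
        \<beta> * integral\<^sup>L (lebesgue_on I) u \<le> integral\<^sup>L (lebesgue_on E) u"
    using u unfolding A_infty_def by (auto dest!: spec[of _ "1/2::real"])
  have A: "\<beta> * mass u c d \<le> (LINT x:E|lebesgue. u x)"
    if "E \<in> sets lebesgue" "E \<subseteq> {c..d}" "c < d" "1 / 2 * (d - c) \<le> measure lebesgue E" for E c d
    using \<beta>(2)[rule_format, of "{c..d}" E] that
    by (auto simp: is_interval_cc integral_lebesgue_on mass_def)
  have "\<exists>m K. 0 < K \<and> (\<forall>a b c d. -3*pi \<le> c \<longrightarrow> c \<le> a \<longrightarrow> a < b \<longrightarrow> b \<le> d \<longrightarrow> d \<le> 3*pi \<longrightarrow> d - c \<le> 6*pi \<longrightarrow>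
     mass u c d \<le> K * ((d - c) / (b - a)) ^ m * mass u a b)"
  proof (rule doubling_growth[of "1/2" "max 1 (1 / \<beta>)"])
    fix a b c d :: real
    assume *: "-3*pi \<le> c" "c \<le> a" "a < b" "b \<le> d" "d \<le> 3*pi" "d - c \<le> 6*pi" "1 / 2 * (d - c) \<le> b - a"
    have "\<beta> * mass u c d \<le> mass u a b" using A[of "{a..b}" c d] * by (simp add: mass_def)
    hence "mass u c d \<le> (1 / \<beta>) * mass u a b" using \<beta>(1) by (simp add: field_simps)
    also have "\<dots> \<le> max 1 (1 / \<beta>) * mass u a b" using mass_nonneg[OF w] by (intro mult_right_mono) auto
    finally show "mass u c d \<le> max 1 (1 / \<beta>) * mass u a b" .
  qed (use mass_nonneg[OF w] in auto)
  then obtain m K where mK: "0 < K" "\<forall>a b c d. -3*pi \<le> c \<longrightarrow> c \<le> a \<longrightarrow> a < b \<longrightarrow> b \<le> d \<longrightarrow> d \<le> 3*pi \<longrightarrow> d - c \<le> 6*pi \<longrightarrow>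
     mass u c d \<le> K * ((d - c) / (b - a)) ^ m * mass u a b" by blast
  have lev: "1 / 2 * (b - a) \<le> measure lebesgue {y \<in> {a..b}. \<beta> / 2 * mass u a b \<le> u y * (b - a)}"
    if ab: "-3*pi \<le> a" "a < b" "b \<le> 3*pi" for a b
  proof (rule ccontr)
    define E where "E = {y \<in> {a..b}. \<beta> / 2 * mass u a b \<le> u y * (b - a)}"
    assume "\<not> ?thesis"
    hence neg: "measure lebesgue E < 1 / 2 * (b - a)" unfolding E_def[symmetric] by linarith
    have sub: "{a..b} \<subseteq> {-3*pi..3*pi}" using ab by auto
    have E: "E \<in> sets lebesgue" "E \<subseteq> {a..b}"
      unfolding E_def by (rule weight_superlevel_measurable[OF w sub]) blast
    define B where "B = {a..b} - E"
    have B: "B \<in> sets lebesgue" "B \<subseteq> {a..b}" using E by (auto simp: B_def)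
    have "measure lebesgue B = (b - a) - measure lebesgue E"
      unfolding B_def by (rule measure_interval_diff[OF E ab(2)])
    hence mB: "1 / 2 * (b - a) \<le> measure lebesgue B"
      using neg by (simp add: field_simps)
    have mB2: "measure lebesgue B \<le> b - a"
      using measure_sub_interval(2)[OF B(2,1)] ab by simp
    have le: "u y \<le> \<beta> / 2 * mass u a b / (b - a)" if "y \<in> B" for y
      using that ab unfolding B_def E_def by (auto simp: field_simps not_le)
    have "\<beta> * mass u a b \<le> (LINT x:B|lebesgue. u x)" using A[OF B ab(2) mB] .
    also have "\<dots> \<le> (\<beta> / 2 * mass u a b / (b - a)) * measure lebesgue B"
      using le measure_sub_interval(1)[OF B(2,1)] mass_nonneg[OF w] \<beta>(1) ab
      by (intro set_integral_le_const) auto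
    also have "\<dots> \<le> (\<beta> / 2 * mass u a b / (b - a)) * (b - a)"
      using mB2 mass_nonneg[OF w] \<beta>(1) ab by (intro mult_left_mono) auto
    also have "\<dots> = \<beta> / 2 * mass u a b" by (rule divide_mult_cancel_real) (use ab in simp)
    finally have "mass u a b = 0" using \<beta>(1) mass_nonneg[OF w, of a b] by (simp add: field_simps)
    hence "E = {a..b}" unfolding E_def using weight_integrable(3)[OF w] ab by auto
    thus False using neg ab by simp
  qed
  have "regular_weight (6*pi) u m K (\<beta> / 2) (1 / 2)"
    unfolding regular_weight_def
  proof (intro conjI w mK)
    show "0 < \<beta> / 2" "0 < (1 / 2 :: real)" using \<beta>(1) by simp_all
  qed (intro allI impI lev)
  thus ?thesis by blast
qed

text \<open>As \<open>u\<close> is at most \<open>L\<close> times its mean, a part of relative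
  length \<open>1 / (2 * L)\<close> carries at most half of the mass. This is the step of
  \<open>doubling_growth\<close> with \<open>\<alpha> = 1 - 1 / (2 * L)\<close>. The set where
  \<open>u\<close> is below half its mean also carries at most half of the mass, so if the mass is
  positive, the rest has relative length at least \<open>1 / (2 * L)\<close>.\<close>

lemma A_star_regular:
  assumes u: "u \<in> A_star"
  shows "\<exists>L m K \<delta> \<kappa>. 0 < L \<and> regular_weight (2*pi) u m K \<delta> \<kappa> \<and>
     (\<forall>a b t. -3*pi \<le> a \<longrightarrow> a < b \<longrightarrow> b \<le> 3*pi \<longrightarrow> b - a \<le> 2*pi \<longrightarrow> t \<in> {a..b} \<longrightarrow> u t \<le> L * mass u a b / (b - a))"
proof -
  have w: "weight u" using u unfolding A_star_def by blast
  obtain L0 where L0: "\<forall>c I. is_interval I \<longrightarrow> I \<subseteq> {c - pi..c + pi} \<longrightarrow> 0 < measure lebesgue I \<longrightarrow>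
        (\<forall>t\<in>I. u t \<le> L0 / measure lebesgue I * integral\<^sup>L (lebesgue_on I) u)"
    using u unfolding A_star_def by blast
  define L where "L = max L0 1"
  have L1: "1 \<le> L" by (simp add: L_def)
  have up: "u t \<le> L * mass u a b / (b - a)" if ab: "a < b" "b - a \<le> 2*pi" "t \<in> {a..b}" for a b t
  proof -
    \<comment> \<open>The interval sits in the period about its midpoint, so it may cross the points
      \<open>-pi\<close> and \<open>pi\<close>.\<close>
    have "{a..b} \<subseteq> {(a + b) / 2 - pi..(a + b) / 2 + pi}" using ab by (auto simp: field_simps)
    moreover have "0 < measure lebesgue {a..b}" using ab by simp
    ultimately have "u t \<le> L0 / measure lebesgue {a..b} * integral\<^sup>L (lebesgue_on {a..b}) u"
      using L0[rule_format, of "{a..b}" "(a + b) / 2" t] ab(3) is_interval_cc by blast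
    also have "\<dots> = L0 * (mass u a b / (b - a))" using ab by (simp add: integral_lebesgue_on mass_def)
    also have "\<dots> \<le> L * (mass u a b / (b - a))"
      using ab mass_nonneg[OF w] by (intro mult_right_mono) (auto simp: L_def)
    finally show ?thesis by simp
  qed
  have split: "mass u c d \<le> (LINT x:E|lebesgue. u x) + (L * mass u c d / (d - c)) * ((d - c) - measure lebesgue E)"
    if "E \<in> sets lebesgue" "E \<subseteq> {c..d}" "c < d" "-3*pi \<le> c" "d \<le> 3*pi" "d - c \<le> 2*pi" for E c d
  proof -
    define B where "B = {c..d} - E"
    have B: "B \<in> sets lebesgue" "B \<subseteq> {c..d}" using that by (auto simp: B_def)
    have mB: "measure lebesgue B = (d - c) - measure lebesgue E"
      unfolding B_def by (rule measure_interval_diff[OF that(1-3)])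
    have "mass u c d = (LINT x:E \<union> B|lebesgue. u x)" using that by (simp add: mass_def B_def Un_absorb1)
    also have "\<dots> = (LINT x:E|lebesgue. u x) + (LINT x:B|lebesgue. u x)"
      using that B by (intro set_integral_Un weight_integrable_sub[OF w]) (auto simp: B_def)
    also have "(LINT x:B|lebesgue. u x) \<le> (L * mass u c d / (d - c)) * measure lebesgue B"
      using up[OF that(3,6)] B measure_sub_interval(1)[OF B(2,1)] mass_nonneg[OF w] L1 that
      by (intro set_integral_le_const) auto
    finally show ?thesis by (simp add: mB)
  qed
  have "\<exists>m K. 0 < K \<and> (\<forall>a b c d. -3*pi \<le> c \<longrightarrow> c \<le> a \<longrightarrow> a < b \<longrightarrow> b \<le> d \<longrightarrow> d \<le> 3*pi \<longrightarrow> d - c \<le> 2*pi \<longrightarrow>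
     mass u c d \<le> K * ((d - c) / (b - a)) ^ m * mass u a b)"
  proof (rule doubling_growth[of "1 - 1 / (2 * L)" 2])
    show "0 < 1 - 1 / (2 * L)" "1 - 1 / (2 * L) < 1" using L1 by (auto simp: field_simps)
    fix a b c d :: real
    assume *: "-3*pi \<le> c" "c \<le> a" "a < b" "b \<le> d" "d \<le> 3*pi" "d - c \<le> 2*pi" "(1 - 1 / (2 * L)) * (d - c) \<le> b - a"
    have "mass u c d \<le> mass u a b + (L * mass u c d / (d - c)) * ((d - c) - (b - a))"
      using split[of "{a..b}" c d] * by (simp add: mass_def)
    also have "(L * mass u c d / (d - c)) * ((d - c) - (b - a)) \<le> (L * mass u c d / (d - c)) * ((d - c) / (2 * L))"
      using * mass_nonneg[OF w] L1 by (intro mult_left_mono) (auto simp: algebra_simps)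
    also have "\<dots> = mass u c d / 2" using * L1 by (simp add: field_simps)
    finally show "mass u c d \<le> 2 * mass u a b" by simp
  qed (use mass_nonneg[OF w] in auto)
  then obtain m K where mK: "0 < K" "\<forall>a b c d. -3*pi \<le> c \<longrightarrow> c \<le> a \<longrightarrow> a < b \<longrightarrow> b \<le> d \<longrightarrow> d \<le> 3*pi \<longrightarrow> d - c \<le> 2*pi \<longrightarrow>
     mass u c d \<le> K * ((d - c) / (b - a)) ^ m * mass u a b" by blast
  have lev: "1 / (2 * L) * (b - a) \<le> measure lebesgue {y \<in> {a..b}. 1 / 2 * mass u a b \<le> u y * (b - a)}"
    if ab: "-3*pi \<le> a" "a < b" "b \<le> 3*pi" "b - a \<le> 2*pi" for a b
  proof -
    define E where "E = {y \<in> {a..b}. 1 / 2 * mass u a b \<le> u y * (b - a)}"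
    have sub: "{a..b} \<subseteq> {-3*pi..3*pi}" using ab by auto
    have E: "E \<in> sets lebesgue" "E \<subseteq> {a..b}"
      unfolding E_def by (rule weight_superlevel_measurable[OF w sub]) blast
    show ?thesis
    proof (cases "mass u a b = 0")
      case True
      hence "E = {a..b}" unfolding E_def using weight_integrable(3)[OF w] ab by auto
      moreover have "1 / (2 * L) * (b - a) \<le> 1 * (b - a)" using L1 ab by (intro mult_right_mono) auto
      ultimately show ?thesis using ab unfolding E_def[symmetric] by simp
    next
      case False
      hence mpos: "0 < mass u a b" using mass_nonneg[OF w, of a b] by simp
      define B where "B = {a..b} - E"
      have B: "B \<in> sets lebesgue" "B \<subseteq> {a..b}" using E by (auto simp: B_def)
      have mB: "measure lebesgue B = (b - a) - measure lebesgue E"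
        unfolding B_def by (rule measure_interval_diff[OF E ab(2)])
      have le: "u y \<le> 1 / 2 * mass u a b / (b - a)" if "y \<in> B" for y
        using that ab unfolding B_def E_def by (auto simp: field_simps not_le)
      have "(LINT x:B|lebesgue. u x) \<le> (1 / 2 * mass u a b / (b - a)) * measure lebesgue B"
        using le measure_sub_interval(1)[OF B(2,1)] mpos ab by (intro set_integral_le_const) auto
      also have "\<dots> \<le> (1 / 2 * mass u a b / (b - a)) * (b - a)"
        using mB mpos ab by (intro mult_left_mono) auto
      also have "\<dots> = 1 / 2 * mass u a b" by (rule divide_mult_cancel_real) (use ab in simp)
      finally have "(LINT x:B|lebesgue. u x) \<le> mass u a b / 2" by simp
      moreover have "mass u a b \<le> (LINT x:B|lebesgue. u x) + (L * mass u a b / (b - a)) * measure lebesgue E"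
      proof -
        have "(b - a) - measure lebesgue B = measure lebesgue E" using mB by simp
        thus ?thesis using split[OF B ab(2,1,3,4)] by (simp only:)
      qed
      ultimately have "mass u a b / 2 \<le> (L * mass u a b / (b - a)) * measure lebesgue E" by linarith
      hence "mass u a b * ((b - a) / 2) \<le> mass u a b * (L * measure lebesgue E)" using ab by (simp add: field_simps)
      hence "(b - a) / 2 \<le> L * measure lebesgue E" using mpos by simp
      hence "1 / (2 * L) * (b - a) \<le> measure lebesgue E" using L1 by (simp add: field_simps)
      thus ?thesis by (simp add: E_def)
    qed
  qed
  have "regular_weight (2*pi) u m K (1/2) (1 / (2 * L))"
    unfolding regular_weight_def
  proof (intro conjI w mK)
    show "0 < (1 / 2 :: real)" "0 < 1 / (2 * L)" using L1 by simp_all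
  qed (intro allI impI lev)
  moreover have "0 < L" using L1 by simp
  ultimately show ?thesis using up by blast
qed

section \<open>The Nikolskii inequalities\<close>

lemma trig_poly_ex_entire:
  assumes "trig_poly n T"
  shows "\<exists>f. trig_entire n f \<and> (\<forall>t. T t = f (of_real t))"
proof -
  obtain c where c: "T = (\<lambda>t. \<Sum>k = - int n..int n. c k * cis (of_int k * t))"
    using assms unfolding trig_poly_def by blast
  have "T t = (\<Sum>k = - int n..int n. c k * exp (\<i> * of_int k * of_real t))" for t
    unfolding c by (simp add: cis_conv_exp mult.assoc)
  thus ?thesis
    by (intro exI[of _ "\<lambda>z. \<Sum>k = - int n..int n. c k * exp (\<i> * of_int k * z)"])
       (auto simp: trig_entire_def)
qed

text \<open>If \<open>i0\<close> is the index of the cell containing \<open>y\<close>, the cells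
  being continued over the whole line, then
  \<open>n * \<bar>y - t j\<bar> \<ge> \<bar>j - i0\<bar> - 1\<close>. So the sum is dominated by a
  two-sided sum of inverse squares, uniformly in \<open>n\<close>; this pays for adding up local
  estimates over all cells.\<close>

lemma inverse_square_sum_bound:
  "\<exists>K>0. \<forall>n\<ge>1. \<forall>y. \<forall>t :: nat \<Rightarrow> real.
     (\<forall>j<n. t j \<in> {-pi + 2 * pi * real j / real n..-pi + 2 * pi * real (j + 1) / real n}) \<longrightarrow>
     (\<Sum>j<n. 1 / (1 + real n * \<bar>y - t j\<bar>)\<^sup>2) \<le> K"
proof -
  \<comment> \<open>Without the maximum the term \<open>i = 0\<close> would be
    \<open>1 / 0 = 0\<close>, whereas it has to be at least 1.\<close>
  define \<psi> where "\<psi> i = 1 / (max 1 (real i))\<^sup>2" for i :: nat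
  have \<psi>0: "0 \<le> \<psi> i" for i by (simp add: \<psi>_def)
  have "summable (\<lambda>i. inverse (real i ^ 2))" by (rule inverse_power_summable) simp
  hence sm: "summable \<psi>"
  proof (rule summable_cong[THEN iffD2, rotated])
    show "eventually (\<lambda>i. \<psi> i = inverse (real i ^ 2)) sequentially"
      using eventually_ge_at_top[of 1] by eventually_elim (simp add: \<psi>_def inverse_eq_divide max_def)
  qed
  define K where "K = 1 + 2 * suminf \<psi>"
  have K: "K > 0" using suminf_nonneg[OF sm \<psi>0] by (simp add: K_def)
  have ints: "(\<Sum>k\<in>A. \<psi> (nat \<bar>k\<bar>)) \<le> 2 * suminf \<psi>" if A: "finite A" for A :: "int set"
  proof -
    have half: "(\<Sum>k\<in>B. \<psi> (nat \<bar>k\<bar>)) \<le> suminf \<psi>" if B: "finite B" "inj_on (\<lambda>k. nat \<bar>k\<bar>) B" for B :: "int set"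
    proof -
      have "(\<Sum>k\<in>B. \<psi> (nat \<bar>k\<bar>)) = sum \<psi> ((\<lambda>k. nat \<bar>k\<bar>) ` B)" using B by (simp add: sum.reindex)
      also have "\<dots> \<le> suminf \<psi>" using B \<psi>0 by (intro sum_le_suminf sm) auto
      finally show ?thesis .
    qed
    have "(\<Sum>k\<in>A. \<psi> (nat \<bar>k\<bar>)) = (\<Sum>k\<in>A \<inter> {0..}. \<psi> (nat \<bar>k\<bar>)) + (\<Sum>k\<in>A - {0..}. \<psi> (nat \<bar>k\<bar>))"
      using A by (rule sum.Int_Diff)
    also have "\<dots> \<le> suminf \<psi> + suminf \<psi>"
      using A by (intro add_mono half) (auto simp: inj_on_def)
    finally show ?thesis by simp
  qed
  show ?thesis
  proof (intro exI[of _ K] conjI allI impI K)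
    fix n :: nat and y :: real and t :: "nat \<Rightarrow> real"
    assume n: "1 \<le> n" and t: "\<forall>j<n. t j \<in> {-pi + 2 * pi * real j / real n..-pi + 2 * pi * real (j + 1) / real n}"
    define w where "w = real n * (y + pi) / (2 * pi)"
    define i0 where "i0 = \<lfloor>w\<rfloor>"
    have termle: "1 / (1 + real n * \<bar>y - t j\<bar>)\<^sup>2 \<le> \<psi> (nat \<bar>int j - i0\<bar>)" if j: "j < n" for j
    proof -
      define \<tau> where "\<tau> = real n * (t j + pi) / (2 * pi)"
      have "real j \<le> \<tau>" "\<tau> \<le> real j + 1"
        using t j n by (auto simp: \<tau>_def field_simps)
      moreover have "of_int i0 \<le> w" "w < of_int i0 + 1" unfolding i0_def by linarith+
      ultimately have "\<bar>real_of_int (int j - i0)\<bar> - 1 \<le> \<bar>w - \<tau>\<bar>" by simp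
      also have "\<dots> \<le> real n * \<bar>y - t j\<bar>"
      proof -
        have "w - \<tau> = real n * (y - t j) / (2 * pi)" by (simp add: w_def \<tau>_def field_simps)
        hence "\<bar>w - \<tau>\<bar> = (real n * \<bar>y - t j\<bar>) / (2 * pi)" by (simp add: abs_mult abs_divide)
        also have "\<dots> \<le> (real n * \<bar>y - t j\<bar>) / 1" using pi_gt3 by (intro divide_left_mono) auto
        finally show ?thesis by simp
      qed
      finally have "max 1 (real (nat \<bar>int j - i0\<bar>)) \<le> 1 + real n * \<bar>y - t j\<bar>" by simp
      hence "(max 1 (real (nat \<bar>int j - i0\<bar>)))\<^sup>2 \<le> (1 + real n * \<bar>y - t j\<bar>)\<^sup>2"
        by (intro power_mono) auto
      thus ?thesis unfolding \<psi>_def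
        by (intro divide_left_mono mult_pos_pos zero_less_power) (auto simp: add_pos_nonneg)
    qed
    have "(\<Sum>j<n. 1 / (1 + real n * \<bar>y - t j\<bar>)\<^sup>2) \<le> (\<Sum>j<n. \<psi> (nat \<bar>int j - i0\<bar>))"
      using termle by (intro sum_mono) auto
    also have "\<dots> = (\<Sum>k\<in>(\<lambda>j. int j - i0) ` {..<n}. \<psi> (nat \<bar>k\<bar>))"
      by (subst sum.reindex) (auto simp: inj_on_def)
    also have "\<dots> \<le> 2 * suminf \<psi>" by (intro ints) auto
    finally show "(\<Sum>j<n. 1 / (1 + real n * \<bar>y - t j\<bar>)\<^sup>2) \<le> K" by (simp add: K_def)
  qed
qed

lemma sum_powr_le:
  fixes a :: "'i \<Rightarrow> real"
  assumes "finite A" "\<And>i. i \<in> A \<Longrightarrow> 0 \<le> a i" "1 \<le> r"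
  shows "(\<Sum>i\<in>A. a i powr r) \<le> (\<Sum>i\<in>A. a i) powr r"
proof -
  define S where "S = (\<Sum>i\<in>A. a i)"
  have S: "0 \<le> S" unfolding S_def by (intro sum_nonneg assms)
  have pw: "x * x powr (r - 1) = x powr r" if "0 \<le> x" for x :: real
    using that powr_mult_base[of x "r - 1"] by simp
  have "(\<Sum>i\<in>A. a i powr r) \<le> (\<Sum>i\<in>A. a i * S powr (r - 1))"
  proof (rule sum_mono)
    fix i assume i: "i \<in> A"
    have "a i \<le> S" unfolding S_def using assms i by (intro member_le_sum) auto
    hence "a i * a i powr (r - 1) \<le> a i * S powr (r - 1)"
      using assms i by (intro mult_left_mono powr_mono2) auto
    thus "a i powr r \<le> a i * S powr (r - 1)" using pw assms(2)[OF i] by simp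
  qed
  also have "\<dots> = S * S powr (r - 1)" by (simp add: S_def sum_distrib_right)
  also have "\<dots> = S powr r" by (rule pw[OF S])
  finally show ?thesis by (simp add: S_def)
qed

lemma power_as_powr: "0 < X \<Longrightarrow> (X ^ k) powr s = X powr (real k * s)" for X :: real
  by (simp add: powr_powr powr_realpow[symmetric])

text \<open>The balance of exponents: the decay \<open>X ^ k\<close> of the polynomial, raised to
  \<open>p\<close>, has to outweigh the growth \<open>X ^ m\<close> of the masses, raised to
  \<open>p / q\<close>, and to leave \<open>X\<^sup>2\<close> for the summation over cells. This is
  the condition on \<open>k\<close>.\<close>

lemma combine_powers:
  fixes a v X F u c1 K2 p q :: real
  assumes a: "0 \<le> a" and v: "0 \<le> v" and X: "1 \<le> X" and F: "0 \<le> F" and u: "0 \<le> u" and pq: "0 < p" "0 < q"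
    and c: "0 < c1" "0 < K2" and aF: "a * X ^ k \<le> c1 * F" and vu: "v \<le> K2 * X ^ m * u"
    and k: "2 + real m * (p / q) \<le> p * real k"
  shows "a powr p * v powr (p / q) * X\<^sup>2 \<le> (c1 powr p * K2 powr (p / q)) * (F powr p * u powr (p / q))"
proof -
  have X0: "0 < X" using X by simp
  define Y where "Y = X powr (real m * (p / q))"
  have Y: "0 < Y" using X0 by (simp add: Y_def)
  have 1: "a powr p * X powr (p * real k) \<le> c1 powr p * F powr p"
  proof -
    have "(a * X ^ k) powr p \<le> (c1 * F) powr p" using aF a X0 pq by (intro powr_mono2) auto
    thus ?thesis using a F X0 c by (simp add: powr_mult power_as_powr mult.commute)
  qed
  have 2: "v powr (p / q) \<le> K2 powr (p / q) * Y * u powr (p / q)"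
  proof -
    have "v powr (p / q) \<le> (K2 * X ^ m * u) powr (p / q)" using vu v pq by (intro powr_mono2) auto
    thus ?thesis using u X0 c by (simp add: powr_mult power_as_powr Y_def)
  qed
  have "X\<^sup>2 * Y = X powr (2 + real m * (p / q))"
    using X0 by (simp add: Y_def powr_add)
  also have "\<dots> \<le> X powr (p * real k)" using X k by (intro powr_mono) auto
  finally have 3: "X\<^sup>2 * Y \<le> X powr (p * real k)" .
  have "(a powr p * v powr (p / q) * X\<^sup>2) * Y = (a powr p * v powr (p / q)) * (X\<^sup>2 * Y)" by (simp add: mult_ac)
  also have "\<dots> \<le> (a powr p * v powr (p / q)) * X powr (p * real k)"
    using 3 by (intro mult_left_mono) auto
  also have "\<dots> = (a powr p * X powr (p * real k)) * v powr (p / q)" by (simp add: mult_ac)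
  also have "\<dots> \<le> (c1 powr p * F powr p) * (K2 powr (p / q) * Y * u powr (p / q))"
    by (rule mult_mono[OF 1 2]) (use v in auto)
  also have "\<dots> = ((c1 powr p * K2 powr (p / q)) * (F powr p * u powr (p / q))) * Y" by (simp add: mult_ac)
  finally show ?thesis using Y by (rule mult_right_le_imp_le)
qed

lemma set_integrable_mult_bounded:
  fixes b k :: "real \<Rightarrow> real"
  assumes b: "set_integrable lebesgue A b" and k: "continuous_on UNIV k" and k01: "\<And>y. 0 \<le> k y" "\<And>y. k y \<le> 1"
  shows "set_integrable lebesgue A (\<lambda>y. b y * k y)"
  unfolding set_integrable_def
proof (rule Bochner_Integration.integrable_bound)
  show bi: "integrable lebesgue (\<lambda>x. indicator A x *\<^sub>R b x)" using b unfolding set_integrable_def .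
  have "k \<in> borel_measurable lebesgue"
    using borel_measurable_continuous_onI[OF k] measurable_completion measurable_lborel2 by blast
  hence "(\<lambda>x. (indicator A x *\<^sub>R b x) * k x) \<in> borel_measurable lebesgue"
    using borel_measurable_integrable[OF bi] by (rule borel_measurable_times[rotated])
  thus "(\<lambda>x. indicator A x *\<^sub>R (b x * k x)) \<in> borel_measurable lebesgue" by (simp add: mult.assoc)
  show "AE x in lebesgue. norm (indicator A x *\<^sub>R (b x * k x)) \<le> norm (indicator A x *\<^sub>R b x)"
    using k01 by (intro always_eventually allI) (auto simp: indicator_def abs_mult mult_left_le)
qed

lemma level_times_measure_le:
  fixes G :: "real \<Rightarrow> real"
  assumes E: "E \<in> sets lebesgue" "E \<subseteq> {a..b}" and G: "set_integrable lebesgue {a..b} G"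
    and le: "\<And>y. y \<in> E \<Longrightarrow> \<Phi> \<le> G y" and G0: "\<And>y. 0 \<le> G y"
  shows "\<Phi> * measure lebesgue E \<le> (LINT y:{a..b}|lebesgue. G y)"
proof -
  have "E \<in> lmeasurable" by (rule measure_sub_interval(1)[OF E(2,1)])
  hence "\<Phi> * measure lebesgue E = (LINT y:E|lebesgue. \<Phi>)"
    by (subst set_integral_const) (auto simp: fmeasurable_def)
  also have "\<dots> \<le> (LINT y:{a..b}|lebesgue. G y)"
    using E le G0 by (intro set_integral_mono_sets G) auto
  finally show ?thesis .
qed

lemma continuous_on_real_trig_entire:
  "trig_entire n f \<Longrightarrow> continuous_on S (\<lambda>t::real. f (of_real t))"
  by (intro continuous_on_compose2[OF trig_entire_continuous[of n f UNIV]] continuous_intros) auto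

text \<open>The Bochner integral of a non-integrable function is 0, so integrability is what gives
  the right-hand sides of the inequalities their meaning. The bound by \<open>V * (1 + u)\<close>
  holds with \<open>V = 1\<close> for the exponent \<open>p / q \<le> 1\<close>, and for bounded
  \<open>u\<close> with any positive exponent.\<close>

lemma integrand_integrable:
  assumes f: "trig_entire n f" and u: "weight u" and w: "continuous_on UNIV w" "\<And>t. 0 \<le> w t" "\<And>t. w t \<le> 1"
    and p: "0 < p" "0 < s" and V: "\<And>t. t \<in> {-pi..pi} \<Longrightarrow> u t powr s \<le> V * (1 + u t)" "0 \<le> V"
  shows "integrable (lebesgue_on {-pi..pi}) (\<lambda>t. norm (f (of_real t)) powr p * (w t * u t) powr s)"
proof -
  have ui: "integrable (lebesgue_on {-pi..pi}) u" using u unfolding weight_def by blast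
  have u0: "0 \<le> u t" for t using weight_integrable(3)[OF u] .
  have cf: "continuous_on {-pi..pi} (\<lambda>t. norm (f (of_real t)))"
    by (intro continuous_intros continuous_on_real_trig_entire[OF f])
  have "bounded ((\<lambda>t. norm (f (of_real t))) ` {-pi..pi})"
    by (intro compact_imp_bounded compact_continuous_image cf) auto
  then obtain M where "\<forall>t\<in>{-pi..pi}. norm (f (of_real t)) \<le> M"
    unfolding bounded_iff by auto
  hence M: "norm (f (of_real t)) \<le> M" if "t \<in> {-pi..pi}" for t using that by blast
  have 1: "integrable (lebesgue_on {-pi..pi}) (\<lambda>t. M powr p * V * (1 + u t))"
    by (intro integrable_mult_right Bochner_Integration.integrable_add ui)
       (auto intro!: finite_measure.integrable_const finite_measure_lebesgue_on)
  show ?thesis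
  proof (rule Bochner_Integration.integrable_bound[OF 1])
    have [measurable]: "(\<lambda>t. norm (f (of_real t))) \<in> borel_measurable (lebesgue_on {-pi..pi})"
      by (rule continuous_imp_measurable_on_sets_lebesgue[OF cf]) auto
    have [measurable]: "w \<in> borel_measurable (lebesgue_on {-pi..pi})"
      by (rule continuous_imp_measurable_on_sets_lebesgue[OF continuous_on_subset[OF w(1)]]) auto
    have [measurable]: "u \<in> borel_measurable (lebesgue_on {-pi..pi})"
      by (rule borel_measurable_integrable[OF ui])
    show "(\<lambda>t. norm (f (of_real t)) powr p * (w t * u t) powr s) \<in> borel_measurable (lebesgue_on {-pi..pi})"
      by measurable
    show "AE t in lebesgue_on {-pi..pi}. norm (norm (f (of_real t)) powr p * (w t * u t) powr s) \<le> norm (M powr p * V * (1 + u t))"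
    proof (rule AE_I2)
      fix t assume "t \<in> space (lebesgue_on {-pi..pi})"
      hence t: "t \<in> {-pi..pi}" by simp
      have "norm (f (of_real t)) powr p \<le> M powr p" using M[OF t] p by (intro powr_mono2) auto
      moreover have "(w t * u t) powr s \<le> u t powr s"
        using w u0[of t] p by (intro powr_mono2) (auto simp: mult_left_le_one_le)
      ultimately have "norm (f (of_real t)) powr p * (w t * u t) powr s \<le> M powr p * (V * (1 + u t))"
        using V(1)[OF t] by (intro mult_mono) auto
      thus "norm (norm (f (of_real t)) powr p * (w t * u t) powr s) \<le> norm (M powr p * V * (1 + u t))"
        using V(2) u0[of t] by (simp add: mult.assoc)
    qed
  qed
qed

text \<open>
  \<open>J = {a..b}\<close> is the interval of length \<open>2 * \<delta> / n\<close> around \<open>x\<close>; the hull of \<open>J\<close> and an interval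
  of length \<open>O(1 / n)\<close> around \<open>t\<close> exceeds \<open>J\<close> by a factor \<open>O(1 + n * \<bar>y - t\<bar>)\<close>, for any \<open>y\<close> in \<open>J\<close>.
\<close>
lemma hull_ratio:
  fixes n :: nat
  assumes n: "1 \<le> n" and \<delta>: "0 < \<delta>" "\<delta> \<le> 1" and y: "\<bar>y - x\<bar> \<le> \<delta> / real n"
    and a: "a = x - \<delta> / real n" and b: "b = x + \<delta> / real n"
    and s: "t - 7 / real n \<le> s" and e: "e \<le> t + 7 / real n"
  shows "(max e b - min s a) / (b - a) \<le> (15 / \<delta>) * (1 + real n * \<bar>y - t\<bar>)"
proof -
  have nn: "0 < real n" using n by simp
  have dn: "\<delta> / real n \<le> 1 / real n" using \<delta> by (intro divide_right_mono) auto
  have d7: "1 / real n \<le> 7 / real n" by (intro divide_right_mono) auto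
  have "\<bar>x - t\<bar> \<le> \<bar>y - t\<bar> + 1 / real n" using y dn by linarith
  moreover have "max e b \<le> max t x + 7 / real n" using e dn d7 unfolding b by (simp add: max_def)
  moreover have "min t x - 7 / real n \<le> min s a" using s dn d7 unfolding a by (simp add: min_def)
  moreover have "max t x - min t x = \<bar>x - t\<bar>" by (simp add: max_def min_def)
  \<comment> \<open>A cell has length \<open>2 * pi / n \<le> 7 / n\<close>, so it lies within
    \<open>7 / n\<close> of each of its points; the remaining \<open>1 / n\<close> comes from
    \<open>\<delta> \<le> 1\<close> in the distance between \<open>y\<close> and
    \<open>x\<close>.\<close>
  moreover have "7 / real n + 7 / real n + 1 / real n = 15 / real n" by (simp add: field_simps)
  ultimately have "max e b - min s a \<le> \<bar>y - t\<bar> + 15 / real n" by linarith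
  also have "\<dots> \<le> 15 * (1 + real n * \<bar>y - t\<bar>) / real n" using nn by (simp add: field_simps)
  finally have "(max e b - min s a) / (b - a) \<le> (15 * (1 + real n * \<bar>y - t\<bar>) / real n) / (b - a)"
    using \<delta> nn by (intro divide_right_mono) (auto simp: a b)
  also have "\<dots> = (15 / (2 * \<delta>)) * (1 + real n * \<bar>y - t\<bar>)"
    using nn \<delta> by (simp add: a b field_simps)
  also have "\<dots> \<le> (15 / \<delta>) * (1 + real n * \<bar>y - t\<bar>)"
    using \<delta> by (intro mult_right_mono divide_left_mono) auto
  finally show ?thesis .
qed


section \<open>Localisation combined with the regularity of \<open>u\<close>\<close>

definition localized :: "(real \<Rightarrow> real) \<Rightarrow> nat \<Rightarrow> real \<Rightarrow> real \<Rightarrow> bool" where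
  "localized W m \<delta> c \<longleftrightarrow> 0 < \<delta> \<and> \<delta> \<le> 1 \<and> 0 < c \<and>
     (\<forall>n\<ge>1. \<forall>f t. trig_entire n f \<longrightarrow> (\<exists>x. \<bar>x - t\<bar> \<le> pi \<and> (\<forall>y. \<bar>y - x\<bar> \<le> \<delta> / real n \<longrightarrow>
       norm (f (of_real t)) * W t * (1 + real n * \<bar>y - t\<bar>) ^ m \<le> c * (norm (f (of_real y)) * W y))))"

text \<open>\<open>E\<close> is the part of the localisation interval around \<open>x\<close> where
  \<open>u\<close> is at least \<delta> times its mean, and \<open>{c..d}\<close> is the hull of
  that interval and \<open>{s..e}\<close>. Growth of masses replaces the mean over the interval by
  the mass of the hull, at the cost of a power of the ratio in \<open>hull_ratio\<close>. In part
  (i) \<open>{s..e}\<close> is a cell; in part (ii) it is the point \<open>t\<close>, because there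
  the hull must not be longer than one period.\<close>

lemma localized_regular:
  assumes loc: "localized W k \<delta>1 c1" and reg: "regular_weight lm u m K \<delta> \<kappa>"
    and n: "1 \<le> n" and f: "trig_entire n f" and t: "t \<in> {-pi..pi}"
    and s: "t - 7 / real n \<le> s" "s \<le> t" "-pi \<le> s" and e: "t \<le> e" "e \<le> t + 7 / real n" "e \<le> pi"
    and lm: "s = t \<and> e = t \<and> lm = 2 * pi \<or> lm = 6 * pi"
  obtains E c d where "E \<in> sets lebesgue" "E \<subseteq> {-3*pi..3*pi}" "2 * \<kappa> * \<delta>1 / real n \<le> measure lebesgue E"
    "c \<le> s" "e \<le> d" "c < d" "-3*pi \<le> c" "d \<le> 3*pi" "d - c \<le> lm" "2 * \<delta>1 / real n \<le> d - c"
    "\<And>y. y \<in> E \<Longrightarrow> real n * mass u c d \<le> (2 * K * (15 / \<delta>1) ^ m / \<delta>) * (1 + real n * \<bar>y - t\<bar>) ^ m * u y"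
    "\<And>y. y \<in> E \<Longrightarrow> mass u c d / (2 * \<delta>1 / real n) \<le> (K * (15 / \<delta>1) ^ m / \<delta>) * (1 + real n * \<bar>y - t\<bar>) ^ m * u y"
    "\<And>y. y \<in> E \<Longrightarrow> norm (f (of_real t)) * W t * (1 + real n * \<bar>y - t\<bar>) ^ k \<le> c1 * (norm (f (of_real y)) * W y)"
proof -
  have \<delta>1: "0 < \<delta>1" "\<delta>1 \<le> 1" using loc unfolding localized_def by blast+
  obtain x where x: "\<bar>x - t\<bar> \<le> pi" "\<And>y. \<bar>y - x\<bar> \<le> \<delta>1 / real n \<Longrightarrow>
       norm (f (of_real t)) * W t * (1 + real n * \<bar>y - t\<bar>) ^ k \<le> c1 * (norm (f (of_real y)) * W y)"
    using loc n f unfolding localized_def by blast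
  have u: "weight u" and pos: "0 < K" "0 < \<delta>" "0 < \<kappa>"
    and dbl: "\<And>a b c d. -3*pi \<le> c \<Longrightarrow> c \<le> a \<Longrightarrow> a < b \<Longrightarrow> b \<le> d \<Longrightarrow> d \<le> 3*pi \<Longrightarrow> d - c \<le> lm \<Longrightarrow>
        mass u c d \<le> K * ((d - c) / (b - a)) ^ m * mass u a b"
    and lev: "\<And>a b. -3*pi \<le> a \<Longrightarrow> a < b \<Longrightarrow> b \<le> 3*pi \<Longrightarrow> b - a \<le> lm \<Longrightarrow>
        \<kappa> * (b - a) \<le> measure lebesgue {y \<in> {a..b}. \<delta> * mass u a b \<le> u y * (b - a)}"
    using reg unfolding regular_weight_def by blast+
  have nn: "1 \<le> real n" using n by simp
  have dn: "0 < \<delta>1 / real n" "\<delta>1 / real n \<le> 1 / real n" "\<delta>1 / real n \<le> 1" "1 / real n \<le> 1"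
    using \<delta>1 nn by (auto simp: divide_le_eq intro: divide_right_mono)
  define a where "a = x - \<delta>1 / real n"
  define b where "b = x + \<delta>1 / real n"
  define c where "c = min s a"
  define d where "d = max e b"
  have ba: "b - a = 2 * \<delta>1 / real n" by (simp add: a_def b_def)
  have ab: "a < b" using dn by (simp add: a_def b_def)
  have cd: "c \<le> a" "b \<le> d" "c \<le> s" "e \<le> d" by (simp_all add: c_def d_def)
  have range: "-3*pi \<le> c" "d \<le> 3*pi"
  proof -
    have "-2*pi - 1 \<le> a" using x(1) t dn unfolding a_def by (auto simp: abs_le_iff)
    thus "-3*pi \<le> c" using s pi_gt3 unfolding c_def by auto
    have "b \<le> 2*pi + 1" using x(1) t dn unfolding b_def by (auto simp: abs_le_iff)
    thus "d \<le> 3*pi" using e pi_gt3 unfolding d_def by auto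
  qed
  have len: "d - c \<le> lm"
    using lm
  proof (elim disjE conjE)
    assume l: "s = t" "e = t" "lm = 2 * pi"
    show ?thesis using x(1) dn pi_gt3 unfolding c_def d_def a_def b_def l
      by (auto simp: abs_le_iff min_def max_def)
  next
    assume "lm = 6 * pi"
    thus ?thesis using range by simp
  qed
  define E where "E = {y \<in> {a..b}. \<delta> * mass u a b \<le> u y * (b - a)}"
  have sub: "{a..b} \<subseteq> {-3*pi..3*pi}" using range cd by auto
  have E: "E \<in> sets lebesgue" "E \<subseteq> {a..b}" unfolding E_def by (rule weight_superlevel_measurable[OF u sub]) blast
  have bl: "b - a \<le> lm" using len cd by linarith
  have yE: "\<bar>y - x\<bar> \<le> \<delta>1 / real n" if "y \<in> E" for y
    using that E(2) unfolding a_def b_def by (auto simp: abs_le_iff)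
  have key: "mass u c d / (b - a) \<le> (K * (15 / \<delta>1) ^ m / \<delta>) * (1 + real n * \<bar>y - t\<bar>) ^ m * u y" if y: "y \<in> E" for y
  proof -
    have u0: "0 \<le> u y" using weight_integrable(3)[OF u] .
    have "mass u a b \<le> u y * (b - a) / \<delta>" using y pos unfolding E_def by (simp add: field_simps)
    have r0: "0 \<le> (d - c) / (b - a)" using cd ab by simp
    have "mass u c d \<le> K * ((d - c) / (b - a)) ^ m * mass u a b"
      using range cd ab len by (intro dbl) auto
    also have "\<dots> \<le> K * ((15 / \<delta>1) * (1 + real n * \<bar>y - t\<bar>)) ^ m * (u y * (b - a) / \<delta>)"
    proof (intro mult_mono mult_left_mono power_mono r0)
      show "(d - c) / (b - a) \<le> (15 / \<delta>1) * (1 + real n * \<bar>y - t\<bar>)"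
        unfolding c_def d_def by (rule hull_ratio[OF n \<delta>1 yE[OF y] a_def b_def s(1) e(2)])
      show "mass u a b \<le> u y * (b - a) / \<delta>" by fact
    qed (use pos \<delta>1 mass_nonneg[OF u] zero_le_power[OF r0] in auto)
    also have "\<dots> = ((K * (15 / \<delta>1) ^ m / \<delta>) * (1 + real n * \<bar>y - t\<bar>) ^ m * u y) * (b - a)"
      unfolding power_mult_distrib by simp
    finally show ?thesis using ab by (simp only: pos_divide_le_eq[OF diff_gt_0_iff_gt[THEN iffD2, OF ab]])
  qed
  show ?thesis
  proof (rule that[of E c d])
    show "E \<in> sets lebesgue" "E \<subseteq> {-3*pi..3*pi}" using E sub by auto
    have "\<kappa> * (b - a) \<le> measure lebesgue E" unfolding E_def using range cd ab bl by (intro lev) auto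
    thus "2 * \<kappa> * \<delta>1 / real n \<le> measure lebesgue E" by (simp add: ba mult_ac)
    show "c \<le> s" "e \<le> d" "c < d" "-3*pi \<le> c" "d \<le> 3*pi" "d - c \<le> lm" using cd ab range len by auto
    show "2 * \<delta>1 / real n \<le> d - c" using ba cd by linarith
    fix y assume y: "y \<in> E"
    show k2: "mass u c d / (2 * \<delta>1 / real n) \<le> (K * (15 / \<delta>1) ^ m / \<delta>) * (1 + real n * \<bar>y - t\<bar>) ^ m * u y"
      using key[OF y] by (simp only: ba)
    show "norm (f (of_real t)) * W t * (1 + real n * \<bar>y - t\<bar>) ^ k \<le> c1 * (norm (f (of_real y)) * W y)"
      by (rule x(2)[OF yE[OF y]])
    have "real n * mass u c d = (2 * \<delta>1) * (mass u c d / (2 * \<delta>1 / real n))" using \<delta>1 by simp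
    also have "\<dots> \<le> 2 * (mass u c d / (2 * \<delta>1 / real n))"
      using \<delta>1 mass_nonneg[OF u, of c d] nn by (intro mult_right_mono) auto
    also have "\<dots> \<le> 2 * ((K * (15 / \<delta>1) ^ m / \<delta>) * (1 + real n * \<bar>y - t\<bar>) ^ m * u y)"
      using k2 by (rule mult_left_mono) simp
    finally show "real n * mass u c d \<le> (2 * K * (15 / \<delta>1) ^ m / \<delta>) * (1 + real n * \<bar>y - t\<bar>) ^ m * u y" by simp
  qed
qed

text \<open>Sampling: \<open>W = norm f * w powr (1 / q)\<close> is replaced by its maximum on each
  of \<open>n\<close> cells, so the left side is at most the sum of
  \<open>\<Phi> j powr (q / p) / n\<close>. Each \<open>\<Phi> j\<close> is O(n) times the integral
  of the right-hand integrand against a kernel peaked at the cell; the kernels have bounded sum, so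
  the sum of the \<open>\<Phi> j\<close> is O(n B). Embedding with exponent
  \<open>q / p \<ge> 1\<close> then gives \<open>n powr (q / p - 1)\<close>.\<close>

lemma nikolskii_Lp:
  assumes reg: "regular_weight (6*pi) u m K \<delta> \<kappa>" and pq: "0 < p" "p \<le> q"
    and w: "continuous_on UNIV w" "\<And>t. 0 \<le> w t" "\<And>t. w t \<le> 1" "\<And>t. w (t + 2 * pi) = w t"
    and loc: "localized (\<lambda>t. w t powr (1 / q)) k \<delta>1 c1" and k: "2 + real m * (p / q) \<le> p * real k"
  shows "\<exists>C>0. \<forall>n\<ge>1. \<forall>f. trig_entire n f \<longrightarrow>
     integral\<^sup>L (lebesgue_on {-pi..pi}) (\<lambda>t. norm (f (of_real t)) powr q * (w t * u t))
     \<le> C * real n powr (q / p - 1) *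
        (integral\<^sup>L (lebesgue_on {-pi..pi}) (\<lambda>t. norm (f (of_real t)) powr p * (w t * u t) powr (p / q))) powr (q / p)"
proof -
  have q0: "0 < q" using pq by simp
  have u: "weight u" and pos: "0 < K" "0 < \<delta>" "0 < \<kappa>" using reg unfolding regular_weight_def by blast+
  have \<delta>1: "0 < \<delta>1" "\<delta>1 \<le> 1" and c1: "0 < c1" using loc unfolding localized_def by blast+
  have u0: "0 \<le> u t" for t using weight_integrable(3)[OF u] .
  obtain K0 where K0: "K0 > 0" "\<And>n y t. n \<ge> 1 \<Longrightarrow>
     (\<forall>j<n. t j \<in> {-pi + 2 * pi * real j / real n..-pi + 2 * pi * real (j + 1) / real n}) \<Longrightarrow>
     (\<Sum>j<n. 1 / (1 + real n * \<bar>y - t j\<bar>)\<^sup>2) \<le> K0"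
    using inverse_square_sum_bound by blast
  define K2 where "K2 = 2 * K * (15 / \<delta>1) ^ m / \<delta>"
  have K2: "0 < K2" using pos \<delta>1 by (simp add: K2_def)
  define C3 where "C3 = c1 powr p * K2 powr (p / q)"
  have C3: "0 < C3" using c1 K2 by (simp add: C3_def)
  \<comment> \<open>3 is the number of periods integrated over, and
    \<open>2 * \<kappa> * \<delta>1 / n\<close> bounds from below the measure of the set
    \<open>E\<close> in each local estimate.\<close>
  define C4 where "C4 = 3 * C3 * K0 / (2 * \<kappa> * \<delta>1)"
  have C4: "0 < C4" using C3 K0 pos \<delta>1 by (simp add: C4_def)
  show ?thesis
  proof (intro exI[of _ "C4 powr (q / p)"] conjI allI impI)
    show "0 < C4 powr (q / p)" using C4 by simp
    fix n :: nat and f assume n: "1 \<le> n" and f: "trig_entire n f"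
    have nn: "1 \<le> real n" using n by simp
    define b where "b y = norm (f (of_real y)) powr p * (w y * u y) powr (p / q)" for y
    define B where "B = integral\<^sup>L (lebesgue_on {-pi..pi}) b"
    have b0: "0 \<le> b y" for y by (simp add: b_def)
    have bint: "integrable (lebesgue_on {-pi..pi}) b"
      unfolding b_def
    proof (rule integrand_integrable[OF f u w(1-3) pq(1), where V = 1])
      fix t
      show "u t powr (p / q) \<le> 1 * (1 + u t)"
      proof (cases "u t \<le> 1")
        case True
        have "u t powr (p / q) \<le> 1" using True u0 pq by (intro powr_le1) auto
        thus ?thesis using u0[of t] by simp
      next
        case False
        have "u t powr (p / q) \<le> u t powr 1" using False pq by (intro powr_mono) auto
        thus ?thesis using False by simp
      qed
    qed (use pq in auto)
    have bper: "b (t + 2 * pi) = b t" for t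
      unfolding b_def using w(4) weight_integrable(2)[OF u] trig_entire_periodic[OF f] by simp
    note b3 = periodic_integrable[OF bint bper b0]
    define s where "s j = -pi + 2 * pi * real j / real n" for j :: nat
    have s_eq: "s (j + 1) = s j + 2 * pi / real n" for j by (simp add: s_def add_divide_distrib algebra_simps)
    have s_range: "-pi \<le> s j" "s (j + 1) \<le> pi" if "j < n" for j
    proof -
      show "-pi \<le> s j" by (simp add: s_def)
      have "2 * pi * real (j + 1) / real n \<le> 2 * pi * real n / real n"
        using that by (intro divide_right_mono mult_left_mono) auto
      thus "s (j + 1) \<le> pi" using nn by (simp add: s_def)
    qed
    have cell7: "2 * pi / real n \<le> 7 / real n" using pi_less_4 pi_approx by (intro divide_right_mono) auto
    have s_lt: "s j \<le> s (j + 1)" for j unfolding s_eq using nn by simp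
    define W where "W t = norm (f (of_real t)) * w t powr (1 / q)" for t
    have W0: "0 \<le> W t" for t by (simp add: W_def)
    have "\<exists>x\<in>{s j..s (j + 1)}. \<forall>y\<in>{s j..s (j + 1)}. W y \<le> W x" for j
      unfolding W_def using s_lt[of j] q0 w(2)
      by (intro continuous_attains_sup continuous_intros continuous_on_real_trig_entire[OF f]
           continuous_on_powr' continuous_on_subset[OF w(1)]) auto
    then obtain t where t: "\<And>j. t j \<in> {s j..s (j + 1)}" "\<And>j y. y \<in> {s j..s (j + 1)} \<Longrightarrow> W y \<le> W (t j)"
      by metis
    \<comment> \<open>With the factor \<open>n\<close>, which turns the mass into a mean up to
      \<open>2 * pi\<close>, \<open>\<Phi> j powr (q / p)\<close> is \<open>n\<close> times the
      contribution of the cell to the left side.\<close>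
    define \<Phi> where "\<Phi> j = W (t j) powr p * (real n * mass u (s j) (s (j + 1))) powr (p / q)" for j
    have \<Phi>0: "0 \<le> \<Phi> j" for j by (simp add: \<Phi>_def)
    define k' where "k' j y = 1 / (1 + real n * \<bar>y - t j\<bar>)\<^sup>2" for j y
    have k': "continuous_on UNIV (k' j)" "0 \<le> k' j y" "k' j y \<le> 1" for j y
    proof -
      have nz: "1 + real n * \<bar>y - t j\<bar> \<noteq> 0" for y
      proof -
        have "0 < 1 + real n * \<bar>y - t j\<bar>" by (simp add: add_pos_nonneg)
        thus ?thesis by (rule less_imp_neq[symmetric])
      qed
      show "continuous_on UNIV (k' j)" unfolding k'_def by (intro continuous_intros ballI power_not_zero nz)
      show "0 \<le> k' j y" by (simp add: k'_def)
      have "1\<^sup>2 \<le> (1 + real n * \<bar>y - t j\<bar>)\<^sup>2" by (intro power_mono) auto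
      moreover have "0 < (1 + real n * \<bar>y - t j\<bar>)\<^sup>2" by (rule zero_less_power2[THEN iffD2, OF nz])
      ultimately show "k' j y \<le> 1" unfolding k'_def by (subst divide_le_eq_1_pos) simp_all
    qed
    have bk: "set_integrable lebesgue {-3*pi..3*pi} (\<lambda>y. b y * k' j y)" for j
      by (rule set_integrable_mult_bounded[OF b3(1) k'])
    have each: "(2 * \<kappa> * \<delta>1 / real n) * \<Phi> j \<le> C3 * (LINT y:{-3*pi..3*pi}|lebesgue. b y * k' j y)" if j: "j < n" for j
    proof (rule localized_regular[OF loc reg n f, of "t j" "s j" "s (j + 1)"])
      note tj = t(1)[of j] and sj = s_range[OF j]
      show "t j \<in> {-pi..pi}" using tj sj by auto
      show "t j - 7 / real n \<le> s j" "s (j + 1) \<le> t j + 7 / real n" using tj cell7 unfolding s_eq by auto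
      show "s j \<le> t j" "-pi \<le> s j" "t j \<le> s (j + 1)" "s (j + 1) \<le> pi" using tj sj by auto
      show "s j = t j \<and> s (j + 1) = t j \<and> 6*pi = 2 * pi \<or> 6*pi = 6 * pi" by simp
      fix E c d
      assume E: "E \<in> sets lebesgue" "E \<subseteq> {-3*pi..3*pi}" and mE: "2 * \<kappa> * \<delta>1 / real n \<le> measure lebesgue E"
        and cd: "c \<le> s j" "s (j + 1) \<le> d" "-3*pi \<le> c" "d \<le> 3*pi"
        and um: "\<And>y. y \<in> E \<Longrightarrow> real n * mass u c d \<le> (2 * K * (15 / \<delta>1) ^ m / \<delta>) * (1 + real n * \<bar>y - t j\<bar>) ^ m * u y"
        and fm: "\<And>y. y \<in> E \<Longrightarrow> norm (f (of_real (t j))) * w (t j) powr (1 / q) * (1 + real n * \<bar>y - t j\<bar>) ^ k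
           \<le> c1 * (norm (f (of_real y)) * w y powr (1 / q))"
      have "\<Phi> j \<le> C3 * (b y * k' j y)" if y: "y \<in> E" for y
      proof -
        define X where "X = 1 + real n * \<bar>y - t j\<bar>"
        have X: "1 \<le> X" by (simp add: X_def)
        have "real n * mass u (s j) (s (j + 1)) \<le> real n * mass u c d"
          using cd nn by (intro mult_left_mono mass_mono[OF u]) auto
        hence v: "real n * mass u (s j) (s (j + 1)) \<le> K2 * X ^ m * u y" using um[OF y] by (simp add: K2_def X_def)
        have "\<Phi> j * X\<^sup>2 \<le> C3 * (W y powr p * u y powr (p / q))"
          unfolding \<Phi>_def C3_def using mass_nonneg[OF u] nn
          by (intro combine_powers[where k = k and m = m] W0 u0 X pq q0 c1 K2 k v)
             (use fm[OF y] in \<open>auto simp: W_def X_def\<close>)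
        also have "W y powr p * u y powr (p / q) = b y"
          unfolding W_def b_def using w(2)[of y] u0[of y] by (simp add: powr_mult powr_powr)
        finally have "\<Phi> j \<le> C3 * b y / X\<^sup>2" using X by (simp add: pos_le_divide_eq)
        thus ?thesis by (simp add: k'_def X_def)
      qed
      hence "\<Phi> j * measure lebesgue E \<le> (LINT y:{-3*pi..3*pi}|lebesgue. C3 * (b y * k' j y))"
        using C3 b0 k'(2) by (intro level_times_measure_le[OF E] set_integrable_mult_right bk) auto
      also have "\<dots> = C3 * (LINT y:{-3*pi..3*pi}|lebesgue. b y * k' j y)" by (rule set_integral_mult_right)
      finally have "measure lebesgue E * \<Phi> j \<le> C3 * (LINT y:{-3*pi..3*pi}|lebesgue. b y * k' j y)" by (simp add: mult.commute)
      moreover have "(2 * \<kappa> * \<delta>1 / real n) * \<Phi> j \<le> measure lebesgue E * \<Phi> j" using mE \<Phi>0 by (rule mult_right_mono)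
      ultimately show "(2 * \<kappa> * \<delta>1 / real n) * \<Phi> j \<le> C3 * (LINT y:{-3*pi..3*pi}|lebesgue. b y * k' j y)" by linarith
    qed
    have sumk: "(\<Sum>j<n. LINT y:{-3*pi..3*pi}|lebesgue. b y * k' j y) \<le> K0 * (3 * B)"
    proof -
      have "(\<Sum>j<n. LINT y:{-3*pi..3*pi}|lebesgue. b y * k' j y)
          = (\<integral>y. (\<Sum>j<n. indicator {-3*pi..3*pi} y *\<^sub>R (b y * k' j y)) \<partial>lebesgue)"
        unfolding set_lebesgue_integral_def using bk unfolding set_integrable_def
        by (intro Bochner_Integration.integral_sum[symmetric])
      also have "\<dots> \<le> (\<integral>y. K0 * (indicator {-3*pi..3*pi} y *\<^sub>R b y) \<partial>lebesgue)"
      proof (rule integral_mono)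
        show "integrable lebesgue (\<lambda>y. \<Sum>j<n. indicator {-3*pi..3*pi} y *\<^sub>R (b y * k' j y))"
          using bk unfolding set_integrable_def by (intro Bochner_Integration.integrable_sum)
        show "integrable lebesgue (\<lambda>y. K0 * (indicator {-3*pi..3*pi} y *\<^sub>R b y))"
          using b3(1) unfolding set_integrable_def by (intro integrable_mult_right)
        fix y
        have "(\<Sum>j<n. k' j y) \<le> K0" unfolding k'_def using t(1) by (intro K0(2)[OF n]) (auto simp: s_def)
        hence "(indicator {-3*pi..3*pi} y * b y) * (\<Sum>j<n. k' j y) \<le> (indicator {-3*pi..3*pi} y * b y) * K0"
          using b0[of y] by (intro mult_left_mono) auto
        moreover have "(\<Sum>j<n. indicator {-3*pi..3*pi} y *\<^sub>R (b y * k' j y)) = (indicator {-3*pi..3*pi} y * b y) * (\<Sum>j<n. k' j y)"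
          by (simp add: sum_distrib_left mult.assoc)
        ultimately show "(\<Sum>j<n. indicator {-3*pi..3*pi} y *\<^sub>R (b y * k' j y)) \<le> K0 * (indicator {-3*pi..3*pi} y *\<^sub>R b y)"
          by (simp add: mult.commute)
      qed
      also have "\<dots> = K0 * (LINT y:{-3*pi..3*pi}|lebesgue. b y)" by (simp add: set_lebesgue_integral_def)
      finally show ?thesis using b3(2) by (simp add: B_def)
    qed
    have S: "(\<Sum>j<n. \<Phi> j) \<le> C4 * real n * B"
    proof -
      have "(2 * \<kappa> * \<delta>1 / real n) * (\<Sum>j<n. \<Phi> j) \<le> C3 * (\<Sum>j<n. LINT y:{-3*pi..3*pi}|lebesgue. b y * k' j y)"
        unfolding sum_distrib_left using each by (intro sum_mono) auto
      also have "\<dots> \<le> C3 * (K0 * (3 * B))" using sumk C3 by (intro mult_left_mono) auto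
      finally have "(2 * \<kappa> * \<delta>1 / real n) * (\<Sum>j<n. \<Phi> j) \<le> C3 * (K0 * (3 * B))" .
      thus ?thesis using pos \<delta>1 nn by (simp add: C4_def field_simps)
    qed
    have qp: "1 \<le> q / p" using pq by simp
    have B0: "0 \<le> B" unfolding B_def using b0 by (intro Bochner_Integration.integral_nonneg) auto
    have lhs: "integral\<^sup>L (lebesgue_on {-pi..pi}) (\<lambda>t. norm (f (of_real t)) powr q * (w t * u t))
        \<le> (\<Sum>j<n. W (t j) powr q * mass u (s j) (s (j + 1)))"
    proof -
      have ui: "set_integrable lebesgue {s j..s (j + 1)} u" if "j < n" for j
        using s_range[OF that] pi_gt3 by (intro weight_integrable_sub[OF u]) auto
      have "integral\<^sup>L (lebesgue_on {-pi..pi}) (\<lambda>t. norm (f (of_real t)) powr q * (w t * u t))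
         = (\<integral>y. indicator {-pi..pi} y *\<^sub>R (norm (f (of_real y)) powr q * (w y * u y)) \<partial>lebesgue)"
        by (subst integral_lebesgue_on) (auto simp: set_lebesgue_integral_def)
      also have "\<dots> \<le> (\<integral>y. (\<Sum>j<n. W (t j) powr q * (indicator {s j..s (j + 1)} y *\<^sub>R u y)) \<partial>lebesgue)"
      proof (rule integral_mono')
        show "integrable lebesgue (\<lambda>y. \<Sum>j<n. W (t j) powr q * (indicator {s j..s (j + 1)} y *\<^sub>R u y))"
          using ui unfolding set_integrable_def
          by (intro Bochner_Integration.integrable_sum integrable_mult_right) auto
        fix y
        have nonneg: "0 \<le> W (t j) powr q * (indicator {s j..s (j + 1)} y *\<^sub>R u y)" for j using u0[of y] by simp
        thus "0 \<le> (\<Sum>j<n. W (t j) powr q * (indicator {s j..s (j + 1)} y *\<^sub>R u y))" by (intro sum_nonneg)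
        show "indicator {-pi..pi} y *\<^sub>R (norm (f (of_real y)) powr q * (w y * u y))
           \<le> (\<Sum>j<n. W (t j) powr q * (indicator {s j..s (j + 1)} y *\<^sub>R u y))"
        proof (cases "y \<in> {-pi..pi}")
          case False
          thus ?thesis using nonneg by (simp add: sum_nonneg)
        next
          case True
          obtain j where j: "j < n" "y \<in> {s j..s (j + 1)}"
          proof (cases "y = pi")
            case True
            \<comment> \<open>At \<open>y = pi\<close> the floor used in the other case would give
              \<open>j = n\<close>, so this point is assigned to the last cell.\<close>
            have "y \<in> {s (n - 1)..s (n - 1 + 1)}" using True n nn pi_gt_zero
              by (auto simp: s_def of_nat_diff field_simps)
            thus ?thesis using that[of "n - 1"] n by simp
          next
            case F: False
            define j where "j = nat \<lfloor>real n * (y + pi) / (2 * pi)\<rfloor>"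
            have p0: "0 \<le> real n * (y + pi) / (2 * pi)" using True nn by simp
            hence jj: "real j \<le> real n * (y + pi) / (2 * pi)" "real n * (y + pi) / (2 * pi) < real j + 1"
              unfolding j_def by linarith+
            have "real n * (y + pi) / (2 * pi) < real n" using True F nn pi_gt_zero by (simp add: field_simps)
            hence "j < n" using jj by linarith
            moreover have "y \<in> {s j..s (j + 1)}" using jj nn pi_gt_zero by (auto simp: s_def field_simps)
            ultimately show ?thesis by (rule that)
          qed
          have "norm (f (of_real y)) powr q * w y = W y powr q"
            unfolding W_def using w(2)[of y] q0 by (simp add: powr_mult powr_powr)
          hence "norm (f (of_real y)) powr q * (w y * u y) = W y powr q * u y" by (simp add: mult.assoc[symmetric])
          also have "\<dots> \<le> W (t j) powr q * u y"
            using t(2)[OF j(2)] W0 u0 q0 by (intro mult_right_mono powr_mono2) auto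
          also have "\<dots> = W (t j) powr q * (indicator {s j..s (j + 1)} y *\<^sub>R u y)" using j by simp
          also have "\<dots> \<le> (\<Sum>j<n. W (t j) powr q * (indicator {s j..s (j + 1)} y *\<^sub>R u y))"
            by (rule member_le_sum[where f = "\<lambda>j. W (t j) powr q * (indicator {s j..s (j + 1)} y *\<^sub>R u y)"])
               (use j nonneg in auto)
          finally show ?thesis using True by simp
        qed
      qed
      also have "\<dots> = (\<Sum>j<n. W (t j) powr q * mass u (s j) (s (j + 1)))"
        unfolding mass_def set_lebesgue_integral_def using ui unfolding set_integrable_def
        by (subst Bochner_Integration.integral_sum) (auto intro!: integrable_mult_right)
      finally show ?thesis .
    qed
    have "W (t j) powr q * mass u (s j) (s (j + 1)) = \<Phi> j powr (q / p) / real n" for j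
    proof -
      have "\<Phi> j powr (q / p) = W (t j) powr q * (real n * mass u (s j) (s (j + 1)))"
        unfolding \<Phi>_def using pq q0 W0 mass_nonneg[OF u] nn by (simp add: powr_mult powr_powr)
      thus ?thesis using nn by simp
    qed
    hence "(\<Sum>j<n. W (t j) powr q * mass u (s j) (s (j + 1))) = (\<Sum>j<n. \<Phi> j powr (q / p)) / real n"
      by (simp add: sum_divide_distrib)
    also have "\<dots> \<le> (\<Sum>j<n. \<Phi> j) powr (q / p) / real n"
      using \<Phi>0 qp by (intro divide_right_mono sum_powr_le) auto
    also have "\<dots> \<le> (C4 * real n * B) powr (q / p) / real n"
      using S \<Phi>0 qp by (intro divide_right_mono powr_mono2 sum_nonneg) auto
    also have "\<dots> = C4 powr (q / p) * real n powr (q / p - 1) * B powr (q / p)"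
      using C4 nn B0 by (simp add: powr_mult powr_diff)
    finally show "integral\<^sup>L (lebesgue_on {-pi..pi}) (\<lambda>t. norm (f (of_real t)) powr q * (w t * u t))
     \<le> C4 powr (q / p) * real n powr (q / p - 1) *
        (integral\<^sup>L (lebesgue_on {-pi..pi}) (\<lambda>t. norm (f (of_real t)) powr p * (w t * u t) powr (p / q))) powr (q / p)"
      using lhs unfolding B_def b_def by linarith
  qed
qed

text \<open>At a fixed \<open>t\<close> the hypothesis \<open>up\<close> bounds \<open>u t\<close>
  by a mean over the hull of \<open>t\<close> and the localisation interval, hence by a multiple of
  \<open>(1 + n * \<bar>y - t\<bar>) ^ m * u y\<close> for \<open>y\<close> in \<open>E\<close>. The
  polynomial decays to the same order \<open>m\<close>, so the powers cancel, and averaging over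
  \<open>E\<close>, whose measure is at least of order 1 / n, yields
  \<open>n powr (1 / p)\<close>.\<close>

lemma nikolskii_Linf:
  assumes reg: "regular_weight (2*pi) u m K \<delta> \<kappa>" and p: "0 < p" and L: "0 < L"
    and up: "\<And>a b t. -3*pi \<le> a \<Longrightarrow> a < b \<Longrightarrow> b \<le> 3*pi \<Longrightarrow> b - a \<le> 2*pi \<Longrightarrow> t \<in> {a..b} \<Longrightarrow> u t \<le> L * mass u a b / (b - a)"
    and w: "continuous_on UNIV w" "\<And>t. 0 \<le> w t" "\<And>t. w t \<le> 1" "\<And>t. w (t + 2 * pi) = w t"
    and loc: "localized w m \<delta>1 c1"
  shows "\<exists>C>0. \<forall>n\<ge>1. \<forall>f t. trig_entire n f \<longrightarrow> t \<in> {-pi..pi} \<longrightarrow>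
     norm (f (of_real t)) * (w t * u t) \<le> C * real n powr (1 / p) *
        (integral\<^sup>L (lebesgue_on {-pi..pi}) (\<lambda>t. norm (f (of_real t)) powr p * (w t * u t) powr p)) powr (1 / p)"
proof -
  have u: "weight u" and pos: "0 < K" "0 < \<delta>" "0 < \<kappa>" using reg unfolding regular_weight_def by blast+
  have \<delta>1: "0 < \<delta>1" "\<delta>1 \<le> 1" and c1: "0 < c1" using loc unfolding localized_def by blast+
  have u0: "0 \<le> u t" for t using weight_integrable(3)[OF u] .
  define K3 where "K3 = L * (K * (15 / \<delta>1) ^ m / \<delta>)"
  have K3: "0 < K3" using pos \<delta>1 L by (simp add: K3_def)
  define C4 where "C4 = 3 * (c1 * K3) powr p / (2 * \<kappa> * \<delta>1)"
  have C4: "0 < C4" using c1 K3 pos \<delta>1 by (simp add: C4_def)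
  \<comment> \<open>Applied to the whole period, \<open>up\<close> bounds \<open>u\<close> itself,
    which makes \<open>(w * u) powr p\<close> integrable also for \<open>p > 1\<close>.\<close>
  define V where "V = L * mass u (-pi) pi / (2 * pi)"
  have V0: "0 \<le> V" using L mass_nonneg[OF u] by (simp add: V_def)
  have uV: "u t \<le> V" if "t \<in> {-pi..pi}" for t
    using up[of "-pi" pi t] that pi_gt_zero by (simp add: V_def)
  show ?thesis
  proof (intro exI[of _ "C4 powr (1 / p)"] conjI allI impI)
    show "0 < C4 powr (1 / p)" using C4 by simp
    fix n :: nat and f and t :: real
    assume n: "1 \<le> n" and f: "trig_entire n f" and t: "t \<in> {-pi..pi}"
    have nn: "1 \<le> real n" using n by simp
    define b where "b y = norm (f (of_real y)) powr p * (w y * u y) powr p" for y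
    define B where "B = integral\<^sup>L (lebesgue_on {-pi..pi}) b"
    have b0: "0 \<le> b y" for y by (simp add: b_def)
    have bint: "integrable (lebesgue_on {-pi..pi}) b"
      unfolding b_def
    proof (rule integrand_integrable[OF f u w(1-3) p p, where V = "V powr p"])
      fix t assume t: "t \<in> {-pi..pi}"
      have "u t powr p \<le> V powr p * 1" using uV[OF t] u0 p by (simp add: powr_mono2)
      also have "\<dots> \<le> V powr p * (1 + u t)" using u0[of t] by (intro mult_left_mono) auto
      finally show "u t powr p \<le> V powr p * (1 + u t)" .
    qed auto
    have bper: "b (t + 2 * pi) = b t" for t
      unfolding b_def using w(4) weight_integrable(2)[OF u] trig_entire_periodic[OF f] by simp
    note b3 = periodic_integrable[OF bint bper b0]
    define \<Phi> where "\<Phi> = norm (f (of_real t)) * (w t * u t)"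
    have \<Phi>0: "0 \<le> \<Phi>" using w(2) u0 by (simp add: \<Phi>_def)
    have main: "(2 * \<kappa> * \<delta>1 / real n) * \<Phi> powr p \<le> (c1 * K3) powr p * (3 * B)"
    proof (rule localized_regular[OF loc reg n f t, of t t])
      show "t - 7 / real n \<le> t" "t \<le> t + 7 / real n" "t \<le> t" "t \<le> t" by simp_all
      show "-pi \<le> t" "t \<le> pi" using t by auto
      show "t = t \<and> t = t \<and> 2*pi = 2 * pi \<or> 2*pi = 6 * pi" by simp
      fix E c d
      assume E: "E \<in> sets lebesgue" "E \<subseteq> {-3*pi..3*pi}" and mE: "2 * \<kappa> * \<delta>1 / real n \<le> measure lebesgue E"
        and cd: "c \<le> t" "t \<le> d" "c < d" "-3*pi \<le> c" "d \<le> 3*pi" "d - c \<le> 2*pi" "2 * \<delta>1 / real n \<le> d - c"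
        and um: "\<And>y. y \<in> E \<Longrightarrow> mass u c d / (2 * \<delta>1 / real n) \<le> (K * (15 / \<delta>1) ^ m / \<delta>) * (1 + real n * \<bar>y - t\<bar>) ^ m * u y"
        and fm: "\<And>y. y \<in> E \<Longrightarrow> norm (f (of_real t)) * w t * (1 + real n * \<bar>y - t\<bar>) ^ m
           \<le> c1 * (norm (f (of_real y)) * w y)"
      have "\<Phi> powr p \<le> (c1 * K3) powr p * b y" if y: "y \<in> E" for y
      proof -
        define X where "X = (1 + real n * \<bar>y - t\<bar>) ^ m"
        have X: "0 < X" unfolding X_def by (intro zero_less_power) (simp add: add_pos_nonneg)
        have dpos: "0 < 2 * \<delta>1 / real n" using \<delta>1 nn by simp
        have "u t \<le> L * mass u c d / (d - c)" using cd by (intro up) auto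
        also have "\<dots> \<le> L * mass u c d / (2 * \<delta>1 / real n)"
          using cd dpos L mass_nonneg[OF u, of c d]
          by (intro divide_left_mono mult_nonneg_nonneg mult_pos_pos) simp_all
        also have "\<dots> = L * (mass u c d / (2 * \<delta>1 / real n))" by simp
        also have "\<dots> \<le> L * ((K * (15 / \<delta>1) ^ m / \<delta>) * X * u y)"
          using um[OF y] L unfolding X_def by (intro mult_left_mono) auto
        finally have ut: "u t \<le> K3 * X * u y" by (simp add: K3_def mult_ac)
        have "\<Phi> * X = (norm (f (of_real t)) * w t * X) * u t" by (simp add: \<Phi>_def)
        also have "\<dots> \<le> (c1 * (norm (f (of_real y)) * w y)) * (K3 * X * u y)"
          by (rule mult_mono[OF fm[OF y, folded X_def] ut]) (use u0 w(2) c1 in auto)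
        also have "\<dots> = (c1 * K3 * (norm (f (of_real y)) * (w y * u y))) * X" by (simp add: mult_ac)
        finally have "\<Phi> \<le> c1 * K3 * (norm (f (of_real y)) * (w y * u y))" using X by (rule mult_right_le_imp_le)
        hence "\<Phi> powr p \<le> (c1 * K3 * (norm (f (of_real y)) * (w y * u y))) powr p"
          using \<Phi>0 p by (intro powr_mono2) auto
        also have "\<dots> = (c1 * K3) powr p * b y"
          unfolding b_def using c1 K3 w(2)[of y] u0[of y] by (simp add: powr_mult)
        finally show ?thesis .
      qed
      hence "\<Phi> powr p * measure lebesgue E \<le> (LINT y:{-3*pi..3*pi}|lebesgue. (c1 * K3) powr p * b y)"
        using b0 by (intro level_times_measure_le[OF E] set_integrable_mult_right b3(1)) auto
      also have "\<dots> = (c1 * K3) powr p * (3 * B)" using b3(2) by (simp add: B_def)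
      finally have "measure lebesgue E * \<Phi> powr p \<le> (c1 * K3) powr p * (3 * B)" by (simp add: mult.commute)
      moreover have "(2 * \<kappa> * \<delta>1 / real n) * \<Phi> powr p \<le> measure lebesgue E * \<Phi> powr p" using mE by (rule mult_right_mono) simp
      ultimately show "(2 * \<kappa> * \<delta>1 / real n) * \<Phi> powr p \<le> (c1 * K3) powr p * (3 * B)" by linarith
    qed
    hence "\<Phi> powr p \<le> C4 * real n * B" using pos \<delta>1 nn by (simp add: C4_def field_simps)
    hence "(\<Phi> powr p) powr (1 / p) \<le> (C4 * real n * B) powr (1 / p)" using p by (intro powr_mono2) auto
    moreover have "(\<Phi> powr p) powr (1 / p) = \<Phi>" using \<Phi>0 p by (simp add: powr_powr)
    moreover have B0: "0 \<le> B" unfolding B_def using b0 by (intro Bochner_Integration.integral_nonneg) auto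
    moreover have "(C4 * real n * B) powr (1 / p) = C4 powr (1 / p) * real n powr (1 / p) * B powr (1 / p)"
      using C4 nn B0 by (simp add: powr_mult)
    ultimately show "norm (f (of_real t)) * (w t * u t) \<le> C4 powr (1 / p) * real n powr (1 / p) *
        (integral\<^sup>L (lebesgue_on {-pi..pi}) (\<lambda>t. norm (f (of_real t)) powr p * (w t * u t) powr p)) powr (1 / p)"
      unfolding \<Phi>_def B_def b_def by simp
  qed
qed

lemma Omega_product_ex_localized:
  assumes fin: "finite I" "I \<noteq> {}" and w: "\<And>i. i \<in> I \<Longrightarrow> ws i \<in> Omega_class" and r: "r > 0"
  shows "\<exists>\<delta> c. localized (\<lambda>t. (\<Prod>i\<in>I. ws i t) powr r) m \<delta> c"
proof -
  have "\<exists>\<delta>>0. \<delta> \<le> 1 \<and> (\<exists>c>0. \<forall>n\<ge>1. \<forall>f t. trig_entire n f \<longrightarrow> (\<exists>x. \<bar>x - t\<bar> \<le> pi \<and>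
     (\<forall>y. \<bar>y - x\<bar> \<le> \<delta> / real n \<longrightarrow>
       norm (f (of_real t)) * (\<Prod>i\<in>I. ws i t) powr r * (1 + real n * \<bar>y - t\<bar>) ^ m
         \<le> c * (norm (f (of_real y)) * (\<Prod>i\<in>I. ws i y) powr r))))"
    by (rule Omega_product_localized) (use fin w r in auto)
  thus ?thesis unfolding localized_def by blast
qed

theorem corollary8p1:
  fixes s :: nat and \<omega>s :: "nat \<Rightarrow> real \<Rightarrow> real" and \<omega> :: "real \<Rightarrow> real"
  assumes "s \<ge> 1"
    and "\<And>i. i \<in> {1..s} \<Longrightarrow> \<omega>s i \<in> Omega_class"
    and "\<omega> = (\<lambda>t. \<Prod>i=1..s. \<omega>s i t)"
  shows "(\<forall>u p q. u \<in> A_infty \<and> 0 < p \<and> p \<le> q \<longrightarrow>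
            (\<exists>C>0. \<forall>n\<ge>1. \<forall>T. trig_poly n T \<longrightarrow>
               Lp_norm q (\<lambda>t. \<omega> t * u t) T
                 \<le> C * real n powr (1 / p - 1 / q) * Lp_norm p (\<lambda>t. (\<omega> t * u t) powr (p / q)) T)) \<and>
         (\<forall>u p. u \<in> A_star \<and> 0 < p \<longrightarrow>
            (\<exists>C>0. \<forall>n\<ge>1. \<forall>T. trig_poly n T \<longrightarrow>
               Linf_norm (\<lambda>t. \<omega> t * u t) T
                 \<le> ereal (C * real n powr (1 / p) * Lp_norm p (\<lambda>t. (\<omega> t * u t) powr p) T)))"
proof (intro conjI allI impI)
  have I: "finite {1..s}" "{1..s} \<noteq> {}" using assms(1) by auto
  have w: "continuous_on UNIV \<omega>" "\<And>t. 0 \<le> \<omega> t" "\<And>t. \<omega> t \<le> 1" "\<And>t. \<omega> (t + 2 * pi) = \<omega> t"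
    unfolding assms(3) using Omega_product_props[of "{1..s}" \<omega>s, OF I assms(2)] by auto
  have loc: "\<exists>\<delta> c. localized (\<lambda>t. \<omega> t powr r) m \<delta> c" if "r > 0" for r m
    unfolding assms(3) by (rule Omega_product_ex_localized[OF I assms(2) that])
  {
    fix u p q assume "u \<in> A_infty \<and> 0 < p \<and> p \<le> (q::real)"
    hence u: "u \<in> A_infty" and p: "0 < p" and pq: "p \<le> q" by auto
    have q: "0 < q" using p pq by simp
    obtain m K \<delta> \<kappa> where reg: "regular_weight (6*pi) u m K \<delta> \<kappa>" using A_infty_regular[OF u] by blast
    \<comment> \<open>Meets the exponent condition of \<open>combine_powers\<close>;
      \<open>k\<close> depends on \<open>u\<close>, \<open>p\<close> and \<open>q\<close> but not on
      the degree.\<close>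
    obtain k :: nat where "(2 + real m * (p / q)) / p \<le> real k" using real_arch_simple by blast
    hence k: "2 + real m * (p / q) \<le> p * real k" using p by (simp add: pos_divide_le_eq mult.commute)
    have "1 / q > 0" using q by simp
    then obtain \<delta>1 c1 where l: "localized (\<lambda>t. \<omega> t powr (1 / q)) k \<delta>1 c1" using loc by blast
    obtain C where C: "C > 0" "\<And>n f. n \<ge> 1 \<Longrightarrow> trig_entire n f \<Longrightarrow>
     integral\<^sup>L (lebesgue_on {-pi..pi}) (\<lambda>t. norm (f (of_real t)) powr q * (\<omega> t * u t))
     \<le> C * real n powr (q / p - 1) *
        (integral\<^sup>L (lebesgue_on {-pi..pi}) (\<lambda>t. norm (f (of_real t)) powr p * (\<omega> t * u t) powr (p / q))) powr (q / p)"
      using nikolskii_Lp[OF reg p pq w l k] by blast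
    show "\<exists>C>0. \<forall>n\<ge>1. \<forall>T. trig_poly n T \<longrightarrow>
               Lp_norm q (\<lambda>t. \<omega> t * u t) T
                 \<le> C * real n powr (1 / p - 1 / q) * Lp_norm p (\<lambda>t. (\<omega> t * u t) powr (p / q)) T"
    proof (intro exI[of _ "C powr (1 / q)"] conjI allI impI)
      show "0 < C powr (1 / q)" using C by simp
      fix n :: nat and T assume n: "1 \<le> n" and T: "trig_poly n T"
      obtain f where f: "trig_entire n f" "\<And>t. T t = f (of_real t)"
        using trig_poly_ex_entire[OF T] by blast
      define J where "J = integral\<^sup>L (lebesgue_on {-pi..pi}) (\<lambda>t. norm (T t) powr q * (\<omega> t * u t))"
      define B where "B = integral\<^sup>L (lebesgue_on {-pi..pi}) (\<lambda>t. norm (T t) powr p * (\<omega> t * u t) powr (p / q))"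
      have u0: "0 \<le> u t" for t using reg weight_integrable(3) unfolding regular_weight_def by blast
      have J0: "0 \<le> J" unfolding J_def using u0 w(2) by (intro Bochner_Integration.integral_nonneg) auto
      have B0: "0 \<le> B" unfolding B_def by (intro Bochner_Integration.integral_nonneg) auto
      have "J \<le> C * real n powr (q / p - 1) * B powr (q / p)"
        using C(2)[OF n f(1)] unfolding J_def B_def f(2) .
      hence "J powr (1 / q) \<le> (C * real n powr (q / p - 1) * B powr (q / p)) powr (1 / q)"
        using J0 q by (intro powr_mono2) auto
      also have "\<dots> = C powr (1 / q) * real n powr ((q / p - 1) * (1 / q)) * B powr ((q / p) * (1 / q))"
        using C(1) B0 by (simp add: powr_mult powr_powr)
      also have "(q / p - 1) * (1 / q) = 1 / p - 1 / q" using p q by (simp add: field_simps)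
      also have "(q / p) * (1 / q) = 1 / p" using q by simp
      finally show "Lp_norm q (\<lambda>t. \<omega> t * u t) T
                 \<le> C powr (1 / q) * real n powr (1 / p - 1 / q) * Lp_norm p (\<lambda>t. (\<omega> t * u t) powr (p / q)) T"
        unfolding Lp_norm_def J_def B_def .
    qed
  }
  {
    fix u p assume "u \<in> A_star \<and> 0 < (p::real)"
    hence u: "u \<in> A_star" and p: "0 < p" by auto
    obtain L m K \<delta> \<kappa> where L: "0 < L" and reg: "regular_weight (2*pi) u m K \<delta> \<kappa>"
      and up: "\<And>a b t. -3*pi \<le> a \<Longrightarrow> a < b \<Longrightarrow> b \<le> 3*pi \<Longrightarrow> b - a \<le> 2*pi \<Longrightarrow> t \<in> {a..b} \<Longrightarrow> u t \<le> L * mass u a b / (b - a)"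
      using A_star_regular[OF u] by blast
    \<comment> \<open>The order of localisation is the growth exponent \<open>m\<close> of the
      masses, and \<omega> enters with the power 1.\<close>
    obtain \<delta>1 c1 where "localized (\<lambda>t. \<omega> t powr 1) m \<delta>1 c1" using loc[of 1 m] by auto
    hence l: "localized \<omega> m \<delta>1 c1" using w(2) by simp
    have wu: "weight u" using reg unfolding regular_weight_def by blast
    obtain C where C: "C > 0" "\<And>n f t. n \<ge> 1 \<Longrightarrow> trig_entire n f \<Longrightarrow> t \<in> {-pi..pi} \<Longrightarrow>
     norm (f (of_real t)) * (\<omega> t * u t) \<le> C * real n powr (1 / p) *
        (integral\<^sup>L (lebesgue_on {-pi..pi}) (\<lambda>t. norm (f (of_real t)) powr p * (\<omega> t * u t) powr p)) powr (1 / p)"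
      using nikolskii_Linf[OF reg p L up w l] by blast
    show "\<exists>C>0. \<forall>n\<ge>1. \<forall>T. trig_poly n T \<longrightarrow>
               Linf_norm (\<lambda>t. \<omega> t * u t) T
                 \<le> ereal (C * real n powr (1 / p) * Lp_norm p (\<lambda>t. (\<omega> t * u t) powr p) T)"
    proof (intro exI[of _ C] conjI allI impI C(1))
      fix n :: nat and T assume n: "1 \<le> n" and T: "trig_poly n T"
      obtain f where f: "trig_entire n f" "\<And>t. T t = f (of_real t)"
        using trig_poly_ex_entire[OF T] by blast
      have eq: "norm (T t * of_real (\<omega> t * u t)) = norm (f (of_real t)) * (\<omega> t * u t)" for t
        unfolding f(2) norm_mult norm_of_real using w(2)[of t] weight_integrable(3)[OF wu, of t] by simp
      show "Linf_norm (\<lambda>t. \<omega> t * u t) T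
                 \<le> ereal (C * real n powr (1 / p) * Lp_norm p (\<lambda>t. (\<omega> t * u t) powr p) T)"
        unfolding Linf_norm_def eq
      \<comment> \<open>\<open>esssup\<close> of a non-measurable function is \<open>top\<close>, so
        measurability is a genuine part of the claim.\<close>
      proof (rule esssup_I)
        have [measurable]: "(\<lambda>t. norm (f (of_real t))) \<in> borel_measurable (lebesgue_on {-pi..pi})"
          by (intro continuous_imp_measurable_on_sets_lebesgue continuous_intros continuous_on_real_trig_entire[OF f(1)]) auto
        have [measurable]: "\<omega> \<in> borel_measurable (lebesgue_on {-pi..pi})"
          by (rule continuous_imp_measurable_on_sets_lebesgue[OF continuous_on_subset[OF w(1)]]) auto
        have [measurable]: "u \<in> borel_measurable (lebesgue_on {-pi..pi})"
          using wu unfolding weight_def by auto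
        show "(\<lambda>t. ereal (norm (f (of_real t)) * (\<omega> t * u t))) \<in> borel_measurable (lebesgue_on {-pi..pi})"
          by measurable
        show "AE t in lebesgue_on {-pi..pi}. ereal (norm (f (of_real t)) * (\<omega> t * u t))
            \<le> ereal (C * real n powr (1 / p) * Lp_norm p (\<lambda>t. (\<omega> t * u t) powr p) T)"
          using C(2)[OF n f(1)] by (intro AE_I2) (simp add: Lp_norm_def f(2))
      qed
    qed
  }
qed

end
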